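(* Let $L>0$, $0<v<1$, $\phi^0\in H_0^1(\mathbf{I}_0)$ and $\phi^1\in L^2(\mathbf{I}_0)$, where $\mathbf{I}_t=(vt,L+vt)$. Then the solution $\phi$ of the problem $$\phi_{tt}-\phi_{xx}=0 \ \ (x\in\mathbf{I}_t,\ t\in(0,T)),\qquad \phi(vt,t)=\phi(L+vt,t)=0\ \ (t\in(0,T)),\qquad \phi(x,0)=\phi^0(x),\ \phi_t(x,0)=\phi^1(x)\ \ (x\in\mathbf{I}_0)$$ is given by the series $$\phi(x,t)=\sum_{n\in\mathbb{Z}^*}c_n\left(e^{n\pi i(1-v)(t+x)/L}-e^{n\pi i(1+v)(t-x)/L}\right),\qquad x\in\mathbf{I}_t,\ t\in(0,T),$$ where the coefficients $c_n\in\mathbb{C}$ are given by either of the two following formulas, for $n\in\mathbb{Z}^*$: $$c_n=\frac{1}{4n\pi i}\int_0^{L_2}\left(\tilde\phi^0_x+\tilde\phi^1\right)e^{-n\pi i(1-v)x/L}\,dx=\frac{1}{4n\pi i}\int_{-L_1}^{L}\left(\tilde\phi^0_x-\tilde\phi^1\right)e^{n\pi i(1+v)x/L}\,dx,$$ where $\tilde\phi^0_x$ and $\tilde\phi^1$ are the extensions of the initial data to $(-L_1,L_2)$ defined in the context.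
   Context: Here $T>0$ is arbitrary, $\mathbb{Z}^*=\mathbb{Z}\setminus\{0\}$, subscripts $t,x$ denote partial derivatives, and all data and solutions are real valued. For $0<v<1$ and data $\phi^0\in H^1_0(\mathbf{I}_0)$, $\phi^1\in L^2(\mathbf{I}_0)$, "the solution" is the (known to exist) weak solution with $\phi\in C([0,T];H_0^1(\mathbf{I}_t))$ and $\phi_t\in C([0,T];L^2(\mathbf{I}_t))$. Notation: $\gamma_v=\frac{1+v}{1-v}$, $L_1=\frac{1-v}{1+v}L$, $L_2=\frac{2}{1-v}L$. Extensions of the initial data to $(-L_1,L_2)$ (with $\phi^0_x$ the derivative of $\phi^0$): $$\tilde\phi^0_x(x)=\begin{cases}\gamma_v\,\phi^0_x(-\gamma_v x), & x\in(-L_1,0),\\ \phi^0_x(x), & x\in(0,L),\\ \frac{1}{\gamma_v}\phi^0_x\left(-\frac{x}{\gamma_v}+\frac{2L}{1+v}\right), & x\in(L,L_2),\end{cases}\qquad \tilde\phi^1(x)=\begin{cases}-\gamma_v\,\phi^1(-\gamma_v x), & x\in(-L_1,0),\\ \phi^1(x), & x\in(0,L),\\ -\frac{1}{\gamma_v}\phi^1\left(-\frac{x}{\gamma_v}+\frac{2L}{1+v}\right), & x\in(L,L_2).\end{cases}$$ *)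

theory Defs
  imports "HOL-Analysis.Analysis"
begin

section \<open>Test functions and weak derivatives\<close>

definition pderiv_dir :: "'a::euclidean_space \<Rightarrow> ('a \<Rightarrow> real) \<Rightarrow> 'a \<Rightarrow> real" where
  "pderiv_dir b f = (\<lambda>x. frechet_derivative f (at x) b)"

primrec C_k :: "nat \<Rightarrow> ('a::euclidean_space \<Rightarrow> real) \<Rightarrow> bool" where
  "C_k 0 f \<longleftrightarrow> continuous_on UNIV f"
| "C_k (Suc k) f \<longleftrightarrow> (\<forall>x. f differentiable (at x)) \<and> (\<forall>b\<in>Basis. C_k k (pderiv_dir b f))"

definition test_function :: "'a::euclidean_space set \<Rightarrow> ('a \<Rightarrow> real) \<Rightarrow> bool" where
  "test_function \<Omega> \<psi> \<longleftrightarrow>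
     (\<forall>k. C_k k \<psi>) \<and> compact (closure {x. \<psi> x \<noteq> 0}) \<and> closure {x. \<psi> x \<noteq> 0} \<subseteq> \<Omega>"

definition locally_integrable :: "'a::euclidean_space set \<Rightarrow> ('a \<Rightarrow> real) \<Rightarrow> bool" where
  "locally_integrable \<Omega> f \<longleftrightarrow> (\<forall>K. compact K \<and> K \<subseteq> \<Omega> \<longrightarrow> set_integrable lebesgue K f)"

definition weak_pderiv ::
  "'a::euclidean_space set \<Rightarrow> 'a \<Rightarrow> ('a \<Rightarrow> real) \<Rightarrow> ('a \<Rightarrow> real) \<Rightarrow> bool" where
  "weak_pderiv \<Omega> b u g \<longleftrightarrow>
     locally_integrable \<Omega> u \<and> locally_integrable \<Omega> g \<and>
     (\<forall>\<psi>. test_function \<Omega> \<psi> \<longrightarrow>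
        (LINT x:\<Omega>|lebesgue. u x * pderiv_dir b \<psi> x) = - (LINT x:\<Omega>|lebesgue. g x * \<psi> x))"

section \<open>The spaces \<open>L\<^sup>2\<close> and \<open>H\<^sup>1\<^sub>0\<close>\<close>

text \<open>Elements of these spaces are represented by functions; membership does not depend on
  the values of the function on null sets or outside \<open>\<Omega>\<close>.\<close>

definition L2_space :: "'a::euclidean_space set \<Rightarrow> ('a \<Rightarrow> real) set" where
  "L2_space \<Omega> = {f. set_borel_measurable lebesgue \<Omega> f \<and> set_integrable lebesgue \<Omega> (\<lambda>x. (f x)\<^sup>2)}"

definition L2_norm :: "'a::euclidean_space set \<Rightarrow> ('a \<Rightarrow> real) \<Rightarrow> real" where
  "L2_norm \<Omega> f = sqrt (LINT x:\<Omega>|lebesgue. (f x)\<^sup>2)"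

text \<open>\<open>H\<^sup>1\<^sub>0(\<Omega>)\<close> is the closure of the test functions in the norm of \<open>H\<^sup>1(\<Omega>)\<close>.\<close>

definition H10_space :: "real set \<Rightarrow> (real \<Rightarrow> real) set" where
  "H10_space \<Omega> = {u. u \<in> L2_space \<Omega> \<and>
     (\<exists>g\<in>L2_space \<Omega>. weak_pderiv \<Omega> 1 u g \<and>
       (\<forall>\<epsilon>>0. \<exists>\<psi>. test_function \<Omega> \<psi> \<and>
          sqrt ((L2_norm \<Omega> (\<lambda>x. u x - \<psi> x))\<^sup>2
              + (L2_norm \<Omega> (\<lambda>x. g x - pderiv_dir 1 \<psi> x))\<^sup>2) < \<epsilon>))}"

section \<open>The moving interval and the weak solution\<close>

definition moving_interval :: "real \<Rightarrow> real \<Rightarrow> real \<Rightarrow> real set" where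
  "moving_interval L v t = {v * t <..< L + v * t}"

text \<open>Points of space-time are pairs \<open>(x, t)\<close>, so that the direction of \<open>x\<close> is \<open>(1, 0)\<close>
  and that of \<open>t\<close> is \<open>(0, 1)\<close>.\<close>

definition spacetime :: "real \<Rightarrow> real \<Rightarrow> real \<Rightarrow> (real \<times> real) set" where
  "spacetime L v T = {(x, t). t \<in> {0<..<T} \<and> x \<in> moving_interval L v t}"

text \<open>Continuity in time with values in a space over the moving interval is understood after
  the translation \<open>x = y + v t\<close> to the fixed interval \<open>(0, L)\<close>.\<close>

definition C_L2 :: "real \<Rightarrow> real \<Rightarrow> real \<Rightarrow> (real \<times> real \<Rightarrow> real) \<Rightarrow> bool" where
  "C_L2 L v T f \<longleftrightarrow>
     (\<forall>t\<in>{0..T}. (\<lambda>x. f (x, t)) \<in> L2_space (moving_interval L v t)) \<and>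
     (\<forall>s\<in>{0..T}.
        ((\<lambda>t. L2_norm {0<..<L} (\<lambda>y. f (y + v * t, t) - f (y + v * s, s))) \<longlongrightarrow> 0)
          (at s within {0..T}))"

definition C_H10 :: "real \<Rightarrow> real \<Rightarrow> real \<Rightarrow> (real \<times> real \<Rightarrow> real) \<Rightarrow> bool" where
  "C_H10 L v T f \<longleftrightarrow>
     (\<forall>t\<in>{0..T}. (\<lambda>x. f (x, t)) \<in> H10_space (moving_interval L v t)) \<and>
     C_L2 L v T f \<and>
     (\<exists>fx. (\<forall>t\<in>{0..T}.
               weak_pderiv (moving_interval L v t) 1 (\<lambda>x. f (x, t)) (\<lambda>x. fx (x, t))) \<and>
           C_L2 L v T fx)"

text \<open>Each \<open>\<phi>(\<cdot>, t) \<in> H\<^sup>1\<^sub>0\<close> is represented by its continuous version on the closed interval,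
  which gives the boundary values (and all point values of \<open>\<phi>\<close>) their meaning.  The wave
  equation holds in the sense of distributions.\<close>

definition weak_solution ::
  "real \<Rightarrow> real \<Rightarrow> real \<Rightarrow> (real \<Rightarrow> real) \<Rightarrow> (real \<Rightarrow> real) \<Rightarrow> (real \<times> real \<Rightarrow> real) \<Rightarrow> bool" where
  "weak_solution L v T \<phi>0 \<phi>1 \<phi> \<longleftrightarrow>
     C_H10 L v T \<phi> \<and>
     (\<forall>t\<in>{0..T}. continuous_on {v * t..L + v * t} (\<lambda>x. \<phi> (x, t))) \<and>
     (\<forall>\<psi>. test_function (spacetime L v T) \<psi> \<longrightarrow>
        (LINT p:spacetime L v T|lebesgue.
           \<phi> p * (pderiv_dir (0, 1) (pderiv_dir (0, 1) \<psi>) p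
                 - pderiv_dir (1, 0) (pderiv_dir (1, 0) \<psi>) p)) = 0) \<and>
     (\<forall>t\<in>{0<..<T}. \<phi> (v * t, t) = 0 \<and> \<phi> (L + v * t, t) = 0) \<and>
     (AE x in lebesgue. x \<in> moving_interval L v 0 \<longrightarrow> \<phi> (x, 0) = \<phi>0 x) \<and>
     (\<exists>\<phi>t. weak_pderiv (spacetime L v T) (0, 1) \<phi> \<phi>t \<and> C_L2 L v T \<phi>t \<and>
        (AE x in lebesgue. x \<in> moving_interval L v 0 \<longrightarrow> \<phi>t (x, 0) = \<phi>1 x))"

section \<open>Extended data and coefficients\<close>

definition gam :: "real \<Rightarrow> real" where
  "gam v = (1 + v) / (1 - v)"

definition L_left :: "real \<Rightarrow> real \<Rightarrow> real" where
  "L_left L v = (1 - v) / (1 + v) * L"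

definition L_right :: "real \<Rightarrow> real \<Rightarrow> real" where
  "L_right L v = 2 / (1 - v) * L"

text \<open>The extensions live on \<open>(-L\<^sub>1, L\<^sub>2)\<close> = \<open>(- L_left L v, L_right L v)\<close>; the value 0 at the
  break points and outside that interval is a dummy.\<close>

definition ext_dphi0 :: "real \<Rightarrow> real \<Rightarrow> (real \<Rightarrow> real) \<Rightarrow> real \<Rightarrow> real" where
  "ext_dphi0 L v \<phi>0x x =
     (if x \<in> {- L_left L v<..<0} then gam v * \<phi>0x (- gam v * x)
      else if x \<in> {0<..<L} then \<phi>0x x
      else if x \<in> {L<..<L_right L v} then 1 / gam v * \<phi>0x (- x / gam v + 2 * L / (1 + v))
      else 0)"

definition ext_phi1 :: "real \<Rightarrow> real \<Rightarrow> (real \<Rightarrow> real) \<Rightarrow> real \<Rightarrow> real" where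
  "ext_phi1 L v \<phi>1 x =
     (if x \<in> {- L_left L v<..<0} then - gam v * \<phi>1 (- gam v * x)
      else if x \<in> {0<..<L} then \<phi>1 x
      else if x \<in> {L<..<L_right L v} then - (1 / gam v) * \<phi>1 (- x / gam v + 2 * L / (1 + v))
      else 0)"

definition coeff_right ::
  "real \<Rightarrow> real \<Rightarrow> (real \<Rightarrow> real) \<Rightarrow> (real \<Rightarrow> real) \<Rightarrow> int \<Rightarrow> complex" where
  "coeff_right L v \<phi>0x \<phi>1 n =
     1 / (4 * of_int n * of_real pi * \<i>) *
     (LINT x:{0<..<L_right L v}|lebesgue.
        complex_of_real (ext_dphi0 L v \<phi>0x x + ext_phi1 L v \<phi>1 x) *
        exp (- (of_int n * of_real pi * \<i> * of_real ((1 - v) * x / L))))"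

definition coeff_left ::
  "real \<Rightarrow> real \<Rightarrow> (real \<Rightarrow> real) \<Rightarrow> (real \<Rightarrow> real) \<Rightarrow> int \<Rightarrow> complex" where
  "coeff_left L v \<phi>0x \<phi>1 n =
     1 / (4 * of_int n * of_real pi * \<i>) *
     (LINT x:{- L_left L v<..<L}|lebesgue.
        complex_of_real (ext_dphi0 L v \<phi>0x x - ext_phi1 L v \<phi>1 x) *
        exp (of_int n * of_real pi * \<i> * of_real ((1 + v) * x / L)))"

end

theory Submission
  imports Defs
begin

text \<open>In the characteristic variables \<open>\<xi> = t + x\<close> and \<open>\<eta> = t - x\<close> a solution of the wave equation has
  the form \<open>F \<xi> + G \<eta>\<close>.  Vanishing on the side \<open>x = v t\<close> means \<open>G \<eta> = - F (\<gamma> \<eta>)\<close> with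
  \<open>\<gamma> = (1 + v) / (1 - v)\<close>, and vanishing on the side \<open>x = L + v t\<close> then means that \<open>F\<close> has the period
  \<open>P = L + \<gamma> L\<close>, which is \<open>L\<^sub>2\<close>.  The data prescribe \<open>2 F'\<close> on one period: it is \<open>\<phi>\<^sup>0\<^sub>x + \<phi>\<^sup>1\<close> on
  \<open>(0, L)\<close>, and reflection at the moving side yields its values on \<open>(L, P)\<close>; this is what the extended
  data express.  So \<open>F'\<close> is square-integrable over a period, the Fourier series of \<open>F\<close> converges
  absolutely, an integration by parts turns the coefficients of \<open>F\<close> into integrals of \<open>F'\<close>, and
  \<open>F (t + x) - F (\<gamma> (t - x))\<close> is the series to be established, in which the mean of \<open>F\<close> cancels.  The
  second formula for the coefficients arises from the first by the substitution \<open>y = - \<gamma> x\<close> and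
  a shift by a period.

  For a weak solution none of this holds pointwise at the outset.  A one-dimensional Sobolev estimate
  (\<open>sup_le_L2_norms\<close>) turns continuity in time with values in \<open>H\<^sup>1\<^sub>0\<close> into joint continuity of \<open>\<phi>\<close> up to
  the boundary.  For a continuous function, testing the equation with a product of smooth cutoffs in
  \<open>\<xi>\<close> and \<open>\<eta>\<close> gives in the limit the parallelogram identity: over the corners of a
  rectangle with characteristic sides the values of \<open>\<phi>\<close> have equal sums along the two diagonals
  (\<open>wave_equation_char_rect\<close>, \<open>char_additive_solution\<close>).  In the triangle over the initial interval
  this identity expresses \<open>\<phi>\<close> by its values at time 0 and on one characteristic; comparing with the
  weak time derivative at time 0 identifies the latter, which is d'Alembert's formula (\<open>dalembert\<close>).  The candidate
  \<open>F (t + x) - F (\<gamma> (t - x))\<close> satisfies the parallelogram identity, vanishes on both sides and obeys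
  d'Alembert's formula as well.  The difference from \<open>\<phi>\<close> therefore vanishes in the triangle, and the
  parallelogram identity carries this zero through reflections at the sides to the whole strip
  (\<open>char_additive_zero\<close>).

  The convergence theorem for Fourier series is \<open>fourier_series_antiderivative\<close>.  Bessel's
  inequality gives absolute convergence, and \<open>fourier_uniqueness\<close> identifies the sum.\<close>

section \<open>Smooth functions\<close>

lemma pderiv_dir_eq:
  assumes "\<And>x. (f has_derivative f' x) (at x)"
  shows "pderiv_dir b f = (\<lambda>x. f' x b)"
  unfolding pderiv_dir_def by (metis assms frechet_derivative_at)

lemma C_k_SucI:
  assumes "\<And>x. (f has_derivative f' x) (at x)" "\<And>b. b \<in> Basis \<Longrightarrow> C_k k (\<lambda>x. f' x b)"
  shows "C_k (Suc k) f"
  using assms by (auto simp: pderiv_dir_eq[OF assms(1)] differentiable_def)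

lemma C_k_SucD:
  assumes "C_k (Suc k) f"
  obtains f' where "\<And>x. (f has_derivative f' x) (at x)" "\<And>b. b \<in> Basis \<Longrightarrow> C_k k (\<lambda>x. f' x b)"
proof
  show "(f has_derivative frechet_derivative f (at x)) (at x)" for x
    using assms by (simp add: frechet_derivative_works)
  show "C_k k (\<lambda>x. frechet_derivative f (at x) b)" if "b \<in> Basis" for b
    using assms that by (simp add: pderiv_dir_def[abs_def])
qed

text \<open>The recursion in the definition of \<open>C_k\<close> yields continuity only at level 0, but a
  differentiable function is continuous, so the levels are nested.\<close>

lemma C_k_lower: "C_k (Suc k) f \<Longrightarrow> C_k k f"
proof (induction k arbitrary: f)
  case 0
  then show ?case
    by (auto intro!: continuous_at_imp_continuous_on differentiable_imp_continuous_within)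
next
  case (Suc k)
  then show ?case by auto
qed

lemma C_k_const: "C_k k (\<lambda>x. c)"
proof (induction k arbitrary: c)
  case (Suc k)
  show ?case by (rule C_k_SucI[where f' = "\<lambda>x b. 0"]) (auto simp: Suc)
qed simp

lemma C_k_add:
  "C_k k f \<Longrightarrow> C_k k g \<Longrightarrow> C_k k (\<lambda>x. f x + g x)"
proof (induction k arbitrary: f g)
  case 0
  then show ?case by (simp add: continuous_on_add)
next
  case (Suc k)
  obtain f' where f: "\<And>x. (f has_derivative f' x) (at x)" "\<And>b. b \<in> Basis \<Longrightarrow> C_k k (\<lambda>x. f' x b)"
    using C_k_SucD[OF Suc.prems(1)] by metis
  obtain g' where g: "\<And>x. (g has_derivative g' x) (at x)" "\<And>b. b \<in> Basis \<Longrightarrow> C_k k (\<lambda>x. g' x b)"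
    using C_k_SucD[OF Suc.prems(2)] by metis
  show ?case
    by (rule C_k_SucI[where f' = "\<lambda>x h. f' x h + g' x h"])
      (auto intro!: has_derivative_add f g Suc.IH)
qed

lemma C_k_mult:
  "C_k k f \<Longrightarrow> C_k k g \<Longrightarrow> C_k k (\<lambda>x. f x * g x)"
proof (induction k arbitrary: f g)
  case 0
  then show ?case by (simp add: continuous_on_mult)
next
  case (Suc k)
  obtain f' where f: "\<And>x. (f has_derivative f' x) (at x)" "\<And>b. b \<in> Basis \<Longrightarrow> C_k k (\<lambda>x. f' x b)"
    using C_k_SucD[OF Suc.prems(1)] by metis
  obtain g' where g: "\<And>x. (g has_derivative g' x) (at x)" "\<And>b. b \<in> Basis \<Longrightarrow> C_k k (\<lambda>x. g' x b)"
    using C_k_SucD[OF Suc.prems(2)] by metis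
  show ?case
    by (rule C_k_SucI[where f' = "\<lambda>x h. f x * g' x h + f' x h * g x"])
      (auto intro!: has_derivative_mult f g Suc.IH C_k_add Suc.prems[THEN C_k_lower])
qed

definition smooth :: "('a::euclidean_space \<Rightarrow> real) \<Rightarrow> bool" where
  "smooth f \<longleftrightarrow> (\<forall>k. C_k k f)"

lemma smooth_const: "smooth (\<lambda>x. c)"
  and smooth_add: "smooth f \<Longrightarrow> smooth g \<Longrightarrow> smooth (\<lambda>x. f x + g x)"
  and smooth_mult: "smooth f \<Longrightarrow> smooth g \<Longrightarrow> smooth (\<lambda>x. f x * g x)"
  by (simp_all add: smooth_def C_k_const C_k_add C_k_mult)

lemma smooth_diff: "smooth f \<Longrightarrow> smooth g \<Longrightarrow> smooth (\<lambda>x. f x - g x)"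
  using smooth_add[OF _ smooth_mult[OF smooth_const[of "-1"]], of f g] by simp

lemma smooth_continuous: "smooth f \<Longrightarrow> continuous_on S f"
  using continuous_on_subset[of UNIV f S] by (auto simp: smooth_def dest: spec[of _ 0])

lemma C_k_real_Suc:
  fixes a :: "real \<Rightarrow> real"
  assumes "\<And>x. (a has_real_derivative a' x) (at x)"
  shows "C_k (Suc k) a \<longleftrightarrow> C_k k a'"
proof -
  have "pderiv_dir 1 a = a'"
    using pderiv_dir_eq[of a "\<lambda>x. (*) (a' x)" 1] assms by (simp add: has_field_derivative_def)
  moreover have "\<forall>x. a differentiable at x"
    using assms real_differentiable_def by blast
  ultimately show ?thesis by simp
qed

text \<open>Smoothness passes from a derivative to its antiderivative, so a smooth step can be built
  as the integral of a bump.\<close>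

lemma smooth_real_iff_deriv:
  fixes a :: "real \<Rightarrow> real"
  assumes "\<And>x. (a has_real_derivative a' x) (at x)"
  shows "smooth a \<longleftrightarrow> smooth a'"
  unfolding smooth_def using C_k_real_Suc[OF assms] C_k_lower by metis

lemma smooth_real_deriv:
  fixes a :: "real \<Rightarrow> real"
  assumes "smooth a"
  obtains a' where "\<And>x. (a has_real_derivative a' x) (at x)" "smooth a'"
proof -
  have "\<And>x. a differentiable at x" using assms C_k.simps(2) unfolding smooth_def by blast
  then obtain a' where "\<And>x. (a has_real_derivative a' x) (at x)"
    unfolding real_differentiable_def by metis
  then show thesis using that smooth_real_iff_deriv assms by blast
qed

lemma C_k_affine:
  fixes a :: "real \<Rightarrow> real" and l :: "'a::euclidean_space \<Rightarrow> real"
  assumes l: "bounded_linear l"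
  shows "smooth a \<Longrightarrow> C_k k (\<lambda>p. a (l p + c))"
proof (induction k arbitrary: a)
  case 0
  have "continuous_on UNIV (\<lambda>p. l p + c)"
    by (intro continuous_intros bounded_linear.continuous_on[OF l])
  from continuous_on_compose[OF this smooth_continuous[OF 0]] show ?case by (simp add: o_def)
next
  case (Suc k)
  obtain a' where a': "\<And>x. (a has_real_derivative a' x) (at x)" "smooth a'"
    using smooth_real_deriv Suc.prems by blast
  show ?case
  proof (rule C_k_SucI[where f' = "\<lambda>p h. a' (l p + c) * l h"])
    show "((\<lambda>p. a (l p + c)) has_derivative (\<lambda>h. a' (l p + c) * l h)) (at p)" for p
    proof -
      have "((\<lambda>p. l p + c) has_derivative l) (at p)"
        by (rule has_derivative_add_const[OF bounded_linear_imp_has_derivative[OF l]])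
      from has_derivative_compose[OF this, of a "(*) (a' (l p + c))"] a' show ?thesis
        by (simp add: has_field_derivative_def)
    qed
    show "C_k k (\<lambda>p. a' (l p + c) * l b)" for b
      by (intro C_k_mult C_k_const Suc.IH a')
  qed
qed

lemma smooth_affine:
  fixes a :: "real \<Rightarrow> real" and l :: "'a::euclidean_space \<Rightarrow> real"
  assumes "bounded_linear l" "smooth a"
  shows "smooth (\<lambda>p. a (l p + c))"
  using C_k_affine[OF assms] by (simp add: smooth_def)

section \<open>Mollifiers and cutoff functions\<close>

text \<open>The functions that are flat to infinite order at 0, with the powers of \<open>1 / x\<close> that
  differentiation produces.\<close>

definition flat :: "nat \<Rightarrow> real \<Rightarrow> real" where
  "flat n x = (if x \<le> 0 then 0 else inverse x ^ n * exp (- inverse x))"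

lemma flat_tendsto_0: "(flat n \<longlongrightarrow> 0) (at 0)"
proof -
  have lim: "((\<lambda>x. inverse x ^ n / exp (inverse x)) \<longlongrightarrow> 0) (at_right (0::real))"
    by (rule filterlim_compose[OF tendsto_power_div_exp_0[of n] filterlim_inverse_at_top_right])
  have "\<forall>\<^sub>F x in at_right 0. inverse x ^ n / exp (inverse x) = flat n x"
    unfolding eventually_at_filter
    by (rule always_eventually) (simp add: flat_def exp_minus divide_inverse)
  from Lim_transform_eventually[OF lim this]
  have "(flat n \<longlongrightarrow> 0) (at_right 0)" .
  moreover have "\<forall>\<^sub>F x in at_left 0. flat n x = 0"
    unfolding eventually_at_filter by (rule always_eventually) (simp add: flat_def)
  then have "(flat n \<longlongrightarrow> 0) (at_left 0)"
    by (rule tendsto_eventually)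
  ultimately show ?thesis by (simp add: filterlim_at_split)
qed

text \<open>The family \<open>x\<^sup>-\<^sup>n exp (- 1 / x)\<close>, extended by 0, is closed under differentiation up to
  linear combinations; this makes every member smooth at once.\<close>

lemma flat_has_derivative:
  "(flat n has_real_derivative flat (n + 2) x - real n * flat (n + 1) x) (at x)"
proof -
  consider "x < 0" | "x = 0" | "x > 0" by linarith
  then show ?thesis
  proof cases
    case 1
    have "(flat n has_real_derivative 0) (at x)"
      by (rule has_field_derivative_transform_within_open[OF DERIV_const[of 0], of "{..<0}"])
        (use 1 in \<open>auto simp: flat_def\<close>)
    then show ?thesis using 1 by (simp add: flat_def)
  next
    case 2
    have "\<forall>\<^sub>F h in at 0. flat (Suc n) h = (flat n (0 + h) - flat n 0) / h"
      unfolding eventually_at_filter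
      by (rule always_eventually) (simp add: flat_def divide_inverse)
    from Lim_transform_eventually[OF flat_tendsto_0 this]
    have "((\<lambda>h. (flat n (0 + h) - flat n 0) / h) \<longlongrightarrow> 0) (at 0)" .
    then show ?thesis using 2 by (simp add: DERIV_def flat_def)
  next
    case 3
    have e: "real n * (- inverse (x ^ Suc (Suc 0)) * inverse x ^ (n - 1)) * exp (- inverse x) +
          exp (- inverse x) * inverse (x ^ Suc (Suc 0)) * inverse x ^ n
        = flat (n + 2) x - real n * flat (n + 1) x"
      using 3 by (cases n) (simp_all add: flat_def algebra_simps)
    have "((\<lambda>x. inverse x ^ n * exp (- inverse x)) has_real_derivative
        flat (n + 2) x - real n * flat (n + 1) x) (at x)"
      unfolding e[symmetric] using 3
      by (auto intro!: derivative_eq_intros)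
    then show ?thesis
      by (rule has_field_derivative_transform_within_open[of _ _ _ "{0<..}"])
        (use 3 in \<open>auto simp: flat_def\<close>)
  qed
qed

lemma smooth_flat: "smooth (flat n)"
proof -
  have "C_k k (flat n)" for k
  proof (induction k arbitrary: n)
    case 0
    have "isCont (flat n) x" for x using flat_has_derivative DERIV_isCont by blast
    then show ?case by (simp add: continuous_at_imp_continuous_on)
  next
    case (Suc k)
    have "C_k k (\<lambda>x. flat (n + 2) x + - real n * flat (n + 1) x)"
      by (intro C_k_add C_k_mult C_k_const Suc)
    then show ?case by (subst C_k_real_Suc[OF flat_has_derivative]) simp
  qed
  then show ?thesis by (simp add: smooth_def)
qed

definition bump :: "real \<Rightarrow> real" where
  "bump x = flat 0 (1 + x) * flat 0 (1 - x)"

lemma bump_nonneg: "bump x \<ge> 0"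
  and bump_eq_0_iff: "bump x = 0 \<longleftrightarrow> \<bar>x\<bar> \<ge> 1"
  by (auto simp: bump_def flat_def)

lemma smooth_bump: "smooth bump"
  using smooth_mult[OF smooth_affine[OF bounded_linear_ident smooth_flat[of 0], of 1]
      smooth_affine[OF bounded_linear_minus[OF bounded_linear_ident] smooth_flat[of 0], of 1]]
  unfolding bump_def[abs_def] by (simp add: algebra_simps)

lemma bump_integral_pos: "integral {-1..1} bump > 0"
proof -
  have c: "continuous_on {-1..1} bump" by (rule smooth_continuous[OF smooth_bump])
  have "bump 0 \<noteq> 0" by (simp add: bump_eq_0_iff)
  then have "integral {-1..1} bump \<noteq> 0"
    using integral_eq_0_iff[OF c] by (auto simp: bump_nonneg intro!: bexI[of _ 0])
  moreover have "integral {-1..1} bump \<ge> 0" by (simp add: Henstock_Kurzweil_Integration.integral_nonneg bump_nonneg c integrable_continuous_real)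
  ultimately show ?thesis by linarith
qed

definition mollifier :: "real \<Rightarrow> real" where
  "mollifier x = bump x / integral {-1..1} bump"

definition smooth_step :: "real \<Rightarrow> real" where
  "smooth_step x = (if x \<le> -1 then 0 else integral {-1..x} mollifier)"

lemma smooth_mollifier: "smooth mollifier"
  using smooth_mult[OF smooth_bump smooth_const[of "1 / integral {-1..1} bump"]]
  unfolding mollifier_def[abs_def] by simp

lemma mollifier_nonneg: "mollifier x \<ge> 0"
  and mollifier_eq_0_iff: "mollifier x = 0 \<longleftrightarrow> \<bar>x\<bar> \<ge> 1"
  using bump_integral_pos by (auto simp: mollifier_def bump_nonneg bump_eq_0_iff)

lemma integrable_mollifier: "mollifier integrable_on {a..b}"
  by (rule integrable_continuous_real[OF smooth_continuous[OF smooth_mollifier]])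

lemma integral_mollifier_outside:
  assumes "b \<le> -1 \<or> a \<ge> 1" shows "integral {a..b} mollifier = 0"
proof -
  have "integral {a..b} mollifier = integral {a..b} (\<lambda>x. 0)"
    by (rule integral_cong) (use assms in \<open>auto simp: mollifier_eq_0_iff\<close>)
  then show ?thesis by simp
qed

lemma smooth_step_eq_integral:
  assumes "c \<le> -1" "c \<le> x" shows "smooth_step x = integral {c..x} mollifier"
proof (cases "x \<le> -1")
  case True
  then show ?thesis using integral_mollifier_outside[of x c] by (simp add: smooth_step_def)
next
  case False
  then show ?thesis
    using Henstock_Kurzweil_Integration.integral_combine[of c "-1" x mollifier]
      integrable_mollifier integral_mollifier_outside[of "-1" c] assms
    by (simp add: smooth_step_def)
qed

lemma smooth_step_has_derivative: "(smooth_step has_real_derivative mollifier x) (at x)"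
proof -
  define c where "c = min (-1) (x - 1)"
  have "((\<lambda>x. integral {c..x} mollifier) has_vector_derivative mollifier x) (at x within {c..x+1})"
    by (rule integral_has_vector_derivative[OF smooth_continuous[OF smooth_mollifier]])
      (auto simp: c_def)
  then have "((\<lambda>x. integral {c..x} mollifier) has_real_derivative mollifier x) (at x)"
    by (subst (asm) at_within_interior)
      (auto simp: c_def has_real_derivative_iff_has_vector_derivative)
  then show ?thesis
    by (rule has_field_derivative_transform_within_open[of _ _ _ "{c<..}"])
      (auto simp: c_def intro!: smooth_step_eq_integral[symmetric])
qed

lemma smooth_smooth_step: "smooth smooth_step"
  using smooth_real_iff_deriv[OF smooth_step_has_derivative] smooth_mollifier by simp

lemma smooth_step_eq_0: "x \<le> -1 \<Longrightarrow> smooth_step x = 0"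
  by (simp add: smooth_step_def)

lemma smooth_step_eq_1:
  assumes "x \<ge> 1" shows "smooth_step x = 1"
proof -
  have "integral {-1..1} mollifier = 1"
    using bump_integral_pos unfolding mollifier_def[abs_def] by simp
  then show ?thesis
    using Henstock_Kurzweil_Integration.integral_combine[of "-1" 1 x mollifier]
      integrable_mollifier integral_mollifier_outside[of x 1] assms
    by (simp add: smooth_step_def)
qed

lemma smooth_step_mono: "x \<le> y \<Longrightarrow> smooth_step x \<le> smooth_step y"
  by (rule DERIV_nonneg_imp_nondecreasing)
    (use smooth_step_has_derivative mollifier_nonneg in blast)+

lemma smooth_step_bounds: "0 \<le> smooth_step x" "smooth_step x \<le> 1"
  using smooth_step_mono[of "min (-1) x" x] smooth_step_mono[of x "max 1 x"]
    smooth_step_eq_0[of "min (-1) x"] smooth_step_eq_1[of "max 1 x"] by simp_all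

lemma smooth_step_tendsto:
  assumes "e \<longlonglongrightarrow> 0" "\<And>n. e n > 0" "s \<noteq> (p::real)"
  shows "(\<lambda>n. smooth_step ((s - p) / e n)) \<longlonglongrightarrow> (if p < s then 1 else 0)"
proof (rule tendsto_eventually)
  have "\<forall>\<^sub>F n in sequentially. e n < \<bar>s - p\<bar>"
    using order_tendstoD(2)[OF assms(1), of "\<bar>s - p\<bar>"] assms(3) by simp
  then show "\<forall>\<^sub>F n in sequentially. smooth_step ((s - p) / e n) = (if p < s then 1 else 0)"
  proof eventually_elim
    case (elim n)
    show ?case
    proof (cases "p < s")
      case True
      then have "(s - p) / e n \<ge> 1" using elim assms(2)[of n] by (simp add: field_simps)
      then show ?thesis using True smooth_step_eq_1 by simp
    next
      case False
      then have "(s - p) / e n \<le> -1" using elim assms(2)[of n] by (simp add: field_simps)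
      then show ?thesis using False smooth_step_eq_0 by simp
    qed
  qed
qed

definition cutoff :: "real \<Rightarrow> real \<Rightarrow> real \<Rightarrow> real \<Rightarrow> real" where
  "cutoff e p q s = smooth_step ((s - p) / e) - smooth_step ((s - q) / e)"

definition cutoff_deriv :: "real \<Rightarrow> real \<Rightarrow> real \<Rightarrow> real \<Rightarrow> real" where
  "cutoff_deriv e p q s = (mollifier ((s - p) / e) - mollifier ((s - q) / e)) / e"

lemma smooth_rescale:
  fixes a :: "real \<Rightarrow> real"
  assumes "smooth a" shows "smooth (\<lambda>s. a ((s - p) / e))"
  using smooth_affine[OF bounded_linear_divide[of e] assms, of "- p / e"] by (simp add: diff_divide_distrib)

lemma smooth_cutoff: "smooth (cutoff e p q)"
  unfolding cutoff_def[abs_def] by (intro smooth_diff smooth_rescale smooth_smooth_step)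

lemma cutoff_has_derivative:
  assumes "e \<noteq> 0" shows "(cutoff e p q has_real_derivative cutoff_deriv e p q s) (at s)"
proof -
  have "((\<lambda>s. smooth_step ((s - p) / e)) has_real_derivative mollifier ((s - p) / e) * (1 / e)) (at s)" for p
    by (rule DERIV_chain2[OF smooth_step_has_derivative]) (use assms in \<open>auto intro!: derivative_eq_intros\<close>)
  from DERIV_diff[OF this[of p] this[of q]] show ?thesis
    unfolding cutoff_def[abs_def] cutoff_deriv_def by (simp add: diff_divide_distrib)
qed

lemma cutoff_bounds:
  assumes "e > 0" "p \<le> q" shows "0 \<le> cutoff e p q s" "cutoff e p q s \<le> 1"
proof -
  have "smooth_step ((s - q) / e) \<le> smooth_step ((s - p) / e)"
    using assms by (intro smooth_step_mono divide_right_mono) auto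
  then show "0 \<le> cutoff e p q s" by (simp add: cutoff_def)
  show "cutoff e p q s \<le> 1"
    using smooth_step_bounds[of "(s - p) / e"] smooth_step_bounds[of "(s - q) / e"] by (simp add: cutoff_def)
qed

lemma cutoff_outside:
  assumes "e > 0" "p \<le> q" "s \<notin> {p - e..q + e}"
  shows "cutoff e p q s = 0" "cutoff_deriv e p q s = 0"
proof -
  have "(s - p) / e \<le> -1 \<and> (s - q) / e \<le> -1 \<or> (s - p) / e \<ge> 1 \<and> (s - q) / e \<ge> 1"
    using assms by (auto simp: field_simps)
  moreover from this have "mollifier ((s - p) / e) = 0 \<and> mollifier ((s - q) / e) = 0"
    unfolding mollifier_eq_0_iff by linarith
  ultimately show "cutoff e p q s = 0" "cutoff_deriv e p q s = 0"
    by (auto simp: cutoff_def cutoff_deriv_def smooth_step_eq_0 smooth_step_eq_1)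
qed

text \<open>As the transition layers shrink, the cutoff becomes the indicator of the interval, away
  from its end points.\<close>

lemma cutoff_tendsto:
  assumes "e \<longlonglongrightarrow> 0" "\<And>n. e n > 0" "p \<le> q" "s \<noteq> p" "s \<noteq> q"
  shows "(\<lambda>n. cutoff (e n) p q s) \<longlonglongrightarrow> indicator {p..q} s"
proof -
  have "indicator {p..q} s = (if p < s then 1 else 0) - (if q < s then 1 else (0::real))"
    using assms by (auto simp: indicator_def)
  then show ?thesis
    unfolding cutoff_def by (simp only:) (intro tendsto_diff smooth_step_tendsto assms)
qed

lemma integral_mollifier_rescaled:
  assumes "e > 0"
  shows "integral {p - e..p + e} (\<lambda>s. mollifier ((s - p) / e)) = e"
proof -
  have "((\<lambda>s. mollifier ((s - p) / e)) has_integral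
      e * smooth_step ((p + e - p) / e) - e * smooth_step ((p - e - p) / e)) {p - e..p + e}"
  proof (rule fundamental_theorem_of_calculus)
    show "((\<lambda>s. e * smooth_step ((s - p) / e)) has_vector_derivative mollifier ((s - p) / e))
        (at s within {p - e..p + e})" for s
    proof -
      have "((\<lambda>s. smooth_step ((s - p) / e)) has_real_derivative mollifier ((s - p) / e) * (1 / e)) (at s)"
        by (rule DERIV_chain2[OF smooth_step_has_derivative])
          (use assms in \<open>auto intro!: derivative_eq_intros\<close>)
      from DERIV_cmult[OF this, of e] show ?thesis
        using assms by (auto simp: has_real_derivative_iff_has_vector_derivative
            intro: has_vector_derivative_at_within)
    qed
  qed (use assms in auto)
  then show ?thesis
    using assms by (simp add: integral_unique smooth_step_eq_0 smooth_step_eq_1)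
qed

lemma mollifier_rescaled_outside:
  assumes "e > 0" "s \<notin> {p - e..p + e}" shows "mollifier ((s - p) / e) = 0"
proof -
  have "\<bar>s - p\<bar> / e \<ge> 1" using assms by (auto simp: field_simps)
  then show ?thesis using assms by (simp add: mollifier_eq_0_iff)
qed

lemma smooth_supported_test_function:
  assumes "smooth \<psi>" "compact K" "K \<subseteq> \<Omega>" "\<And>x. x \<notin> K \<Longrightarrow> \<psi> x = 0"
  shows "test_function \<Omega> \<psi>"
proof -
  have "closure {x. \<psi> x \<noteq> 0} \<subseteq> K"
    using assms(2,4) by (intro closure_minimal) (auto simp: compact_imp_closed)
  then have "compact (closure {x. \<psi> x \<noteq> 0})"
    using compact_Int_closed[OF assms(2) closed_closure, of "{x. \<psi> x \<noteq> 0}"]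
    by (simp only: Int_absorb1)
  then show ?thesis
    using \<open>closure {x. \<psi> x \<noteq> 0} \<subseteq> K\<close> assms by (auto simp: test_function_def smooth_def)
qed

lemma set_integrable_continuous_compact:
  fixes f :: "'a::euclidean_space \<Rightarrow> real"
  assumes "compact K" "continuous_on K f" shows "set_integrable lebesgue K f"
  using borel_integrable_compact[OF assms] unfolding set_integrable_def
  by (subst integrable_completion) auto

lemma set_integral_restrict:
  assumes "K \<subseteq> \<Omega>" "\<And>x. x \<in> \<Omega> - K \<Longrightarrow> f x = 0"
  shows "(LINT x:\<Omega>|M. f x) = (LINT x:K|M. f x)"
  unfolding set_lebesgue_integral_def
  by (rule arg_cong[where f = "integral\<^sup>L M"]) (use assms in \<open>auto simp: indicator_def fun_eq_iff\<close>)

text \<open>Weighting by a nonnegative kernel is an average up to the kernel's mass, so it deviates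
  from a value at one point no more than the function does on the kernel's support.\<close>

lemma kernel_average:
  fixes k u :: "'a::euclidean_space \<Rightarrow> real"
  assumes "compact K" "K \<subseteq> \<Omega>" "continuous_on K u" "continuous_on K k"
    and "\<And>x. x \<in> K \<Longrightarrow> k x \<ge> 0" "\<And>x. x \<notin> K \<Longrightarrow> k x = 0"
    and "\<And>x. x \<in> K \<Longrightarrow> \<bar>u x - c\<bar> \<le> \<eta>"
  shows "\<bar>(LINT x:\<Omega>|lebesgue. u x * k x) - c * (LINT x:K|lebesgue. k x)\<bar>
      \<le> \<eta> * (LINT x:K|lebesgue. k x)"
proof -
  have bound: "u x \<le> c + \<eta>" "c - \<eta> \<le> u x" if "x \<in> K" for x
    using assms(7)[OF that] by (auto simp: abs_le_iff)
  have int: "set_integrable lebesgue K (\<lambda>x. u x * k x)" "set_integrable lebesgue K k"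
    by (intro set_integrable_continuous_compact continuous_intros assms)+
  have "(LINT x:\<Omega>|lebesgue. u x * k x) = (LINT x:K|lebesgue. u x * k x)"
    by (rule set_integral_restrict) (use assms in auto)
  moreover have "(LINT x:K|lebesgue. u x * k x) \<le> (LINT x:K|lebesgue. (c + \<eta>) * k x)"
    using assms(5) bound(1)
    by (intro set_integral_mono set_integrable_mult_right mult_right_mono int) auto
  moreover have "(LINT x:K|lebesgue. u x * k x) \<ge> (LINT x:K|lebesgue. (c - \<eta>) * k x)"
    using assms(5) bound(2)
    by (intro set_integral_mono set_integrable_mult_right mult_right_mono int) auto
  moreover have "(LINT x:K|lebesgue. (c + \<eta>) * k x) = (c + \<eta>) * (LINT x:K|lebesgue. k x)"
    and "(LINT x:K|lebesgue. (c - \<eta>) * k x) = (c - \<eta>) * (LINT x:K|lebesgue. k x)" by simp_all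
  ultimately show ?thesis unfolding abs_le_iff by (simp only:) (simp add: algebra_simps)
qed

text \<open>Lets a smooth test function tend to the indicator of a set, by dominated convergence.\<close>

lemma cutoff_family_limit:
  fixes g :: "'a::euclidean_space \<Rightarrow> real" and k :: "nat \<Rightarrow> 'a \<Rightarrow> real"
  assumes g: "set_integrable lebesgue K g" and K: "K \<subseteq> \<Omega>" "B \<subseteq> K" "B \<in> sets lebesgue"
    and k: "\<And>n. continuous_on UNIV (k n)" "\<And>n x. \<bar>k n x\<bar> \<le> 1" "\<And>n x. x \<notin> K \<Longrightarrow> k n x = 0"
    and lim: "AE x in lebesgue. (\<lambda>n. k n x) \<longlonglongrightarrow> indicator B x"
  shows "(\<lambda>n. LINT x:\<Omega>|lebesgue. g x * k n x) \<longlonglongrightarrow> (LINT x:B|lebesgue. g x)"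
proof -
  let ?g = "\<lambda>x. indicator K x *\<^sub>R g x"
  have int: "integrable lebesgue ?g" using g by (simp add: set_integrable_def)
  have meas: "k n \<in> borel_measurable lebesgue" for n
    by (rule measurable_completion) (simp add: borel_measurable_continuous_onI k(1))
  have B: "indicator B \<in> borel_measurable lebesgue" using K(3) by simp
  have "(\<lambda>n. LINT x|lebesgue. ?g x * k n x) \<longlonglongrightarrow> (LINT x|lebesgue. ?g x * indicator B x)"
  proof (rule integral_dominated_convergence[where w = "\<lambda>x. \<bar>?g x\<bar>"])
    show "AE x in lebesgue. (\<lambda>n. ?g x * k n x) \<longlonglongrightarrow> ?g x * indicator B x"
      using lim by eventually_elim (rule tendsto_mult_left)
    show "AE x in lebesgue. norm (?g x * k n x) \<le> \<bar>?g x\<bar>" for n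
      using k(2)[of n] by (auto simp: abs_mult intro!: mult_left_le)
    show "(\<lambda>x. ?g x * indicator B x) \<in> borel_measurable lebesgue"
      by (rule borel_measurable_times[OF borel_measurable_integrable[OF int] B])
    show "(\<lambda>x. ?g x * k n x) \<in> borel_measurable lebesgue" for n
      by (rule borel_measurable_times[OF borel_measurable_integrable[OF int] meas])
    show "integrable lebesgue (\<lambda>x. \<bar>?g x\<bar>)" by (rule integrable_abs[OF int])
  qed
  moreover have "(LINT x:\<Omega>|lebesgue. g x * k n x) = (LINT x|lebesgue. ?g x * k n x)" for n
    unfolding set_lebesgue_integral_def
    by (rule arg_cong[where f = "integral\<^sup>L lebesgue"])
      (use K(1) k(3)[of _ n] in \<open>fastforce simp: indicator_def fun_eq_iff\<close>)
  moreover have "(LINT x:B|lebesgue. g x) = (LINT x|lebesgue. ?g x * indicator B x)"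
    unfolding set_lebesgue_integral_def
    by (rule arg_cong[where f = "integral\<^sup>L lebesgue"])
      (use K(2) in \<open>auto simp: indicator_def fun_eq_iff\<close>)
  ultimately show ?thesis by simp
qed

section \<open>Weak derivatives on an interval\<close>

lemma mollifier_average_tendsto:
  fixes u :: "real \<Rightarrow> real"
  assumes u: "continuous_on {a<..<b} u" and p: "a < p" "p < b"
    and e: "e \<longlonglongrightarrow> 0" "\<And>n. e n > 0"
  shows "(\<lambda>n. (LINT s:{a<..<b}|lebesgue. u s * mollifier ((s - p) / e n)) / e n) \<longlonglongrightarrow> u p"
proof (rule tendstoI)
  fix \<eta> :: real assume \<eta>: "\<eta> > 0"
  have "isCont u p"
    using u p by (simp add: continuous_on_eq_continuous_at)
  then obtain d where d: "d > 0" "\<And>s. \<bar>s - p\<bar> < d \<Longrightarrow> \<bar>u s - u p\<bar> < \<eta> / 2"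
    unfolding continuous_at_eps_delta using \<eta>
    by (metis dist_real_def half_gt_zero)
  have "\<forall>\<^sub>F n in sequentially. e n < min d (min (p - a) (b - p))"
    using order_tendstoD(2)[OF e(1), of "min d (min (p - a) (b - p))"] d(1) p by auto
  then show "\<forall>\<^sub>F n in sequentially.
      dist ((LINT s:{a<..<b}|lebesgue. u s * mollifier ((s - p) / e n)) / e n) (u p) < \<eta>"
  proof eventually_elim
    case (elim n)
    let ?K = "{p - e n..p + e n}" and ?k = "\<lambda>s. mollifier ((s - p) / e n)"
    let ?J = "LINT s:{a<..<b}|lebesgue. u s * ?k s"
    have "?k absolutely_integrable_on ?K"
      by (intro set_integrable_continuous_compact smooth_continuous smooth_rescale
          smooth_mollifier) auto
    then have mass: "(LINT s:?K|lebesgue. ?k s) = e n"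
      using integral_mollifier_rescaled[OF e(2)] by (simp add: set_lebesgue_integral_eq_integral)
    have "\<bar>?J - u p * (LINT s:?K|lebesgue. ?k s)\<bar> \<le> \<eta> / 2 * (LINT s:?K|lebesgue. ?k s)"
    proof (rule kernel_average)
      show "continuous_on ?K u" by (rule continuous_on_subset[OF u]) (use elim in auto)
      show "continuous_on ?K ?k" by (intro smooth_continuous smooth_rescale smooth_mollifier)
      show "?k s = 0" if "s \<notin> ?K" for s
        using mollifier_rescaled_outside[OF e(2) that] .
      show "\<bar>u s - u p\<bar> \<le> \<eta> / 2" if "s \<in> ?K" for s
        using d(2)[of s] that elim by (auto simp: abs_less_iff intro: less_imp_le)
    qed (use elim in \<open>auto simp: mollifier_nonneg\<close>)
    then have "\<bar>?J / e n - u p\<bar> \<le> \<eta> / 2"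
      unfolding mass using e(2)[of n] by (simp add: field_simps abs_le_iff)
    then show ?case using \<eta> by (simp add: dist_real_def)
  qed
qed

lemma inverse_Suc_mult_tendsto_0: "(\<lambda>n. d * inverse (real (Suc n))) \<longlonglongrightarrow> 0"
  using tendsto_mult_left[OF LIMSEQ_inverse_real_of_nat, of d] by simp

text \<open>Testing with smooth cutoffs of \<open>[p, q]\<close>: their derivatives concentrate at \<open>p\<close> and \<open>q\<close> with
  opposite signs and pick out the values of the continuous function \<open>u\<close> there, while the cutoffs
  themselves tend to the indicator.\<close>

lemma weak_derivative_increment:
  fixes u g :: "real \<Rightarrow> real"
  assumes w: "weak_pderiv {a<..<b} 1 u g" and u: "continuous_on {a<..<b} u"
    and pq: "a < p" "p \<le> q" "q < b"
  shows "(g has_integral (u q - u p)) {p..q}"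
proof -
  define d where "d = min (p - a) (b - q) / 2"
  define e where "e n = d * inverse (real (Suc n))" for n
  have d: "d > 0" "a < p - d" "q + d < b"
    using pq by (auto simp: d_def min_def field_simps)
  have e: "e \<longlonglongrightarrow> 0" "\<And>n. e n > 0" "\<And>n. e n \<le> d"
    unfolding e_def using d inverse_Suc_mult_tendsto_0[of d] by (auto simp: field_simps)
  let ?I = "{a<..<b}" and ?K = "{p - d..q + d}"
  have K: "compact ?K" "?K \<subseteq> ?I" using d by auto
  have g: "set_integrable lebesgue ?K g"
    using w K by (simp add: weak_pderiv_def locally_integrable_def)
  have sub: "{p - e n..q + e n} \<subseteq> ?K" for n using e(3)[of n] by auto
  have out: "cutoff (e n) p q s = 0" "cutoff_deriv (e n) p q s = 0" if "s \<notin> ?K" for n s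
    using cutoff_outside[of "e n" p q s] sub[of n] that e(2)[of n] pq by blast+
  have test: "(LINT s:?I|lebesgue. u s * cutoff_deriv (e n) p q s)
      = - (LINT s:?I|lebesgue. g s * cutoff (e n) p q s)" for n
  proof -
    have "test_function ?I (cutoff (e n) p q)"
      by (rule smooth_supported_test_function[OF smooth_cutoff K]) (rule out(1))
    moreover have "pderiv_dir 1 (cutoff (e n) p q) = cutoff_deriv (e n) p q"
      using pderiv_dir_eq[of "cutoff (e n) p q" "\<lambda>s. (*) (cutoff_deriv (e n) p q s)" 1]
        cutoff_has_derivative[of "e n" p q] e(2)[of n] by (simp add: has_field_derivative_def)
    ultimately show ?thesis using w unfolding weak_pderiv_def by metis
  qed
  have "(\<lambda>n. LINT s:?I|lebesgue. g s * cutoff (e n) p q s) \<longlonglongrightarrow> (LINT s:{p..q}|lebesgue. g s)"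
  proof (rule cutoff_family_limit[OF g K(2)])
    have "AE s in lebesgue. s \<noteq> p \<and> s \<noteq> q"
      using AE_lborel_singleton[of p] AE_lborel_singleton[of q] by (intro AE_completion) auto
    then show "AE s in lebesgue. (\<lambda>n. cutoff (e n) p q s) \<longlonglongrightarrow> indicator {p..q} s"
      by eventually_elim (use cutoff_tendsto[OF e(1,2) pq(2)] in auto)
    show "\<bar>cutoff (e n) p q s\<bar> \<le> 1" for n s
      using cutoff_bounds[OF e(2) pq(2), of n s] by auto
  qed (use d out smooth_continuous[OF smooth_cutoff] in auto)
  moreover have "(\<lambda>n. LINT s:?I|lebesgue. u s * cutoff_deriv (e n) p q s) \<longlonglongrightarrow> u p - u q"
  proof -
    have int: "set_integrable lebesgue ?I (\<lambda>s. u s * mollifier ((s - c) / e n))"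
      if "c \<in> {p, q}" for n c
    proof -
      have z: "mollifier ((s - c) / e n) = 0" if "s \<in> ?I - ?K" for s
        by (rule mollifier_rescaled_outside[OF e(2)])
          (use that \<open>c \<in> {p, q}\<close> e(3)[of n] pq in auto)
      have "set_integrable lebesgue ?K (\<lambda>s. u s * mollifier ((s - c) / e n))"
        by (intro set_integrable_continuous_compact K(1) continuous_on_mult
            continuous_on_subset[OF u K(2)] smooth_continuous smooth_rescale smooth_mollifier)
      moreover have "(\<lambda>s. indicator ?I s *\<^sub>R (u s * mollifier ((s - c) / e n)))
          = (\<lambda>s. indicator ?K s *\<^sub>R (u s * mollifier ((s - c) / e n)))"
        using z K(2) by (fastforce simp: indicator_def fun_eq_iff)
      ultimately show ?thesis by (simp add: set_integrable_def)
    qed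
    have "(LINT s:?I|lebesgue. u s * cutoff_deriv (e n) p q s) =
        (LINT s:?I|lebesgue. u s * mollifier ((s - p) / e n)) / e n
      - (LINT s:?I|lebesgue. u s * mollifier ((s - q) / e n)) / e n" for n
    proof -
      have "(LINT s:?I|lebesgue. u s * cutoff_deriv (e n) p q s)
        = (LINT s:?I|lebesgue. (u s * mollifier ((s - p) / e n)
            - u s * mollifier ((s - q) / e n)) / e n)"
        by (simp add: cutoff_deriv_def right_diff_distrib)
      then show ?thesis using int[of p n] int[of q n]
        by (simp add: set_integral_diff diff_divide_distrib)
    qed
    moreover have "(\<lambda>n. (LINT s:?I|lebesgue. u s * mollifier ((s - p) / e n)) / e n
      - (LINT s:?I|lebesgue. u s * mollifier ((s - q) / e n)) / e n) \<longlonglongrightarrow> u p - u q"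
      by (intro tendsto_diff mollifier_average_tendsto u e) (use pq in auto)
    ultimately show ?thesis by simp
  qed
  ultimately have "u p - u q = - (LINT s:{p..q}|lebesgue. g s)"
    unfolding test using LIMSEQ_unique tendsto_minus by blast
  then have eq: "(LINT s:{p..q}|lebesgue. g s) = u q - u p" by linarith
  have "g absolutely_integrable_on {p..q}"
    by (rule set_integrable_subset[OF g]) (use d in auto)
  from has_integral_set_lebesgue[OF this] show ?thesis unfolding eq .
qed

section \<open>The wave equation on characteristic rectangles\<close>

text \<open>With \<open>\<xi> = t + x\<close> and \<open>\<eta> = t - x\<close>, the point with characteristic coordinates
  \<open>(\<xi>, \<eta>)\<close> and the rectangles with characteristic sides.\<close>

definition char_pt :: "real \<Rightarrow> real \<Rightarrow> real \<times> real" where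
  "char_pt \<xi> \<eta> = ((\<xi> - \<eta>) / 2, (\<xi> + \<eta>) / 2)"

definition char_rect :: "real \<Rightarrow> real \<Rightarrow> real \<Rightarrow> real \<Rightarrow> (real \<times> real) set" where
  "char_rect p q p' q' = {(x, t). t + x \<in> {p..q} \<and> t - x \<in> {p'..q'}}"

lemma char_rect_image: "char_rect p q p' q' = (\<lambda>(\<xi>, \<eta>). char_pt \<xi> \<eta>) ` ({p..q} \<times> {p'..q'})"
proof -
  have "(x, t) \<in> (\<lambda>(\<xi>, \<eta>). char_pt \<xi> \<eta>) ` ({p..q} \<times> {p'..q'})" if "(x, t) \<in> char_rect p q p' q'" for x t
    by (rule image_eqI[of _ _ "(t + x, t - x)"]) (use that in \<open>auto simp: char_pt_def char_rect_def\<close>)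
  then show ?thesis by (auto simp: char_pt_def char_rect_def field_simps)
qed

lemma compact_char_rect: "compact (char_rect p q p' q')"
proof -
  have "continuous_on ({p..q} \<times> {p'..q'}) (\<lambda>(\<xi>, \<eta>). char_pt \<xi> \<eta>)"
    unfolding char_pt_def case_prod_unfold by (intro continuous_intros) auto
  then show ?thesis unfolding char_rect_image
    by (intro compact_continuous_image compact_Times) auto
qed

lemma has_derivative_char_product:
  assumes "\<And>s. (A has_real_derivative A' s) (at s)" "\<And>s. (B has_real_derivative B' s) (at s)"
  shows "((\<lambda>p. A (snd p + fst p) * B (snd p - fst p)) has_derivative
    (\<lambda>h. (snd h + fst h) * (A' (snd p + fst p) * B (snd p - fst p))
       + (snd h - fst h) * (A (snd p + fst p) * B' (snd p - fst p)))) (at p)"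
proof -
  have "((\<lambda>p. A (snd p + fst p)) has_derivative (\<lambda>h. A' (snd p + fst p) * (snd h + fst h))) (at p)"
    by (rule has_derivative_compose[where f = "\<lambda>p. snd p + fst p" and g = A, OF _
          assms(1)[unfolded has_field_derivative_def]]) (auto intro!: derivative_eq_intros)
  moreover have "((\<lambda>p. B (snd p - fst p)) has_derivative (\<lambda>h. B' (snd p - fst p) * (snd h - fst h))) (at p)"
    by (rule has_derivative_compose[where f = "\<lambda>p. snd p - fst p" and g = B, OF _
          assms(2)[unfolded has_field_derivative_def]]) (auto intro!: derivative_eq_intros)
  ultimately show ?thesis
    by (rule has_derivative_eq_rhs[OF has_derivative_mult]) (simp add: fun_eq_iff algebra_simps)
qed

text \<open>In characteristic variables the wave operator is \<open>4 \<partial>\<^sub>\<xi> \<partial>\<^sub>\<eta>\<close>.\<close>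

lemma wave_operator_char_product:
  fixes A B :: "real \<Rightarrow> real"
  assumes "smooth A" "smooth B"
    and A: "\<And>s. (A has_real_derivative A' s) (at s)" and B: "\<And>s. (B has_real_derivative B' s) (at s)"
  defines "\<psi> \<equiv> \<lambda>p::real \<times> real. A (snd p + fst p) * B (snd p - fst p)"
  shows "pderiv_dir (0, 1) (pderiv_dir (0, 1) \<psi>) p - pderiv_dir (1, 0) (pderiv_dir (1, 0) \<psi>) p
    = 4 * (A' (snd p + fst p) * B' (snd p - fst p))"
proof -
  have "smooth A'" "smooth B'" using assms smooth_real_iff_deriv by blast+
  then obtain A'' B'' where A': "\<And>s. (A' has_real_derivative A'' s) (at s)"
    and B': "\<And>s. (B' has_real_derivative B'' s) (at s)" by (metis smooth_real_deriv)
  have 1: "pderiv_dir b \<psi> = (\<lambda>p. (snd b + fst b) * (A' (snd p + fst p) * B (snd p - fst p))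
       + (snd b - fst b) * (A (snd p + fst p) * B' (snd p - fst p)))" for b
    unfolding \<psi>_def by (rule pderiv_dir_eq[OF has_derivative_char_product[OF A B]])
  show ?thesis
    unfolding 1
    by (subst (1 2) pderiv_dir_eq[OF has_derivative_add[OF
          has_derivative_mult_right[OF has_derivative_char_product[OF A' B]]
          has_derivative_mult_right[OF has_derivative_char_product[OF A B']]]])
      (simp add: algebra_simps)
qed

lemma lebesgue_integral_translation:
  fixes k :: "'a::euclidean_space \<Rightarrow> real"
  assumes "k \<in> borel_measurable borel"
  shows "(LINT x|lebesgue. k (x - c)) = (LINT x|lebesgue. k x)"
proof -
  have "(LINT x|lebesgue. k (x - c)) = (LINT x|lborel. k (x - c))"
    using assms by (intro integral_completion) simp
  also have "\<dots> = (LINT x|distr lborel borel ((+) c). k (x - c))"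
    by (simp add: lborel_distr_plus)
  also have "\<dots> = (LINT x|lborel. k x)"
    using assms by (subst integral_distr) auto
  also have "\<dots> = (LINT x|lebesgue. k x)"
    using assms by (intro integral_completion[symmetric]) simp
  finally show ?thesis .
qed

definition char_bump :: "real \<Rightarrow> real \<times> real \<Rightarrow> real" where
  "char_bump e p = mollifier ((snd p + fst p) / e) * mollifier ((snd p - fst p) / e)"

lemma continuous_char_bump: "continuous_on S (\<lambda>p. char_bump e (p - c))"
proof -
  have m: "continuous_on UNIV mollifier" by (rule smooth_continuous[OF smooth_mollifier])
  have mol: "continuous_on S (\<lambda>p. mollifier (f p))" if "continuous_on S f" for f :: "_ \<Rightarrow> real"
    by (rule continuous_on_compose2[OF m that]) simp
  show ?thesis
    unfolding char_bump_def divide_inverse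
    by (intro continuous_on_mult mol continuous_intros)
qed

lemma char_bump_shift:
  "char_bump e (z - char_pt a b) = mollifier ((snd z + fst z - a) / e) * mollifier ((snd z - fst z - b) / e)"
proof -
  have "snd (z - char_pt a b) + fst (z - char_pt a b) = snd z + fst z - a"
    "snd (z - char_pt a b) - fst (z - char_pt a b) = snd z - fst z - b"
    by (auto simp: char_pt_def field_simps)
  then show ?thesis unfolding char_bump_def by (simp only:)
qed

lemma char_bump_nonneg: "char_bump e p \<ge> 0"
  by (simp add: char_bump_def mollifier_nonneg)

lemma char_bump_outside:
  assumes "e > 0" "p \<notin> char_rect (a - e) (a + e) (b - e) (b + e)"
  shows "char_bump e (p - char_pt a b) = 0"
proof -
  have "snd p + fst p \<notin> {a - e..a + e} \<or> snd p - fst p \<notin> {b - e..b + e}"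
    using assms(2) by (cases p) (auto simp: char_rect_def)
  then show ?thesis
    using mollifier_rescaled_outside[OF assms(1), of "snd p + fst p" a]
      mollifier_rescaled_outside[OF assms(1), of "snd p - fst p" b]
    by (auto simp: char_bump_shift)
qed

text \<open>The bumps at different points are translates of each other, so their masses agree; only
  the equality and the sign matter, not the value.\<close>

lemma char_bump_mass:
  assumes "e > 0"
  shows "(LINT p:char_rect (a - e) (a + e) (b - e) (b + e)|lebesgue. char_bump e (p - char_pt a b))
      = (LINT p|lebesgue. char_bump e p)" (is "(LINT p:?K|lebesgue. ?k p) = _")
    and "(LINT p|lebesgue. char_bump e p) > 0"
proof -
  have K: "(LINT p:?K|lebesgue. ?k p) = (LINT p|lebesgue. ?k p)"
    using set_integral_restrict[of "char_rect (a - e) (a + e) (b - e) (b + e)" UNIV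
        "\<lambda>p. char_bump e (p - char_pt a b)" lebesgue] char_bump_outside[OF assms]
    by (simp add: set_lebesgue_integral_def)
  have "char_bump e \<in> borel_measurable borel"
    using continuous_char_bump[of UNIV e 0] by (simp add: borel_measurable_continuous_onI)
  from lebesgue_integral_translation[OF this] K
  show "(LINT p:?K|lebesgue. ?k p) = (LINT p|lebesgue. char_bump e p)" by simp
  let ?K0 = "char_rect (0 - e) (0 + e) (0 - e) (0 + e)"
  have c0: "char_pt 0 0 = 0" by (simp add: char_pt_def zero_prod_def)
  have "set_integrable lebesgue ?K0 (char_bump e)"
    using set_integrable_continuous_compact[OF compact_char_rect continuous_char_bump[of _ _ 0]]
    by simp
  moreover have "indicator ?K0 p *\<^sub>R char_bump e p = char_bump e p" for p
    using char_bump_outside[OF assms, of p 0 0] by (auto simp: c0 indicator_def)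
  ultimately have int: "integrable lebesgue (char_bump e)" unfolding set_integrable_def by (simp only:)
  have "(LINT p|lebesgue. char_bump e p) \<noteq> 0"
  proof
    assume "(LINT p|lebesgue. char_bump e p) = 0"
    then have "AE p in lebesgue. char_bump e p = 0"
      using integral_nonneg_eq_0_iff_AE[OF int] char_bump_nonneg by simp
    then have "negligible {p. char_bump e p \<noteq> 0}"
      by (auto simp: eventually_ae_filter negligible_iff_null_sets[symmetric] intro: negligible_subset)
    moreover have "open {p. char_bump e p \<noteq> 0}"
      using continuous_char_bump[of UNIV e 0] by (auto intro!: open_Collect_neq)
    moreover have "char_bump e 0 \<noteq> 0" by (simp add: char_bump_def mollifier_eq_0_iff)
    ultimately show False using open_not_negligible by blast
  qed
  moreover have "(LINT p|lebesgue. char_bump e p) \<ge> 0" by (simp add: char_bump_nonneg)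
  ultimately show "(LINT p|lebesgue. char_bump e p) > 0" by linarith
qed

text \<open>Tested with a product of cutoffs in the two characteristic variables, the wave operator
  becomes four bumps of equal mass at the corners of a rectangle, with alternating signs.\<close>

lemma wave_equation_char_rect:
  fixes u :: "real \<times> real \<Rightarrow> real"
  assumes u: "continuous_on \<Omega> u"
    and wave: "\<And>\<psi>. test_function \<Omega> \<psi> \<Longrightarrow> (LINT p:\<Omega>|lebesgue.
        u p * (pderiv_dir (0, 1) (pderiv_dir (0, 1) \<psi>) p
             - pderiv_dir (1, 0) (pderiv_dir (1, 0) \<psi>) p)) = 0"
    and pq: "p \<le> q" "p' \<le> q'"
    and d: "d > 0" "char_rect (p - d) (q + d) (p' - d) (q' + d) \<subseteq> \<Omega>"
  shows "u (char_pt q q') + u (char_pt p p') = u (char_pt p q') + u (char_pt q p')"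
proof -
  let ?K = "char_rect (p - d) (q + d) (p' - d) (q' + d)"
  have uK: "continuous_on ?K u" by (rule continuous_on_subset[OF u d(2)])
  let ?D = "u (char_pt p p') - u (char_pt p q') - u (char_pt q p') + u (char_pt q q')"
  have "\<bar>?D\<bar> \<le> 4 * \<eta>" if \<eta>: "\<eta> > 0" for \<eta>
  proof -
    have "uniformly_continuous_on ?K u"
      by (rule compact_uniformly_continuous[OF uK compact_char_rect])
    then obtain r where r: "r > 0"
      "\<And>x y. x \<in> ?K \<Longrightarrow> y \<in> ?K \<Longrightarrow> dist x y < r \<Longrightarrow> \<bar>u x - u y\<bar> < \<eta>"
      using \<eta> unfolding uniformly_continuous_on_def dist_real_def by metis
    \<comment> \<open>A bump of width \<open>e\<close> in both characteristic variables lies within distance \<open>2 e < r\<close> of its corner.\<close>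
    define e where "e = min d (r / 3)"
    have e: "e > 0" "e \<le> d" "2 * e < r" using d r by (auto simp: e_def min_def)
    define M where "M = (LINT p|lebesgue. char_bump e p)"
    have M: "M > 0" unfolding M_def using char_bump_mass(2)[OF e(1)] .
    define J where "J a b = (LINT z:\<Omega>|lebesgue. u z * char_bump e (z - char_pt a b))" for a b
    have corner: "\<bar>J a b - u (char_pt a b) * M\<bar> \<le> \<eta> * M"
      and int: "set_integrable lebesgue \<Omega> (\<lambda>z. u z * char_bump e (z - char_pt a b))"
      if ab: "a \<in> {p, q}" "b \<in> {p', q'}" for a b
    proof -
      let ?S = "char_rect (a - e) (a + e) (b - e) (b + e)"
      have S: "?S \<subseteq> ?K" using ab e pq by (auto simp: char_rect_def)
      have c: "char_pt a b \<in> ?K" using ab e pq d by (auto simp: char_rect_def char_pt_def field_simps)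
      have "\<bar>J a b - u (char_pt a b) * (LINT z:?S|lebesgue. char_bump e (z - char_pt a b))\<bar>
        \<le> \<eta> * (LINT z:?S|lebesgue. char_bump e (z - char_pt a b))"
        unfolding J_def
      proof (rule kernel_average[OF compact_char_rect _ _ continuous_char_bump])
        show "?S \<subseteq> \<Omega>" using S d(2) by blast
        show "continuous_on ?S u" by (rule continuous_on_subset[OF uK S])
        show "char_bump e (z - char_pt a b) \<ge> 0" for z by (rule char_bump_nonneg)
        show "char_bump e (z - char_pt a b) = 0" if "z \<notin> ?S" for z
          by (rule char_bump_outside[OF e(1) that])
        show "\<bar>u z - u (char_pt a b)\<bar> \<le> \<eta>" if z: "z \<in> ?S" for z
        proof -
          have "\<bar>fst z - fst (char_pt a b)\<bar> \<le> e" "\<bar>snd z - snd (char_pt a b)\<bar> \<le> e"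
            using z by (auto simp: char_rect_def char_pt_def abs_le_iff field_simps)
          then have "dist z (char_pt a b) \<le> e + e"
            using norm_Pair_le[of "fst z - fst (char_pt a b)" "snd z - snd (char_pt a b)"]
            unfolding dist_norm by (simp add: minus_prod_def)
          then show ?thesis using r(2)[of z "char_pt a b"] z S c e(3) by force
        qed
      qed
      then show "\<bar>J a b - u (char_pt a b) * M\<bar> \<le> \<eta> * M"
        unfolding char_bump_mass(1)[OF e(1)] M_def .
      have "set_integrable lebesgue ?S (\<lambda>z. u z * char_bump e (z - char_pt a b))"
        by (intro set_integrable_continuous_compact compact_char_rect continuous_on_mult
            continuous_on_subset[OF uK S] continuous_char_bump)
      moreover have "(\<lambda>z. indicator \<Omega> z *\<^sub>R (u z * char_bump e (z - char_pt a b)))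
          = (\<lambda>z. indicator ?S z *\<^sub>R (u z * char_bump e (z - char_pt a b)))"
      proof
        fix z show "indicator \<Omega> z *\<^sub>R (u z * char_bump e (z - char_pt a b))
          = indicator ?S z *\<^sub>R (u z * char_bump e (z - char_pt a b))"
          using char_bump_outside[OF e(1), of z a b] S d(2) by (cases "z \<in> ?S") auto
      qed
      ultimately show "set_integrable lebesgue \<Omega> (\<lambda>z. u z * char_bump e (z - char_pt a b))"
        by (simp add: set_integrable_def)
    qed
    let ?A = "cutoff e p q" and ?B = "cutoff e p' q'"
    let ?\<psi> = "\<lambda>z. ?A (snd z + fst z) * ?B (snd z - fst z)"
    have "test_function \<Omega> ?\<psi>"
    proof (rule smooth_supported_test_function[OF _ compact_char_rect d(2)])
      have "bounded_linear (\<lambda>z::real \<times> real. snd z + fst z)"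
        "bounded_linear (\<lambda>z::real \<times> real. snd z - fst z)"
        by (intro bounded_linear_add bounded_linear_sub bounded_linear_fst bounded_linear_snd)+
      from smooth_mult[OF smooth_affine[OF this(1) smooth_cutoff[of e p q], of 0]
          smooth_affine[OF this(2) smooth_cutoff[of e p' q'], of 0]]
      show "smooth ?\<psi>" by simp
      show "?\<psi> z = 0" if "z \<notin> ?K" for z
      proof -
        have "snd z + fst z \<notin> {p - e..q + e} \<or> snd z - fst z \<notin> {p' - e..q' + e}"
          using that e(2) by (cases z) (auto simp: char_rect_def)
        then show ?thesis
          using cutoff_outside(1)[OF e(1) pq(1)] cutoff_outside(1)[OF e(1) pq(2)] by auto
      qed
    qed
    from wave[OF this]
    have "0 = (LINT z:\<Omega>|lebesgue. u z * (4 * (cutoff_deriv e p q (snd z + fst z)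
        * cutoff_deriv e p' q' (snd z - fst z))))"
      using e(1) by (subst (asm) wave_operator_char_product[OF smooth_cutoff smooth_cutoff
          cutoff_has_derivative cutoff_has_derivative]) auto
    also have "\<dots> = (LINT z:\<Omega>|lebesgue. 4 / e\<^sup>2 *
      (u z * char_bump e (z - char_pt p p') - u z * char_bump e (z - char_pt p q')
       - u z * char_bump e (z - char_pt q p') + u z * char_bump e (z - char_pt q q')))"
    proof -
      have "cutoff_deriv e p q (snd z + fst z) * cutoff_deriv e p' q' (snd z - fst z)
        = (char_bump e (z - char_pt p p') - char_bump e (z - char_pt p q')
        - char_bump e (z - char_pt q p') + char_bump e (z - char_pt q q')) / e\<^sup>2" for z
      proof -
        have "((x - x') / e) * ((y - y') / e) = (x * y - x * y' - x' * y + x' * y') / e\<^sup>2"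
          for x x' y y' :: real by (simp add: power2_eq_square algebra_simps)
        then show ?thesis unfolding char_bump_shift cutoff_deriv_def .
      qed
      moreover have "u z * (4 * (X / e\<^sup>2)) = 4 / e\<^sup>2 * (u z * X)" for z X by simp
      ultimately show ?thesis by (simp only: distrib_left right_diff_distrib)
    qed
    also have "\<dots> = 4 / e\<^sup>2 * (J p p' - J p q' - J q p' + J q q')"
      unfolding J_def using int
      by (subst set_integral_mult_right)
         (simp add: set_integral_add set_integral_diff)
    finally have "J p p' - J p q' - J q p' + J q q' = 0" using e(1) by simp
    then have "\<bar>?D * M\<bar> \<le> 4 * (\<eta> * M)"
      using corner[of p p'] corner[of p q'] corner[of q p'] corner[of q q']
      by (simp add: abs_le_iff left_diff_distrib distrib_right)
    then show ?thesis using M by (simp add: abs_mult)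
  qed
  from this[of "\<bar>?D\<bar> / 8"] have "?D = 0" by (cases "?D = 0") auto
  then show ?thesis by linarith
qed

section \<open>Weak time derivatives\<close>

text \<open>The boundary term of an integration by parts in time: the mollifier concentrates at time
  \<open>\<tau>\<close>, uniformly in \<open>x\<close> by uniform continuity of \<open>u\<close>, and the spatial cutoff tends to an
  indicator at the same rate.\<close>

lemma integral_cutoff_mollifier_tendsto:
  fixes u :: "real \<times> real \<Rightarrow> real"
  assumes ab: "\<alpha> \<le> \<beta>" and d: "d > 0" and \<tau>: "t1 \<le> \<tau>" "\<tau> \<le> t2"
    and e: "e \<longlonglongrightarrow> 0" "\<And>n. e n > 0" "\<And>n. e n \<le> d"
    and K: "K = {\<alpha> - d..\<beta> + d} \<times> {t1 - d..t2 + d}"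
    and u: "continuous_on K u"
  shows "(\<lambda>n. (LINT p:K|lebesgue.
      u p * (cutoff (e n) \<alpha> \<beta> (fst p) * mollifier ((snd p - \<tau>) / e n))) / e n)
    \<longlonglongrightarrow> integral {\<alpha>..\<beta>} (\<lambda>x. u (x, \<tau>))"
proof -
  let ?X = "{\<alpha> - d..\<beta> + d}" and ?T = "{t1 - d..t2 + d}"
  have Kbox: "K = cbox (\<alpha> - d, t1 - d) (\<beta> + d, t2 + d)" by (simp add: K cbox_Pair_eq)
  have uslice: "continuous_on ?X (\<lambda>x. u (x, \<tau>))"
    by (rule continuous_on_compose2[OF u]) (use \<tau> d in \<open>auto simp: K intro!: continuous_intros\<close>)
  define I where "I n x = integral ?T (\<lambda>t. u (x, t) * mollifier ((t - \<tau>) / e n))" for n x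
  define C where "C n x = cutoff (e n) \<alpha> \<beta> x" for n x
  have Cb: "0 \<le> C n x" "C n x \<le> 1" for n x
    unfolding C_def using cutoff_bounds[OF e(2) ab] by auto
  have Ccont: "continuous_on S (C n)" for S n
    unfolding C_def[abs_def] by (rule smooth_continuous[OF smooth_cutoff])
  have mc: "continuous_on S (\<lambda>t. mollifier ((t - \<tau>) / e n))" for S n
    by (intro smooth_continuous smooth_rescale smooth_mollifier)
  have cont: "continuous_on K (\<lambda>p. u p * (C n (fst p) * mollifier ((snd p - \<tau>) / e n)))" for n
  proof (intro continuous_on_mult u)
    show "continuous_on K (\<lambda>p. C n (fst p))"
      by (rule continuous_on_compose2[OF Ccont[of UNIV]]) (auto intro!: continuous_intros)
    show "continuous_on K (\<lambda>p. mollifier ((snd p - \<tau>) / e n))"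
      by (rule continuous_on_compose2[OF mc[of UNIV], of _ snd])
        (auto intro!: continuous_intros)
  qed
  have Icont: "continuous_on ?X (I n)" for n
  proof -
    have "continuous_on (?X \<times> cbox (t1 - d) (t2 + d)) (\<lambda>(x, t). u (x, t) * mollifier ((t - \<tau>) / e n))"
      unfolding case_prod_unfold
      by (intro continuous_on_mult)
        (auto intro!: continuous_intros u[unfolded K]
          continuous_on_compose2[OF mc[of UNIV], of _ snd])
    from integral_continuous_on_param[OF this] show ?thesis by (simp add: I_def[abs_def])
  qed
  have nest: "(LINT p:K|lebesgue. u p * (C n (fst p) * mollifier ((snd p - \<tau>) / e n)))
      = integral ?X (\<lambda>x. C n x * I n x)" for n
  proof -
    have "(LINT p:K|lebesgue. u p * (C n (fst p) * mollifier ((snd p - \<tau>) / e n)))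
      = integral K (\<lambda>p. u p * (C n (fst p) * mollifier ((snd p - \<tau>) / e n)))"
      by (intro set_lebesgue_integral_eq_integral set_integrable_continuous_compact cont)
        (auto simp: Kbox)
    also have "\<dots> = integral ?X (\<lambda>x. integral ?T (\<lambda>t. u (x, t) * (C n x * mollifier ((t - \<tau>) / e n))))"
      using integral_prod_continuous[OF cont[unfolded Kbox]] by (simp add: Kbox)
    also have "\<dots> = integral ?X (\<lambda>x. C n x * I n x)"
    proof (rule integral_cong)
      fix x
      have "(\<lambda>t. u (x, t) * (C n x * mollifier ((t - \<tau>) / e n)))
        = (\<lambda>t. C n x * (u (x, t) * mollifier ((t - \<tau>) / e n)))" by (simp add: mult_ac)
      then show "integral ?T (\<lambda>t. u (x, t) * (C n x * mollifier ((t - \<tau>) / e n))) = C n x * I n x"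
        by (simp add: I_def)
    qed
    finally show ?thesis .
  qed
  have spatial: "(\<lambda>n. integral ?X (\<lambda>x. u (x, \<tau>) * C n x)) \<longlonglongrightarrow> integral {\<alpha>..\<beta>} (\<lambda>x. u (x, \<tau>))"
  proof -
    have "(\<lambda>n. LINT x:?X|lebesgue. u (x, \<tau>) * C n x) \<longlonglongrightarrow> (LINT x:{\<alpha>..\<beta>}|lebesgue. u (x, \<tau>))"
    proof (rule cutoff_family_limit[where K = ?X])
      show "set_integrable lebesgue ?X (\<lambda>x. u (x, \<tau>))"
        by (rule set_integrable_continuous_compact[OF _ uslice]) auto
      show "C n x = 0" if "x \<notin> ?X" for n x
        unfolding C_def by (rule cutoff_outside(1)[OF e(2) ab]) (use that e(3)[of n] in auto)
      have "AE s in lebesgue. s \<noteq> \<alpha> \<and> s \<noteq> \<beta>"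
        using AE_lborel_singleton[of \<alpha>] AE_lborel_singleton[of \<beta>] by (intro AE_completion) auto
      then show "AE s in lebesgue. (\<lambda>n. C n s) \<longlonglongrightarrow> indicator {\<alpha>..\<beta>} s"
        by eventually_elim (use cutoff_tendsto[OF e(1,2) ab] in \<open>auto simp: C_def\<close>)
      show "\<bar>C n x\<bar> \<le> 1" for n x using Cb[of n x] by simp
    qed (use Ccont d in auto)
    moreover have "(LINT x:?X|lebesgue. u (x, \<tau>) * C n x) = integral ?X (\<lambda>x. u (x, \<tau>) * C n x)" for n
      by (intro set_lebesgue_integral_eq_integral set_integrable_continuous_compact
          continuous_on_mult uslice Ccont) auto
    moreover have "(LINT x:{\<alpha>..\<beta>}|lebesgue. u (x, \<tau>)) = integral {\<alpha>..\<beta>} (\<lambda>x. u (x, \<tau>))"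
      by (intro set_lebesgue_integral_eq_integral set_integrable_continuous_compact
          continuous_on_subset[OF uslice]) (use d in auto)
    ultimately show ?thesis by simp
  qed
  have "(\<lambda>n. integral ?X (\<lambda>x. C n x * I n x) / e n - integral ?X (\<lambda>x. u (x, \<tau>) * C n x)) \<longlonglongrightarrow> 0"
  proof (rule tendstoI)
    fix r :: real assume r: "r > 0"
    define l where "l = \<beta> - \<alpha> + 2 * d"
    have l: "l > 0" using ab d by (simp add: l_def)
    define \<eta> where "\<eta> = r / (2 * l)"
    have \<eta>: "\<eta> > 0" using r l by (simp add: \<eta>_def)
    have "uniformly_continuous_on K u"
      by (rule compact_uniformly_continuous[OF u]) (simp add: Kbox)
    then obtain \<delta> where \<delta>: "\<delta> > 0"
      "\<And>x y. x \<in> K \<Longrightarrow> y \<in> K \<Longrightarrow> dist x y < \<delta> \<Longrightarrow> \<bar>u x - u y\<bar> < \<eta>"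
      using \<eta> unfolding uniformly_continuous_on_def dist_real_def by metis
    have "\<forall>\<^sub>F n in sequentially. e n < \<delta>" using order_tendstoD(2)[OF e(1) \<delta>(1)] .
    then show "\<forall>\<^sub>F n in sequentially.
        dist (integral ?X (\<lambda>x. C n x * I n x) / e n - integral ?X (\<lambda>x. u (x, \<tau>) * C n x)) 0 < r"
    proof eventually_elim
      case (elim n)
      let ?S = "{\<tau> - e n..\<tau> + e n}" and ?k = "\<lambda>t. mollifier ((t - \<tau>) / e n)"
      have S: "?S \<subseteq> ?T" using \<tau> e(3)[of n] by auto
      have kc: "continuous_on A ?k" for A
        by (intro smooth_continuous smooth_rescale smooth_mollifier)
      have mass: "(LINT t:?S|lebesgue. ?k t) = e n"
        using integral_mollifier_rescaled[OF e(2)]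
        by (subst set_lebesgue_integral_eq_integral) (auto intro!: set_integrable_continuous_compact kc)
      have near: "\<bar>I n x - u (x, \<tau>) * e n\<bar> \<le> \<eta> * e n" if x: "x \<in> ?X" for x
      proof -
        have ux: "continuous_on ?T (\<lambda>t. u (x, t))"
          by (rule continuous_on_compose2[OF u]) (use x in \<open>auto simp: K intro!: continuous_intros\<close>)
        have "I n x = (LINT t:?T|lebesgue. u (x, t) * ?k t)"
          unfolding I_def
          by (intro set_lebesgue_integral_eq_integral(2)[symmetric] set_integrable_continuous_compact
              continuous_on_mult ux kc) auto
        moreover have "\<bar>(LINT t:?T|lebesgue. u (x, t) * ?k t) - u (x, \<tau>) * (LINT t:?S|lebesgue. ?k t)\<bar>
          \<le> \<eta> * (LINT t:?S|lebesgue. ?k t)"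
        proof (rule kernel_average[OF _ S continuous_on_subset[OF ux S] kc])
          show "\<bar>u (x, t) - u (x, \<tau>)\<bar> \<le> \<eta>" if t: "t \<in> ?S" for t
          proof -
            have "dist (x, t) (x, \<tau>) < \<delta>" using t elim by (auto simp: dist_Pair_Pair dist_real_def)
            moreover have "(x, t) \<in> K" "(x, \<tau>) \<in> K" using x t S \<tau> d by (auto simp: K)
            ultimately show ?thesis using \<delta>(2) by fastforce
          qed
        qed (use mollifier_rescaled_outside[OF e(2)] in \<open>auto simp: mollifier_nonneg\<close>)
        ultimately show ?thesis unfolding mass by simp
      qed
      have int1: "(\<lambda>x. C n x * I n x / e n) integrable_on ?X"
        "(\<lambda>x. u (x, \<tau>) * C n x) integrable_on ?X"
        using e(2)[of n] by (intro integrable_continuous_real continuous_intros Ccont Icont uslice; force)+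
      have "integral ?X (\<lambda>x. C n x * I n x) / e n - integral ?X (\<lambda>x. u (x, \<tau>) * C n x)
        = integral ?X (\<lambda>x. C n x * I n x / e n - u (x, \<tau>) * C n x)"
        using Henstock_Kurzweil_Integration.integral_diff[OF int1] by simp
      moreover have "norm (integral ?X (\<lambda>x. C n x * I n x / e n - u (x, \<tau>) * C n x))
          \<le> integral ?X (\<lambda>x. \<eta>)"
      proof (rule integral_norm_bound_integral)
        show "(\<lambda>x. C n x * I n x / e n - u (x, \<tau>) * C n x) integrable_on ?X"
          by (intro integrable_diff int1)
        fix x assume x: "x \<in> ?X"
        have "C n x * I n x / e n - u (x, \<tau>) * C n x = C n x * ((I n x - u (x, \<tau>) * e n) / e n)"
          using e(2)[of n] by (simp add: field_simps)
        moreover have "\<bar>(I n x - u (x, \<tau>) * e n) / e n\<bar> \<le> \<eta>"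
          using near[OF x] e(2)[of n] by (simp add: field_simps)
        then have "C n x * \<bar>(I n x - u (x, \<tau>) * e n) / e n\<bar> \<le> 1 * \<eta>"
          using Cb[of n x] by (intro mult_mono) auto
        ultimately show "norm (C n x * I n x / e n - u (x, \<tau>) * C n x) \<le> \<eta>"
          using Cb[of n x] by (simp add: abs_mult)
      qed auto
      moreover have "integral ?X (\<lambda>x. \<eta>) = r / 2"
        using ab d l by (simp add: \<eta>_def l_def field_simps)
      ultimately show ?case using r by (simp add: dist_real_def)
    qed
  qed
  from tendsto_add[OF this spatial] show ?thesis
    unfolding C_def[symmetric] nest by simp
qed

text \<open>The two-dimensional analogue of \<open>weak_derivative_increment\<close>: cutoffs in both variables
  approximate the indicator of a box, and the time derivative of the cutoff concentrates on the
  two horizontal edges.\<close>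

lemma weak_time_derivative_increment:
  fixes u g :: "real \<times> real \<Rightarrow> real"
  assumes w: "weak_pderiv \<Omega> (0, 1) u g" and u: "continuous_on \<Omega> u"
    and ab: "\<alpha> \<le> \<beta>" and t12: "t1 \<le> t2"
    and d: "d > 0" "{\<alpha> - d..\<beta> + d} \<times> {t1 - d..t2 + d} \<subseteq> \<Omega>"
  shows "integral {\<alpha>..\<beta>} (\<lambda>x. u (x, t2)) - integral {\<alpha>..\<beta>} (\<lambda>x. u (x, t1))
    = (LINT p:{\<alpha>..\<beta>} \<times> {t1..t2}|lebesgue. g p)"
proof -
  define K where "K = {\<alpha> - d..\<beta> + d} \<times> {t1 - d..t2 + d}"
  have K: "K \<subseteq> \<Omega>" "compact K" using d(2) by (auto simp: K_def intro: compact_Times)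
  have uK: "continuous_on K u" by (rule continuous_on_subset[OF u K(1)])
  define e where "e n = d * inverse (real (Suc n))" for n
  have e: "e \<longlonglongrightarrow> 0" "\<And>n. e n > 0" "\<And>n. e n \<le> d"
    unfolding e_def using d inverse_Suc_mult_tendsto_0[of d] by (auto simp: field_simps)
  define X where "X n p = cutoff (e n) \<alpha> \<beta> (fst p)" for n and p :: "real \<times> real"
  define C where "C n p = X n p * cutoff (e n) t1 t2 (snd p)" for n p
  define M where "M \<tau> n p = X n p * mollifier ((snd p - \<tau>) / e n)" for \<tau> n p
  have Xs: "smooth (X n)" for n
    unfolding X_def[abs_def] using smooth_affine[OF bounded_linear_fst smooth_cutoff, where c = 0] by simp
  have Cs: "smooth (C n)" for n
    unfolding C_def[abs_def]
    using smooth_mult[OF Xs smooth_affine[OF bounded_linear_snd smooth_cutoff, where c = 0]] by simp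
  have Ms: "smooth (M \<tau> n)" for \<tau> n
    unfolding M_def[abs_def]
    using smooth_mult[OF Xs smooth_affine[OF bounded_linear_snd smooth_rescale[OF smooth_mollifier], where c = 0]] by simp
  have out: "fst p \<notin> {\<alpha> - e n..\<beta> + e n} \<or> snd p \<notin> {t1 - e n..t2 + e n}" if "p \<notin> K" for n p
    using that e(3)[of n] by (cases p) (auto simp: K_def)
  have C0: "C n p = 0" if "p \<notin> K" for n p
    using out[OF that, of n] cutoff_outside(1)[OF e(2) ab] cutoff_outside(1)[OF e(2) t12]
    by (auto simp: C_def X_def)
  have M0: "M \<tau> n p = 0" if "p \<notin> K" "\<tau> \<in> {t1, t2}" for \<tau> n p
  proof -
    have "fst p \<notin> {\<alpha> - e n..\<beta> + e n} \<or> snd p \<notin> {\<tau> - e n..\<tau> + e n}"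
      using out[OF that(1), of n] that(2) t12 by auto
    then show ?thesis
      using cutoff_outside(1)[OF e(2) ab] mollifier_rescaled_outside[OF e(2)]
      by (auto simp: M_def X_def)
  qed
  have deriv: "pderiv_dir (0, 1) (C n) = (\<lambda>p. (M t1 n p - M t2 n p) / e n)" for n
  proof -
    have 1: "((\<lambda>p. cutoff (e n) a b (l p)) has_derivative (\<lambda>h. cutoff_deriv (e n) a b (l p) * l h)) (at p)"
      if "bounded_linear l" for l :: "real \<times> real \<Rightarrow> real" and a b p
      by (rule has_derivative_compose[where f = l and g = "cutoff (e n) a b",
            OF bounded_linear_imp_has_derivative[OF that]
             cutoff_has_derivative[unfolded has_field_derivative_def]])
        (use e(2)[of n] in simp)
    have "pderiv_dir (0, 1) (C n) = (\<lambda>p. X n p * cutoff_deriv (e n) t1 t2 (snd p))"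
      unfolding C_def[abs_def] X_def
      by (subst pderiv_dir_eq[OF has_derivative_mult[OF 1[OF bounded_linear_fst] 1[OF bounded_linear_snd]]])
        simp
    then show ?thesis by (simp add: cutoff_deriv_def M_def fun_eq_iff algebra_simps)
  qed
  have test: "(LINT p:K|lebesgue. u p * M t1 n p) / e n - (LINT p:K|lebesgue. u p * M t2 n p) / e n
      = - (LINT p:\<Omega>|lebesgue. g p * C n p)" for n
  proof -
    have int: "set_integrable lebesgue K (\<lambda>p. u p * M \<tau> n p)" for \<tau>
      by (intro set_integrable_continuous_compact K continuous_on_mult uK smooth_continuous[OF Ms])
    have "test_function \<Omega> (C n)"
      by (rule smooth_supported_test_function[OF Cs K(2,1) C0])
    then have "(LINT p:\<Omega>|lebesgue. u p * pderiv_dir (0, 1) (C n) p)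
        = - (LINT p:\<Omega>|lebesgue. g p * C n p)"
      using w unfolding weak_pderiv_def by metis
    then have "(LINT p:\<Omega>|lebesgue. u p * ((M t1 n p - M t2 n p) / e n))
        = - (LINT p:\<Omega>|lebesgue. g p * C n p)" unfolding deriv .
    moreover have "(LINT p:\<Omega>|lebesgue. u p * ((M t1 n p - M t2 n p) / e n))
        = (LINT p:K|lebesgue. (u p * M t1 n p - u p * M t2 n p) / e n)"
      by (subst set_integral_restrict[OF K(1)]) (auto simp: M0 algebra_simps)
    moreover have "\<dots> = (LINT p:K|lebesgue. u p * M t1 n p) / e n - (LINT p:K|lebesgue. u p * M t2 n p) / e n"
      using int by (simp add: set_integral_diff diff_divide_distrib)
    ultimately show ?thesis by simp
  qed
  have gK: "set_integrable lebesgue K g"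
    using w K by (simp add: weak_pderiv_def locally_integrable_def)
  have "(\<lambda>n. LINT p:\<Omega>|lebesgue. g p * C n p) \<longlonglongrightarrow> (LINT p:{\<alpha>..\<beta>} \<times> {t1..t2}|lebesgue. g p)"
  proof (rule cutoff_family_limit[OF gK K(1)])
    show "{\<alpha>..\<beta>} \<times> {t1..t2} \<subseteq> K" using d by (auto simp: K_def)
    show "{\<alpha>..\<beta>} \<times> {t1..t2} \<in> sets lebesgue"
      using fmeasurableD[OF lmeasurable_cbox[of "(\<alpha>, t1)" "(\<beta>, t2)"]] by (simp add: cbox_Pair_eq)
    show "\<bar>C n p\<bar> \<le> 1" for n p
      using cutoff_bounds[OF e(2) ab, of n "fst p"] cutoff_bounds[OF e(2) t12, of n "snd p"]
      by (auto simp: C_def X_def abs_mult intro: mult_le_one)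
    \<comment> \<open>The lines through the edges of the box, where the cutoffs need not converge.\<close>
    have "negligible ({p::real \<times> real. p \<bullet> (1, 0) = \<alpha>} \<union> {p. p \<bullet> (1, 0) = \<beta>}
        \<union> ({p. p \<bullet> (0, 1) = t1} \<union> {p. p \<bullet> (0, 1) = (t2::real)}))" (is "negligible ?N")
      by (intro negligible_Un negligible_standard_hyperplane) (simp_all add: Basis_prod_def Basis_real_def)
    then have "AE p in lebesgue. p \<notin> ?N"
      by (intro AE_not_in) (simp add: negligible_iff_null_sets)
    then show "AE p in lebesgue. (\<lambda>n. C n p) \<longlonglongrightarrow> indicator ({\<alpha>..\<beta>} \<times> {t1..t2}) p"
    proof eventually_elim
      case (elim p)
      have "(\<lambda>n. C n p) \<longlonglongrightarrow> indicator {\<alpha>..\<beta>} (fst p) * indicator {t1..t2} (snd p)"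
        unfolding C_def X_def
        by (intro tendsto_mult cutoff_tendsto e ab t12) (use elim in \<open>auto simp: inner_prod_def\<close>)
      then show ?case by (cases p) (simp add: indicator_times)
    qed
  qed (use smooth_continuous[OF Cs] C0 in auto)
  moreover have "(\<lambda>n. (LINT p:K|lebesgue. u p * M t1 n p) / e n - (LINT p:K|lebesgue. u p * M t2 n p) / e n)
     \<longlonglongrightarrow> integral {\<alpha>..\<beta>} (\<lambda>x. u (x, t1)) - integral {\<alpha>..\<beta>} (\<lambda>x. u (x, t2))"
    unfolding M_def X_def
    by (intro tendsto_diff integral_cutoff_mollifier_tendsto[OF ab d(1) _ _ e K_def uK]) (use t12 in auto)
  ultimately have "integral {\<alpha>..\<beta>} (\<lambda>x. u (x, t1)) - integral {\<alpha>..\<beta>} (\<lambda>x. u (x, t2))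
      = - (LINT p:{\<alpha>..\<beta>} \<times> {t1..t2}|lebesgue. g p)"
    unfolding test using LIMSEQ_unique tendsto_minus by blast
  then show ?thesis by linarith
qed

text \<open>Fubini for a function that is measurable only with respect to the completed measure; a
  Borel version of the function supplies measurability on the product.\<close>

lemma box_integral_slice_bound:
  fixes g :: "real \<times> real \<Rightarrow> real"
  assumes cd: "c \<le> d"
    and int: "set_integrable lebesgue ({a..b} \<times> {c..d}) g"
    and slice_int: "\<And>t. t \<in> {c..d} \<Longrightarrow> set_integrable lebesgue {a..b} (\<lambda>x. g (x, t))"
    and slice: "\<And>t. t \<in> {c..d} \<Longrightarrow> \<bar>(LINT x:{a..b}|lebesgue. g (x, t)) - k\<bar> \<le> \<omega>"
  shows "\<bar>(LINT p:{a..b} \<times> {c..d}|lebesgue. g p) - k * (d - c)\<bar> \<le> \<omega> * (d - c)"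
proof -
  define G where "G p = indicator ({a..b} \<times> {c..d}) p *\<^sub>R g p" for p
  have G: "integrable lebesgue G" using int by (simp add: set_integrable_def G_def[abs_def])
  then obtain G' where G': "G' \<in> borel_measurable lborel" "AE p in lborel. G p = G' p"
    using completion_ex_borel_measurable_real[OF borel_measurable_integrable] by blast
  have ae: "AE p in lebesgue. G p = G' p" using G'(2) by (rule AE_completion)
  have G'i: "integrable lborel G'"
  proof -
    have "integrable lebesgue G'"
      using G ae G'(1) by (subst integrable_cong_AE[symmetric, of G]) (auto intro: measurable_completion)
    then show ?thesis using G'(1) by (simp add: integrable_completion)
  qed
  have intG: "(LINT p:{a..b} \<times> {c..d}|lebesgue. g p) = (LINT p|lborel. G' p)"
  proof -
    have "(LINT p:{a..b} \<times> {c..d}|lebesgue. g p) = (LINT p|lebesgue. G p)"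
      by (simp add: set_lebesgue_integral_def G_def)
    also have "\<dots> = (LINT p|lebesgue. G' p)"
      using G ae G'(1) by (intro integral_cong_AE) (auto intro: measurable_completion)
    also have "\<dots> = (LINT p|lborel. G' p)" using G'(1) by (rule integral_completion)
    finally show ?thesis .
  qed
  have G'p: "integrable (lborel \<Otimes>\<^sub>M lborel) (case_prod (\<lambda>x t. G' (x, t)))"
    using G'i by (simp add: lborel_prod)
  define n where "n t = (LINT x|lborel. G' (x, t))" for t
  have nint: "integrable lborel n" and nval: "(LINT t|lborel. n t) = (LINT p|lborel. G' p)"
    using lborel_pair.integrable_snd[OF G'p] lborel_pair.integral_snd[OF G'p]
    by (simp_all add: n_def[abs_def] lborel_prod)
  have "AE t in lborel. AE x in lborel. G (x, t) = G' (x, t)"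
  proof -
    \<comment> \<open>Exchanging the two quantifiers needs a measurable exceptional set, which the set of
      disagreement need not be.\<close>
    obtain N where N: "N \<in> null_sets lborel" "{p. G p \<noteq> G' p} \<subseteq> N"
      using G'(2) by (auto simp: eventually_ae_filter)
    have "AE p in lborel \<Otimes>\<^sub>M lborel. p \<notin> N"
      unfolding lborel_prod using N(1) by (rule AE_not_in)
    then have "AE x in lborel. AE t in lborel. (x, t) \<notin> N"
      by (rule lborel_pair.AE_pair)
    moreover have "N \<in> sets (lborel \<Otimes>\<^sub>M lborel)"
      unfolding lborel_prod using N(1) by (rule null_setsD2)
    then have "space (lborel \<Otimes>\<^sub>M lborel) - N \<in> sets (lborel \<Otimes>\<^sub>M lborel)"
      by (rule sets.compl_sets)
    then have "{p \<in> space (lborel \<Otimes>\<^sub>M lborel). (fst p, snd p) \<notin> N} \<in> sets (lborel \<Otimes>\<^sub>M lborel)"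
      by (simp only: prod.collapse set_diff_eq)
    ultimately have "AE t in lborel. AE x in lborel. (x, t) \<notin> N"
      using lborel_pair.AE_commute[of "\<lambda>x t. (x, t) \<notin> N"] by simp
    then show ?thesis by eventually_elim (use N(2) in \<open>auto elim!: eventually_mono\<close>)
  qed
  then have nslice: "AE t in lborel. n t = indicator {c..d} t * (LINT x:{a..b}|lebesgue. g (x, t))"
  proof eventually_elim
    case (elim t)
    have m: "(\<lambda>x. G' (x, t)) \<in> borel_measurable lborel" using G'(1) by simp
    have "n t = (LINT x|lebesgue. G' (x, t))" unfolding n_def using m by (rule integral_completion[symmetric])
    also have "\<dots> = (LINT x|lebesgue. G (x, t))"
    proof (rule integral_cong_AE)
      show "(\<lambda>x. G' (x, t)) \<in> borel_measurable lebesgue" using m by (rule measurable_completion)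
      show "AE x in lebesgue. G' (x, t) = G (x, t)"
        using AE_completion[OF elim] by eventually_elim simp
      show "(\<lambda>x. G (x, t)) \<in> borel_measurable lebesgue"
      proof (cases "t \<in> {c..d}")
        case True
        then have "(\<lambda>x. G (x, t)) = (\<lambda>x. indicator {a..b} x *\<^sub>R g (x, t))"
          by (simp add: G_def indicator_times)
        then show ?thesis using slice_int[OF True]
          by (simp only: set_integrable_def borel_measurable_integrable)
      qed (simp add: G_def indicator_times)
    qed
    also have "\<dots> = indicator {c..d} t * (LINT x:{a..b}|lebesgue. g (x, t))"
      unfolding G_def set_lebesgue_integral_def by (cases "t \<in> {c..d}") (simp_all add: indicator_times)
    finally show ?case .
  qed
  have ind: "integrable lborel (\<lambda>t. indicator {c..d} t * r)" "(LINT t|lborel. indicator {c..d} t * r) = r * (d - c)" for r :: real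
    using cd by simp_all
  have "(LINT t|lborel. n t) \<le> (LINT t|lborel. indicator {c..d} t * (k + \<omega>))"
    by (rule integral_mono_AE[OF nint ind(1)])
      (use nslice in eventually_elim, use slice in \<open>auto simp: indicator_def abs_le_iff diff_le_eq add.commute\<close>)
  moreover have "(LINT t|lborel. n t) \<ge> (LINT t|lborel. indicator {c..d} t * (k - \<omega>))"
    by (rule integral_mono_AE[OF ind(1) nint])
      (use nslice in eventually_elim, use slice in \<open>force simp: indicator_def abs_le_iff\<close>)
  ultimately show ?thesis unfolding intG nval[symmetric] ind(2) by (simp add: abs_le_iff algebra_simps)
qed

section \<open>Functions with vanishing integrals\<close>

text \<open>The sets over which the integral vanishes form a Dynkin system that contains the rays,
  hence all Borel sets.\<close>

lemma AE_zero_of_integrable_on_interval: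
  fixes f :: "real \<Rightarrow> real"
  assumes f: "set_integrable lebesgue {a..b} f"
    and 0: "\<And>p q. a \<le> p \<Longrightarrow> p \<le> q \<Longrightarrow> q \<le> b \<Longrightarrow> (f has_integral 0) {p..q}"
  shows "AE x in lebesgue. x \<in> {a..b} \<longrightarrow> f x = 0"
proof -
  define G where "G x = indicator {a..b} x *\<^sub>R f x" for x
  have G: "integrable lebesgue G" using f by (simp add: set_integrable_def G_def[abs_def])
  then obtain G' where G': "G' \<in> borel_measurable lborel" "AE p in lborel. G p = G' p"
    using completion_ex_borel_measurable_real[OF borel_measurable_integrable] by blast
  have ae: "AE p in lebesgue. G p = G' p" using G'(2) by (rule AE_completion)
  have "integrable lebesgue G'"
    using G ae G'(1) by (subst integrable_cong_AE[symmetric, of G]) (auto intro: measurable_completion)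
  then have G'i: "integrable lborel G'" using G'(1) by (simp add: integrable_completion)
  have si: "set_integrable lborel A G'" if "A \<in> sets borel" for A
    unfolding set_integrable_def using G'i that by (intro integrable_mult_indicator) auto
  have ray: "(LINT x:{..q}|lborel. G' x) = 0" for q
  proof -
    have "(LINT x:{..q}|lborel. G' x) = (LINT x:{..q}|lebesgue. G' x)"
      unfolding set_lebesgue_integral_def using G'(1) by (intro integral_completion[symmetric]) simp
    also have "\<dots> = (LINT x:{..q}|lebesgue. G x)"
      using G ae G'(1) by (intro set_lebesgue_integral_cong_AE) (auto intro: measurable_completion)
    also have "\<dots> = (LINT x:{a..min b q}|lebesgue. f x)"
      unfolding set_lebesgue_integral_def G_def
      by (rule arg_cong[where f = "integral\<^sup>L lebesgue"]) (auto simp: indicator_def fun_eq_iff)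
    also have "\<dots> = 0"
    proof (cases "a \<le> min b q")
      case True
      have "set_integrable lebesgue {a..min b q} f"
        by (rule set_integrable_subset[OF f]) auto
      then show ?thesis using 0[of a "min b q"] True
        by (simp add: set_lebesgue_integral_eq_integral integral_unique)
    qed (simp add: set_lebesgue_integral_def)
    finally show ?thesis .
  qed
  have tot: "(LINT x:UNIV|lborel. G' x) = 0"
  proof -
    have "(LINT x:UNIV|lborel. G' x) = (LINT x:{..b}|lborel. G' x)"
    proof -
      have "(LINT x:UNIV|lborel. G' x) = (LINT x|lebesgue. G' x)"
        unfolding set_lebesgue_integral_def using G'(1) by (subst integral_completion) auto
      also have "\<dots> = (LINT x|lebesgue. G x)"
        using G ae G'(1) by (intro integral_cong_AE) (auto intro: measurable_completion)
      also have "\<dots> = (LINT x:{..b}|lebesgue. G x)"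
        unfolding set_lebesgue_integral_def G_def
        by (rule arg_cong[where f = "integral\<^sup>L lebesgue"]) (auto simp: indicator_def fun_eq_iff)
      also have "\<dots> = (LINT x:{..b}|lebesgue. G' x)"
        using G ae G'(1) by (intro set_lebesgue_integral_cong_AE) (auto intro: measurable_completion)
      also have "\<dots> = (LINT x:{..b}|lborel. G' x)"
        unfolding set_lebesgue_integral_def using G'(1) by (intro integral_completion) simp
      finally show ?thesis .
    qed
    then show ?thesis using ray by simp
  qed
  have all: "(LINT x:A|lborel. G' x) = 0" if "A \<in> sets borel" for A
  proof -
    have "Int_stable (range (\<lambda>q::real. {..q}))" by (auto simp: Int_stable_def)
    moreover have "range (\<lambda>q::real. {..q}) \<subseteq> Pow UNIV" by simp
    moreover have "A \<in> sigma_sets UNIV (range (\<lambda>q::real. {..q}))"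
      using that by (simp add: borel_eq_atMost)
    ultimately show ?thesis
    proof (induct rule: sigma_sets_induct_disjoint)
      case (basic A)
      then show ?case using ray by auto
    next
      case (compl A)
      then have A: "A \<in> sets borel" by (simp add: borel_eq_atMost)
      have "(LINT x:UNIV|lborel. G' x) = (LINT x:A|lborel. G' x) + (LINT x:UNIV - A|lborel. G' x)"
        using set_integral_Un[OF _ si[OF A] si, of "UNIV - A"] A by (simp add: Un_absorb1)
      then show ?case using tot compl by simp
    next
      case (union A)
      then have A: "A i \<in> sets borel" for i by (auto simp: borel_eq_atMost)
      have "(LINT x:(\<Union>i. A i)|lborel. G' x) = (\<Sum>i. LINT x:A i|lborel. G' x)"
        by (rule lebesgue_integral_countable_add) (use A union(1) in \<open>auto simp: disjoint_family_on_def intro!: si\<close>)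
      then show ?case using union by simp
    next
      case empty
      then show ?case by (simp add: set_lebesgue_integral_def)
    qed
  qed
  have "AE x in lborel. G' x = 0"
    by (rule sigma_finite_measure.density_zero[OF lborel.sigma_finite_measure_axioms G'i]) (use all in auto)
  then have "AE x in lebesgue. G' x = 0" by (rule AE_completion)
  then show ?thesis using ae by eventually_elim (auto simp: G_def indicator_def)
qed

section \<open>Absolutely convergent Fourier series\<close>

text \<open>The \<open>n\<close>-th Fourier mode of period \<open>P\<close>, written so that \<open>P = L\<^sub>2\<close> gives the exponentials of
  the series by rewriting the arguments alone.\<close>

definition fmode :: "real \<Rightarrow> int \<Rightarrow> real \<Rightarrow> complex" where
  "fmode P n s = exp (of_int n * of_real pi * \<i> * of_real (2 * s / P))"

lemma fmode_0 [simp]: "fmode P 0 s = 1" by (simp add: fmode_def)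

lemma fmode_at_0 [simp]: "fmode P n 0 = 1" by (simp add: fmode_def)

lemma fmode_add: "fmode P (n + m) s = fmode P n s * fmode P m s"
  by (simp add: fmode_def exp_add[symmetric] algebra_simps)

lemma fmode_cis: "fmode P n s = cis (of_int n * pi * (2 * s / P))"
  unfolding fmode_def cis_conv_exp by (rule arg_cong[where f = exp]) (simp add: mult_ac)

lemma norm_fmode [simp]: "cmod (fmode P n s) = 1"
  by (simp add: fmode_cis)

lemma cnj_fmode: "cnj (fmode P n s) = fmode P (- n) s"
  by (simp add: fmode_cis cis_cnj)

lemma fmode_periodic:
  assumes "P \<noteq> 0" shows "fmode P n (s + of_int k * P) = fmode P n s"
proof -
  have "of_int n * pi * (2 * (s + of_int k * P) / P) = of_int n * pi * (2 * s / P) + 2 * pi * of_int (n * k)"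
    using assms by (simp add: field_simps)
  then show ?thesis
    unfolding fmode_cis by (simp only: cis_mult[symmetric]) (simp add: cis_multiple_2pi)
qed

lemma fmode_at_period [simp]: "P \<noteq> 0 \<Longrightarrow> fmode P n P = 1"
  using fmode_periodic[of P n 0 1] by simp

lemma fmode_has_derivative:
  "(fmode P n has_vector_derivative (2 * pi * \<i> * of_int n / P) * fmode P n s) (at s within S)"
proof -
  define c where "c = 2 * pi * \<i> * of_int n / P"
  have "((\<lambda>z. exp (c * z)) has_field_derivative c * exp (c * of_real s)) (at (of_real s))"
    by (auto intro!: derivative_eq_intros)
  from has_vector_derivative_real_field[OF this]
  have "((\<lambda>s. exp (c * of_real s)) has_vector_derivative c * exp (c * of_real s)) (at s within S)"
    by (rule has_vector_derivative_at_within)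
  moreover have "fmode P n = (\<lambda>s. exp (c * of_real s))"
    by (rule ext) (simp add: fmode_def c_def mult_ac)
  ultimately show ?thesis unfolding c_def[symmetric] by (simp only:)
qed

lemma continuous_fmode: "continuous_on S (fmode P n)"
  using fmode_has_derivative
  by (meson continuous_on_eq_continuous_within has_vector_derivative_continuous)

lemma fmode_has_integral:
  assumes "P > 0"
  shows "(fmode P n has_integral (if n = 0 then of_real P else 0)) {0..P}"
proof (cases "n = 0")
  case True
  then show ?thesis using has_integral_const_real[of "1::complex" 0 P] assms
    by (simp add: fmode_def[abs_def] scaleR_conv_of_real)
next
  case False
  let ?c = "2 * pi * \<i> * of_int n / P"
  have c: "?c \<noteq> 0" using False assms by simp
  have "((\<lambda>s. ?c * fmode P n s) has_integral (fmode P n P - fmode P n 0)) {0..P}"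
    using assms fmode_has_derivative by (intro fundamental_theorem_of_calculus) auto
  from has_integral_mult_right[OF this, of "1 / ?c"] c assms False show ?thesis by simp
qed

lemma absolutely_integrable_mult_continuous:
  fixes f g :: "real \<Rightarrow> complex"
  assumes f: "f absolutely_integrable_on {a..b}" and g: "continuous_on {a..b} g"
  shows "(\<lambda>s. f s * g s) absolutely_integrable_on {a..b}"
proof -
  have "(\<lambda>s. g s * f s) absolutely_integrable_on {a..b}"
  proof (rule absolutely_integrable_bounded_measurable_product[where h = "(*)", OF _ _ _ _ f])
    show "bilinear ((*) :: complex \<Rightarrow> complex \<Rightarrow> complex)"
      by (simp add: bilinear_conv_bounded_bilinear bounded_bilinear_mult)
    show "g \<in> borel_measurable (lebesgue_on {a..b})"
      by (rule continuous_imp_measurable_on_sets_lebesgue[OF g]) simp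
    show "bounded (g ` {a..b})"
      by (rule compact_imp_bounded[OF compact_continuous_image[OF g]]) simp
  qed simp
  then show ?thesis by (simp add: mult.commute)
qed

definition fcoeff :: "real \<Rightarrow> (real \<Rightarrow> complex) \<Rightarrow> int \<Rightarrow> complex" where
  "fcoeff P f n = integral {0..P} (\<lambda>s. f s * fmode P (- n) s)"

lemma fcoeff_has_integral:
  assumes "f absolutely_integrable_on {0..P}"
  shows "((\<lambda>s. f s * fmode P (- n) s) has_integral fcoeff P f n) {0..P}"
  unfolding fcoeff_def
  by (intro integrable_integral set_lebesgue_integral_eq_integral(1)
      absolutely_integrable_mult_continuous assms continuous_fmode)

text \<open>The integral of \<open>\<bar>f - p\<bar>\<^sup>2\<close> is nonnegative for the partial Fourier sum \<open>p\<close>.\<close>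

lemma bessel_inequality:
  assumes P: "P > 0" and f: "f absolutely_integrable_on {0..P}"
    and f2: "(\<lambda>s. (cmod (f s))\<^sup>2) integrable_on {0..P}" and F: "finite F"
  shows "(\<Sum>n\<in>F. (cmod (fcoeff P f n))\<^sup>2) \<le> P * integral {0..P} (\<lambda>s. (cmod (f s))\<^sup>2)"
proof -
  define a where "a n = fcoeff P f n / P" for n
  define p where "p s = (\<Sum>n\<in>F. a n * fmode P n s)" for s
  define B where "B = (\<Sum>n\<in>F. (cmod (fcoeff P f n))\<^sup>2)"
  have cp: "cnj (p s) = (\<Sum>n\<in>F. cnj (a n) * fmode P (- n) s)" for s
    by (simp add: p_def cnj_fmode)
  have "((\<lambda>s. \<Sum>n\<in>F. cnj (a n) * (f s * fmode P (- n) s)) has_integral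
      (\<Sum>n\<in>F. cnj (a n) * fcoeff P f n)) {0..P}"
    by (intro has_integral_sum F has_integral_mult_right fcoeff_has_integral f)
  moreover have "(\<lambda>s. \<Sum>n\<in>F. cnj (a n) * (f s * fmode P (- n) s)) = (\<lambda>s. f s * cnj (p s))"
    by (simp add: cp sum_distrib_left mult_ac)
  moreover have "(\<Sum>n\<in>F. cnj (a n) * fcoeff P f n) = of_real (B / P)"
  proof -
    have "cnj (a n) * fcoeff P f n = of_real ((cmod (fcoeff P f n))\<^sup>2 / P)" for n
      by (simp only: a_def complex_norm_square of_real_divide complex_cnj_divide complex_cnj_complex_of_real)
        (simp add: mult.commute)
    then show ?thesis by (simp add: B_def sum_divide_distrib)
  qed
  ultimately have i1: "((\<lambda>s. f s * cnj (p s)) has_integral of_real (B / P)) {0..P}" by simp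
  have "((\<lambda>s. \<Sum>n\<in>F. \<Sum>m\<in>F. a n * cnj (a m) * fmode P (n - m) s) has_integral
      (\<Sum>n\<in>F. \<Sum>m\<in>F. a n * cnj (a m) * (if n - m = 0 then of_real P else 0))) {0..P}"
    by (intro has_integral_sum F has_integral_mult_right fmode_has_integral P)
  moreover have "(\<lambda>s. \<Sum>n\<in>F. \<Sum>m\<in>F. a n * cnj (a m) * fmode P (n - m) s) = (\<lambda>s. p s * cnj (p s))"
  proof
    fix s
    have "a n * cnj (a m) * fmode P (n - m) s = (a n * fmode P n s) * (cnj (a m) * fmode P (- m) s)" for n m
      using fmode_add[of P n "- m" s] by (simp add: mult_ac)
    then show "(\<Sum>n\<in>F. \<Sum>m\<in>F. a n * cnj (a m) * fmode P (n - m) s) = p s * cnj (p s)"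
      by (simp only: cp) (simp only: p_def sum_product)
  qed
  moreover have "(\<Sum>n\<in>F. \<Sum>m\<in>F. a n * cnj (a m) * (if n - m = 0 then of_real P else 0))
      = of_real (B / P)"
  proof -
    have "(\<Sum>m\<in>F. a n * cnj (a m) * (if n - m = 0 then of_real P else 0))
        = of_real ((cmod (fcoeff P f n))\<^sup>2 / P)" if "n \<in> F" for n
    proof -
      have "(\<Sum>m\<in>F. a n * cnj (a m) * (if n - m = 0 then of_real P else 0))
         = (\<Sum>m\<in>F. if n = m then a n * cnj (a n) * of_real P else 0)"
        by (rule sum.cong) auto
      also have "\<dots> = a n * cnj (a n) * of_real P" using F that by simp
      also have "\<dots> = of_real ((cmod (fcoeff P f n))\<^sup>2 / P)"
        using P by (simp add: a_def complex_norm_square del: of_real_power)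
      finally show ?thesis .
    qed
    then have "(\<Sum>n\<in>F. \<Sum>m\<in>F. a n * cnj (a m) * (if n - m = 0 then of_real P else 0))
        = (\<Sum>n\<in>F. of_real ((cmod (fcoeff P f n))\<^sup>2 / P))" by (rule sum.cong[OF refl])
    then show ?thesis by (simp only: of_real_sum[symmetric] B_def sum_divide_distrib)
  qed
  ultimately have i2: "((\<lambda>s. p s * cnj (p s)) has_integral of_real (B / P)) {0..P}" by simp
  have "((\<lambda>s. (cmod (f s))\<^sup>2 - 2 * Re (f s * cnj (p s)) + Re (p s * cnj (p s))) has_integral
      (integral {0..P} (\<lambda>s. (cmod (f s))\<^sup>2) - 2 * Re (of_real (B / P)) + Re (of_real (B / P)))) {0..P}"
    by (intro has_integral_add has_integral_diff has_integral_mult_right integrable_integral f2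
        has_integral_linear[OF i1 bounded_linear_Re, unfolded o_def]
        has_integral_linear[OF i2 bounded_linear_Re, unfolded o_def])
  moreover have "(\<lambda>s. (cmod (f s))\<^sup>2 - 2 * Re (f s * cnj (p s)) + Re (p s * cnj (p s)))
      = (\<lambda>s. (cmod (f s - p s))\<^sup>2)"
    by (rule ext) (simp add: cmod_power2 power2_diff, simp add: power2_eq_square)
  ultimately have "((\<lambda>s. (cmod (f s - p s))\<^sup>2) has_integral
      (integral {0..P} (\<lambda>s. (cmod (f s))\<^sup>2) - 2 * (B / P) + B / P)) {0..P}"
    by (simp only: Re_complex_of_real)
  then have "0 \<le> integral {0..P} (\<lambda>s. (cmod (f s))\<^sup>2) - 2 * (B / P) + B / P"
    by (rule has_integral_nonneg) simp
  then show ?thesis using P by (simp add: B_def[symmetric] field_simps)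
qed

text \<open>The indefinite integral \<open>H\<close> of an integrable function has no derivative at a given point
  in general.  Instead, the defect \<open>K\<close> in the formula on \<open>[a, s]\<close> satisfies
  \<open>\<bar>K q - K p\<bar> \<le> 2 C (q - p) (W q - W p)\<close> with the continuous function \<open>W s = \<integral>\<bar>h\<bar>\<close> over
  \<open>[a, s]\<close>.  So \<open>K\<close> has derivative zero everywhere and is constant.\<close>

lemma integration_by_parts_indefinite:
  fixes h e e' :: "real \<Rightarrow> complex"
  assumes ab: "a \<le> b" and h: "h absolutely_integrable_on {a..b}"
    and e: "\<And>s. s \<in> {a..b} \<Longrightarrow> (e has_vector_derivative e' s) (at s within {a..b})"
    and e': "continuous_on {a..b} e'"
  defines "H \<equiv> \<lambda>s. integral {a..s} h"
  shows "integral {a..b} (\<lambda>s. h s * e s) = H b * e b - integral {a..b} (\<lambda>s. H s * e' s)"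
proof -
  have hi: "h integrable_on {a..b}" and hn: "(\<lambda>s. cmod (h s)) integrable_on {a..b}"
    using h by (auto simp: absolutely_integrable_on_def)
  have ec: "continuous_on {a..b} e"
    using e by (meson continuous_on_eq_continuous_within has_vector_derivative_continuous)
  have Hc: "continuous_on {a..b} H" unfolding H_def by (rule indefinite_integral_continuous_1[OF hi])
  have he: "(\<lambda>s. h s * e s) integrable_on {a..b}"
    using absolutely_integrable_mult_continuous[OF h ec] by (rule set_lebesgue_integral_eq_integral(1))
  have He': "(\<lambda>s. H s * e' s) integrable_on {a..b}"
    by (intro integrable_continuous_real continuous_on_mult Hc e')
  define W where "W s = integral {a..s} (\<lambda>r. cmod (h r))" for s
  have Wc: "continuous_on {a..b} W" unfolding W_def by (rule indefinite_integral_continuous_1[OF hn])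
  \<comment> \<open>The defect of the formula on \<open>[a, s]\<close>.\<close>
  define K where "K s = integral {a..s} (\<lambda>r. h r * e r) - H s * e s + integral {a..s} (\<lambda>r. H r * e' r)" for s
  obtain C where C: "C \<ge> 0" "\<And>s. s \<in> {a..b} \<Longrightarrow> cmod (e' s) \<le> C"
    using compact_imp_bounded[OF compact_continuous_image[OF e' compact_Icc]]
    unfolding bounded_iff by (metis image_eqI norm_ge_zero order_trans ab atLeastAtMost_iff order_refl)
  have sub: "f integrable_on {p..q}" if "f integrable_on {a..b}" "a \<le> p" "q \<le> b" for f :: "real \<Rightarrow> 'x::banach" and p q
    by (rule integrable_subinterval_real[OF that(1)]) (use that in auto)
  have key: "cmod (K q - K p) \<le> 2 * C * (q - p) * (W q - W p)" if pq: "a \<le> p" "p \<le> q" "q \<le> b" for p q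
  proof -
    have split: "integral {a..q} f = integral {a..p} f + integral {p..q} f"
      if "f integrable_on {a..b}" for f :: "real \<Rightarrow> 'x::banach"
      using Henstock_Kurzweil_Integration.integral_combine[of a p q f] sub[OF that, of a q] pq by simp
    have ebound: "cmod (e r - e q) \<le> C * (q - p)" if r: "r \<in> {p..q}" for r
    proof -
      have "norm (e r - e q) \<le> C * norm (r - q)"
      proof (rule differentiable_bound[where S = "{a..b}" and f' = "\<lambda>x h. h *\<^sub>R e' x"])
        show "(e has_derivative (\<lambda>h. h *\<^sub>R e' x)) (at x within {a..b})" if "x \<in> {a..b}" for x
          using e[OF that] by (simp add: has_vector_derivative_def)
        show "onorm (\<lambda>h. h *\<^sub>R e' x) \<le> C" if "x \<in> {a..b}" for x
          using C(2)[OF that] by (intro onorm_bound C(1)) (simp add: mult.commute[of C] mult_left_mono)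
      qed (use r pq in auto)
      also have "\<dots> \<le> C * (q - p)" using r C(1) by (intro mult_left_mono) auto
      finally show ?thesis .
    qed
    have Wpq: "W q - W p = integral {p..q} (\<lambda>r. cmod (h r))" using split[OF hn] by (simp add: W_def)
    have hpq: "h integrable_on {p..q}" "(\<lambda>r. cmod (h r)) integrable_on {p..q}"
      "(\<lambda>r. h r * e r) integrable_on {p..q}" "(\<lambda>r. H r * e' r) integrable_on {p..q}"
      "e' integrable_on {p..q}"
      using sub[OF hi] sub[OF hn] sub[OF he] sub[OF He'] sub[OF integrable_continuous_real[OF e']] pq by auto
    have eq: "integral {p..q} e' = e q - e p"
      by (intro integral_unique fundamental_theorem_of_calculus pq)
        (use pq in \<open>auto intro!: has_vector_derivative_within_subset[OF e]\<close>)
    have "K q - K p = integral {p..q} (\<lambda>r. h r * e r) - (H q * e q - H p * e p) + integral {p..q} (\<lambda>r. H r * e' r)"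
      unfolding K_def using split[OF he] split[OF He'] by simp
    also have "\<dots> = (integral {p..q} (\<lambda>r. h r * e r) - integral {p..q} h * e q)
        + (integral {p..q} (\<lambda>r. H r * e' r) - H p * integral {p..q} e')"
      using split[OF hi] unfolding eq by (simp add: H_def algebra_simps)
    also have "\<dots> = integral {p..q} (\<lambda>r. h r * e r - h r * e q) + integral {p..q} (\<lambda>r. H r * e' r - H p * e' r)"
      using hpq by (simp add: Henstock_Kurzweil_Integration.integral_diff integrable_on_mult_right integrable_on_mult_left)
    also have "cmod \<dots> \<le> integral {p..q} (\<lambda>r. (C * (q - p)) * cmod (h r)) + integral {p..q} (\<lambda>r. (W q - W p) * C)"
    proof (rule order_trans[OF norm_triangle_ineq], rule add_mono; rule integral_norm_bound_integral)
      show "(\<lambda>r. h r * e r - h r * e q) integrable_on {p..q}" "(\<lambda>r. H r * e' r - H p * e' r) integrable_on {p..q}"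
        "(\<lambda>r. (C * (q - p)) * cmod (h r)) integrable_on {p..q}"
        using hpq by (auto intro!: integrable_diff integrable_on_mult_right integrable_on_mult_left)
      show "cmod (h r * e r - h r * e q) \<le> C * (q - p) * cmod (h r)" if "r \<in> {p..q}" for r
      proof -
        have "h r * e r - h r * e q = (e r - e q) * h r" by (simp add: algebra_simps)
        then show ?thesis using ebound[OF that] by (simp only: norm_mult) (simp add: mult_right_mono)
      qed
      show "cmod (H r * e' r - H p * e' r) \<le> (W q - W p) * C" if r: "r \<in> {p..q}" for r
      proof -
        have "integral {a..r} h = integral {a..p} h + integral {p..r} h"
          using Henstock_Kurzweil_Integration.integral_combine[of a p r h] sub[OF hi, of a r] pq r by simp
        then have "H r - H p = integral {p..r} h" by (simp add: H_def)
        also have "cmod \<dots> \<le> integral {p..r} (\<lambda>r. cmod (h r))"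
          by (intro integral_norm_bound_integral sub[OF hi] sub[OF hn]) (use pq r in auto)
        also have "\<dots> \<le> integral {p..q} (\<lambda>r. cmod (h r))"
          by (intro integral_subset_le sub[OF hn]) (use pq r in auto)
        finally have "cmod (H r - H p) \<le> W q - W p" by (simp add: Wpq)
        moreover from this have "0 \<le> W q - W p" by (rule order_trans[OF norm_ge_zero])
        ultimately have "cmod (H r - H p) * cmod (e' r) \<le> (W q - W p) * C"
          using C(2)[of r] pq r by (intro mult_mono) auto
        moreover have "H r * e' r - H p * e' r = (H r - H p) * e' r" by (simp add: algebra_simps)
        ultimately show ?thesis by (simp only: norm_mult)
      qed
    qed auto
    also have "\<dots> = 2 * C * (q - p) * (W q - W p)"
      using pq unfolding Wpq by simp
    finally show ?thesis .
  qed
  have "(K has_vector_derivative 0) (at s within {a..b})" if s: "s \<in> {a..b}" for s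
  proof -
    have "((\<lambda>r. norm (K r - K s) / norm (r - s)) \<longlongrightarrow> 0) (at s within {a..b})"
    proof (rule tendsto_sandwich[where f = "\<lambda>r. 0" and h = "\<lambda>r. 2 * C * \<bar>W r - W s\<bar>"])
      have "(W \<longlongrightarrow> W s) (at s within {a..b})" using Wc s by (simp add: continuous_on_def)
      then have "((\<lambda>r. 2 * C * \<bar>W r - W s\<bar>) \<longlongrightarrow> 2 * C * \<bar>W s - W s\<bar>) (at s within {a..b})"
        by (intro tendsto_intros)
      then show "((\<lambda>r. 2 * C * \<bar>W r - W s\<bar>) \<longlongrightarrow> 0) (at s within {a..b})" by simp
      show "\<forall>\<^sub>F r in at s within {a..b}. norm (K r - K s) / norm (r - s) \<le> 2 * C * \<bar>W r - W s\<bar>"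
        unfolding eventually_at_filter
      proof (rule always_eventually, intro allI impI)
        fix r assume r: "r \<noteq> s" "r \<in> {a..b}"
        have "cmod (K r - K s) \<le> 2 * C * \<bar>r - s\<bar> * \<bar>W r - W s\<bar>"
        proof (cases "r \<le> s")
          case True
          have "cmod (K r - K s) \<le> 2 * C * (s - r) * (W s - W r)"
            using key[of r s] r s True by (simp add: norm_minus_commute)
          also have "\<dots> = 2 * C * \<bar>r - s\<bar> * (W s - W r)" using True by simp
          also have "\<dots> \<le> 2 * C * \<bar>r - s\<bar> * \<bar>W r - W s\<bar>"
            using C(1) by (intro mult_left_mono) auto
          finally show ?thesis .
        next
          case False
          have "cmod (K r - K s) \<le> 2 * C * (r - s) * (W r - W s)" using key[of s r] r s False by simp
          also have "\<dots> = 2 * C * \<bar>r - s\<bar> * (W r - W s)" using False by simp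
          also have "\<dots> \<le> 2 * C * \<bar>r - s\<bar> * \<bar>W r - W s\<bar>"
            using C(1) by (intro mult_left_mono) auto
          finally show ?thesis .
        qed
        then show "norm (K r - K s) / norm (r - s) \<le> 2 * C * \<bar>W r - W s\<bar>"
          using r by (simp add: divide_le_eq mult_ac)
      qed
    qed auto
    then show ?thesis
      unfolding has_vector_derivative_def has_derivative_iff_norm by simp
  qed
  then have "K b = K a"
    by (intro has_derivative_zero_unique[of "{a..b}"]) (use ab in \<open>auto simp: has_vector_derivative_def\<close>)
  then show ?thesis by (simp add: K_def H_def algebra_simps)
qed

lemma has_vector_derivative_quotient:
  fixes f :: "real \<Rightarrow> complex"
  assumes "(f has_vector_derivative f') (at s)"
  shows "((\<lambda>r. (f r - f s) / of_real (r - s)) \<longlongrightarrow> f') (at s)"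
proof -
  have "((\<lambda>r. norm (f r - f s - (r - s) *\<^sub>R f') / norm (r - s)) \<longlongrightarrow> 0) (at s)"
    using assms unfolding has_vector_derivative_def has_derivative_iff_norm by simp
  moreover have "\<forall>\<^sub>F r in at s. norm (f r - f s - (r - s) *\<^sub>R f') / norm (r - s)
      = norm ((f r - f s) / of_real (r - s) - f')"
    unfolding eventually_at_filter
  proof (rule always_eventually, intro allI impI)
    fix r assume "r \<noteq> s"
    then have "(f r - f s) / of_real (r - s) - f' = (f r - f s - (r - s) *\<^sub>R f') / of_real (r - s)"
      by (simp add: diff_divide_distrib scaleR_conv_of_real)
    then show "norm (f r - f s - (r - s) *\<^sub>R f') / norm (r - s) = norm ((f r - f s) / of_real (r - s) - f')"
      by (simp only: norm_divide norm_of_real real_norm_def)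
  qed
  ultimately have "((\<lambda>r. norm ((f r - f s) / of_real (r - s) - f')) \<longlongrightarrow> 0) (at s)"
    by (rule Lim_transform_eventually)
  then show ?thesis by (simp only: tendsto_norm_zero_iff Lim_null[symmetric])
qed

lemma square_summable_constant_norm:
  fixes \<gamma> :: "nat \<Rightarrow> complex"
  assumes "\<And>k. cmod (\<gamma> (Suc k)) = cmod (\<gamma> k)" and B: "\<And>N. (\<Sum>k<N. (cmod (\<gamma> k))\<^sup>2) \<le> B"
  shows "\<gamma> 0 = 0"
proof (rule ccontr)
  assume "\<gamma> 0 \<noteq> 0"
  then have pos: "(cmod (\<gamma> 0))\<^sup>2 > 0" by simp
  have const: "cmod (\<gamma> k) = cmod (\<gamma> 0)" for k by (induction k) (simp_all add: assms(1))
  have "(\<Sum>k<N. (cmod (\<gamma> k))\<^sup>2) = (\<Sum>k<N. (cmod (\<gamma> 0))\<^sup>2)" for N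
    by (rule sum.cong[OF refl], rule arg_cong[OF const])
  then have "real N * (cmod (\<gamma> 0))\<^sup>2 \<le> B" for N using B[of N] by simp
  then show False using reals_Archimedean3[OF pos] by (metis not_le)
qed

text \<open>Reduced by its mean, the antiderivative \<open>E\<close> of \<open>D\<close> has vanishing coefficients as well, and near an
  interior point \<open>s\<^sub>0\<close> the quotient \<open>(E s - E s\<^sub>0) / (e\<^sub>1 s - e\<^sub>1 s\<^sub>0)\<close> extends continuously.  The
  coefficients of the quotient obey a two-term recursion which preserves the modulus except for a
  jump at index 0, and by Bessel's inequality such a sequence vanishes on both sides, so the jump
  vanishes.\<close>

lemma fourier_uniqueness:
  fixes D :: "real \<Rightarrow> complex"
  assumes P: "P > 0" and D: "continuous_on {0..P} D"
    and zero: "\<And>n. integral {0..P} (\<lambda>s. D s * fmode P n s) = 0"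
    and s: "s \<in> {0..P}"
  shows "D s = 0"
proof -
  define \<omega> where "\<omega> n = 2 * pi * \<i> * of_int n / P" for n
  have \<omega>: "\<omega> n = 0 \<longleftrightarrow> n = 0" for n using P by (simp add: \<omega>_def)
  define E where "E s = integral {0..s} D" for s
  have Di: "D absolutely_integrable_on {0..P}" by (rule absolutely_integrable_continuous_real[OF D])
  have Ed: "(E has_vector_derivative D s) (at s within {0..P})" if "s \<in> {0..P}" for s
    unfolding E_def using integral_has_vector_derivative[OF D that] .
  have Ed_interior: "(E has_vector_derivative D s) (at s)" if "0 < s" "s < P" for s
  proof -
    have "s \<in> interior {0..P}" using that by simp
    from at_within_interior[OF this] Ed[of s] that show ?thesis by simp
  qed
  have Ec: "continuous_on {0..P} E"
    using Ed by (meson continuous_on_eq_continuous_within has_vector_derivative_continuous)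
  have EP: "E P = 0" using zero[of 0] by (simp add: E_def)
  have Ezero: "integral {0..P} (\<lambda>s. E s * fmode P n s) = 0" if "n \<noteq> 0" for n
  proof -
    have "integral {0..P} (\<lambda>s. D s * fmode P n s)
        = E P * fmode P n P - integral {0..P} (\<lambda>s. E s * (\<omega> n * fmode P n s))"
      unfolding E_def \<omega>_def
      by (rule integration_by_parts_indefinite[OF _ Di fmode_has_derivative])
        (use P in \<open>auto intro!: continuous_intros continuous_fmode\<close>)
    then have "integral {0..P} (\<lambda>s. E s * (\<omega> n * fmode P n s)) = 0"
      using zero[of n] EP by simp
    moreover have "(\<lambda>s. E s * (\<omega> n * fmode P n s)) = (\<lambda>s. \<omega> n * (E s * fmode P n s))" by (simp add: mult_ac)
    ultimately show ?thesis using \<omega> that by simp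
  qed
  define \<mu> where "\<mu> = integral {0..P} E / P"
  have "E s0 = \<mu>" if s0: "0 < s0" "s0 < P" for s0
  proof -
    define z where "z = fmode P 1 s0"
    define g where "g s = (if s = s0 then D s0 / (\<omega> 1 * z) else (E s - E s0) / (fmode P 1 s - z))" for s
    have z: "cmod z = 1" "z \<noteq> 0" by (auto simp: z_def fmode_def)
    have ne: "fmode P 1 s \<noteq> z" if "s \<in> {0..P}" "s \<noteq> s0" for s
    proof
      assume "fmode P 1 s = z"
      then have "cis (pi * (2 * s / P)) = cis (pi * (2 * s0 / P))" by (simp add: z_def fmode_cis)
      then have "cis (pi * (2 * s / P) - pi * (2 * s0 / P)) = 1" by (simp add: cis_divide[symmetric])
      then obtain k :: int where k: "pi * (2 * s / P) - pi * (2 * s0 / P) = of_int k * (2 * pi)"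
        by (auto simp: complex_eq_iff cos_one_2pi_int)
      have "pi * (2 * s / P) - pi * (2 * s0 / P) = 2 * pi * ((s - s0) / P)" using P by (simp add: field_simps)
      with k have "2 * pi * ((s - s0) / P) = 2 * pi * of_int k" by (simp add: mult_ac)
      then have "(s - s0) / P = of_int k" by (subst (asm) mult_left_cancel) auto
      then have eq: "s - s0 = of_int k * P" using P by (simp add: field_simps)
      have "\<bar>s - s0\<bar> < P" using that s0 by auto
      then have "\<bar>of_int k :: real\<bar> * P < 1 * P" using P unfolding eq by (simp add: abs_mult)
      then have "\<bar>k\<bar> < 1" using P by (simp only: mult_less_cancel_right_pos)
      then show False using eq that by simp
    qed
    have gE: "E s - E s0 = g s * (fmode P 1 s - z)" if "s \<in> {0..P}" for s
      using ne[OF that] by (auto simp: g_def z_def)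
    have gc: "continuous_on {0..P} g"
    proof -
      have "continuous (at s within {0..P}) g" if s: "s \<in> {0..P}" for s
      proof (cases "s = s0")
        case False
        have "continuous (at s within {0..P}) (\<lambda>s. (E s - E s0) / (fmode P 1 s - z))"
        proof (intro continuous_intros)
          show "continuous (at s within {0..P}) E" "continuous (at s within {0..P}) (fmode P 1)"
            using Ec continuous_fmode[of "{0..P}" P 1] s
            unfolding continuous_on_eq_continuous_within by blast+
          show "fmode P 1 s - z \<noteq> 0" using ne[OF s False] by simp
        qed
        then show ?thesis
        proof (rule continuous_transform_within[where \<delta> = "\<bar>s - s0\<bar>"])
          fix r assume "dist r s < \<bar>s - s0\<bar>"
          then have "r \<noteq> s0" by (auto simp: dist_real_def)
          then show "(E r - E s0) / (fmode P 1 r - z) = g r" by (simp only: g_def if_False)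
        qed (use s False in auto)
      next
        case True
        have "(E has_vector_derivative D s0) (at s0)"
          by (rule Ed_interior[OF s0])
        from has_vector_derivative_quotient[OF this]
        have "((\<lambda>r. (E r - E s0) / of_real (r - s0)) \<longlongrightarrow> D s0) (at s0)" .
        moreover have "((\<lambda>r. (fmode P 1 r - z) / of_real (r - s0)) \<longlongrightarrow> \<omega> 1 * z) (at s0)"
          unfolding z_def \<omega>_def by (rule has_vector_derivative_quotient[OF fmode_has_derivative])
        moreover have "\<omega> 1 * z \<noteq> 0" using \<omega>[of 1] z by simp
        ultimately have "((\<lambda>r. ((E r - E s0) / of_real (r - s0)) / ((fmode P 1 r - z) / of_real (r - s0)))
            \<longlongrightarrow> D s0 / (\<omega> 1 * z)) (at s0)" by (rule tendsto_divide)
        moreover have "\<forall>\<^sub>F r in at s0. ((E r - E s0) / of_real (r - s0)) / ((fmode P 1 r - z) / of_real (r - s0)) = g r"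
          unfolding eventually_at_filter by (rule always_eventually) (simp add: g_def)
        ultimately have "(g \<longlongrightarrow> D s0 / (\<omega> 1 * z)) (at s0)" by (rule Lim_transform_eventually)
        then have "isCont g s0" by (simp add: isCont_def g_def)
        then show ?thesis using True continuous_at_imp_continuous_at_within by blast
      qed
      then show ?thesis by (simp add: continuous_on_eq_continuous_within)
    qed
    define \<gamma> where "\<gamma> n = fcoeff P g (- n)" for n
    have gi: "g absolutely_integrable_on {0..P}" by (rule absolutely_integrable_continuous_real[OF gc])
    have \<gamma>i: "((\<lambda>s. g s * fmode P n s) has_integral \<gamma> n) {0..P}" for n
      using fcoeff_has_integral[OF gi, of "- n"] by (simp add: \<gamma>_def)
    \<comment> \<open>Multiply the definition of the quotient by \<open>fmode P n\<close> and integrate.\<close>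
    have step: "\<gamma> (n + 1) - z * \<gamma> n = (if n = 0 then (\<mu> - E s0) * P else 0)" for n
    proof -
      have "((\<lambda>s. g s * fmode P (n + 1) s - z * (g s * fmode P n s)) has_integral (\<gamma> (n + 1) - z * \<gamma> n)) {0..P}"
        by (intro has_integral_diff has_integral_mult_right \<gamma>i)
      moreover have "g s * fmode P (n + 1) s - z * (g s * fmode P n s) = E s * fmode P n s - E s0 * fmode P n s"
        if "s \<in> {0..P}" for s
      proof -
        have "(E s - E s0) * fmode P n s = g s * (fmode P 1 s - z) * fmode P n s"
          using gE[OF that] by simp
        then show ?thesis by (simp add: fmode_add algebra_simps)
      qed
      ultimately have 1: "((\<lambda>s. E s * fmode P n s - E s0 * fmode P n s) has_integral (\<gamma> (n + 1) - z * \<gamma> n)) {0..P}"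
        using has_integral_cong by (metis (no_types, lifting))
      have "((\<lambda>s. E s * fmode P n s) has_integral (if n = 0 then \<mu> * P else 0)) {0..P}"
      proof -
        have "(\<lambda>s. E s * fmode P n s) integrable_on {0..P}"
          by (intro integrable_continuous_real continuous_on_mult Ec continuous_fmode)
        from integrable_integral[OF this] show ?thesis
          using Ezero[of n] P by (auto simp: \<mu>_def split: if_splits)
      qed
      from has_integral_diff[OF this has_integral_mult_right[OF fmode_has_integral[OF P]]]
      have "((\<lambda>s. E s * fmode P n s - E s0 * fmode P n s) has_integral
         ((if n = 0 then \<mu> * P else 0) - E s0 * (if n = 0 then of_real P else 0))) {0..P}" .
      from has_integral_unique[OF 1 this] show ?thesis by (simp add: left_diff_distrib)
    qed
    have jump: "\<gamma> 1 - z * \<gamma> 0 = (\<mu> - E s0) * P" using step[of 0] by simp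
    have rec: "\<gamma> (n + 1) = z * \<gamma> n" if "n \<noteq> 0" for n using step[of n] that by simp
    have rec': "n \<noteq> 0 \<Longrightarrow> cmod (\<gamma> (n + 1)) = cmod (\<gamma> n)" for n
      using rec[of n] z by (simp add: norm_mult)
    define B where "B = P * integral {0..P} (\<lambda>s. (cmod (g s))\<^sup>2)"
    have "(\<lambda>s. (cmod (g s))\<^sup>2) integrable_on {0..P}"
      by (intro integrable_continuous_real continuous_intros gc)
    note bessel = bessel_inequality[OF P gi this, folded B_def]
    have bound: "(\<Sum>k<N. (cmod (\<gamma> (f k)))\<^sup>2) \<le> B" if "inj f" for f :: "nat \<Rightarrow> int" and N
    proof -
      have "inj_on (\<lambda>k. - f k) {..<N}" using that by (auto simp: inj_on_def)
      from sum.reindex[OF this, of "\<lambda>n. (cmod (fcoeff P g n))\<^sup>2"]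
      show ?thesis using bessel[of "(\<lambda>k. - f k) ` {..<N}"] by (simp add: \<gamma>_def o_def)
    qed
    have "\<gamma> (1 + int 0) = 0"
    proof (rule square_summable_constant_norm[where \<gamma> = "\<lambda>k. \<gamma> (1 + int k)"])
      show "cmod (\<gamma> (1 + int (Suc k))) = cmod (\<gamma> (1 + int k))" for k
        using rec'[of "1 + int k"] by (simp add: add_ac)
    qed (rule bound, simp add: inj_def)
    moreover have "\<gamma> (- int 0) = 0"
    proof (rule square_summable_constant_norm[where \<gamma> = "\<lambda>k. \<gamma> (- int k)"])
      show "cmod (\<gamma> (- int (Suc k))) = cmod (\<gamma> (- int k))" for k
        using rec'[of "- int (Suc k)"] by simp
    qed (rule bound, simp add: inj_def)
    ultimately show ?thesis using jump P by simp
  qed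
  note const = this
  have "D s = 0" if s: "s \<in> {0<..<P}" for s
  proof -
    have "(E has_vector_derivative D s) (at s)"
      using Ed_interior[of s] s by simp
    moreover have "(E has_vector_derivative 0) (at s)"
      by (rule has_vector_derivative_transform_within_open[of "\<lambda>s. \<mu>" _ _ "{0<..<P}"])
        (use s const in auto)
    ultimately show ?thesis by (rule vector_derivative_unique_at)
  qed
  then show ?thesis
    using continuous_constant_on_closure[of "{0<..<P}" D 0 s] D P s by simp
qed

lemma summable_on_inverse_square_int: "(\<lambda>n::int. 1 / (of_int n)\<^sup>2 :: real) summable_on (UNIV - {0})"
proof -
  let ?p = "\<lambda>k. int (Suc k)" and ?m = "\<lambda>k. - int (Suc k)"
  have s: "summable (\<lambda>k. 1 / (real (Suc k))\<^sup>2)"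
    using inverse_power_summable[of 2, where 'a = real] by (subst summable_Suc_iff) (simp add: divide_inverse)
  then have "(\<lambda>k. 1 / (real (Suc k))\<^sup>2) summable_on UNIV"
    by (subst summable_on_UNIV_nonneg_real_iff) auto
  moreover have "inj ?p" "inj ?m" by (auto simp: inj_def)
  ultimately have "(\<lambda>n::int. 1 / (of_int n)\<^sup>2 :: real) summable_on range ?p"
    "(\<lambda>n::int. 1 / (of_int n)\<^sup>2 :: real) summable_on range ?m"
    by (simp_all add: summable_on_reindex o_def power2_eq_square algebra_simps)
  moreover have "UNIV - {0} = range ?p \<union> range ?m"
  proof -
    have "n \<in> range ?p \<union> range ?m" if "n \<noteq> 0" for n
    proof (cases "n > 0")
      case True
      then have "n = ?p (nat (n - 1))" by simp
      then show ?thesis by blast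
    next
      case False
      then have "n = ?m (nat (- n - 1))" using that by simp
      then show ?thesis by blast
    qed
    then show ?thesis by auto
  qed
  ultimately show ?thesis by (simp only: summable_on_Un_disjoint) (auto intro!: summable_on_Un_disjoint)
qed

text \<open>By Bessel's inequality and the convergence of \<open>\<Sum>1 / n\<^sup>2\<close> the coefficients are absolutely
  summable, so the series converges uniformly to a continuous function \<open>S\<close> with these
  coefficients.  Integration by parts shows that the antiderivative of \<open>h\<close> has the same
  coefficients away from index 0, and uniqueness does the rest.\<close>

theorem fourier_series_antiderivative:
  fixes h :: "real \<Rightarrow> complex"
  assumes P: "P > 0" and h: "h absolutely_integrable_on {0..P}"
    and h2: "(\<lambda>s. (cmod (h s))\<^sup>2) integrable_on {0..P}" and mean: "integral {0..P} h = 0"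
  defines "c \<equiv> \<lambda>n. 1 / (2 * of_int n * of_real pi * \<i>) * fcoeff P h n"
  shows "(\<lambda>n. cmod (c n)) summable_on (UNIV - {0})"
    and "\<exists>c0. \<forall>s\<in>{0..P}. ((\<lambda>n. c n * fmode P n s) has_sum (integral {0..s} h - c0)) (UNIV - {0})"
proof -
  let ?Z = "UNIV - {0::int}"
  have "(\<lambda>n. (cmod (fcoeff P h n))\<^sup>2) summable_on ?Z"
    by (rule nonneg_bdd_above_summable_on)
      (auto intro!: bdd_aboveI2 bessel_inequality[OF P h h2])
  then have maj: "(\<lambda>n. (cmod (fcoeff P h n))\<^sup>2 + 1 / (of_int n)\<^sup>2) summable_on ?Z"
    by (intro summable_on_add summable_on_inverse_square_int)
  have le: "cmod (c n) \<le> (cmod (fcoeff P h n))\<^sup>2 + 1 / (of_int n)\<^sup>2" if "n \<in> ?Z" for n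
  proof -
    define x y where "x = cmod (fcoeff P h n)" and "y = 1 / \<bar>real_of_int n\<bar>"
    have xy: "x \<ge> 0" "y \<ge> 0" by (auto simp: x_def y_def)
    have "cmod (c n) = 1 / (2 * pi) * (x * y)"
      by (simp add: c_def x_def y_def norm_mult norm_divide)
    also have "\<dots> \<le> 1 * (x * y)" using pi_gt3 xy by (intro mult_right_mono) auto
    also have "\<dots> \<le> x\<^sup>2 + y\<^sup>2"
    proof -
      have "2 * (x * y) \<le> x\<^sup>2 + y\<^sup>2" using sum_squares_bound[of x y] by (simp add: mult.assoc)
      then show ?thesis using mult_nonneg_nonneg[OF xy] by linarith
    qed
    finally show ?thesis by (simp add: x_def y_def power_divide)
  qed
  show csum: "(\<lambda>n. cmod (c n)) summable_on ?Z"
    by (rule summable_on_comparison_test[OF maj]) (use le in auto)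
  define S where "S s = (\<Sum>\<^sub>\<infinity>n\<in>?Z. c n * fmode P n s)" for s
  have abs: "(\<lambda>n. norm (c n * fmode P n s)) summable_on ?Z" for s
    using csum by (simp add: norm_mult)
  have Ssum: "((\<lambda>n. c n * fmode P n s) has_sum S s) ?Z" for s
    unfolding S_def by (rule has_sum_infsum[OF abs_summable_summable[OF abs]])
  have unif: "uniform_limit {0..P} (\<lambda>X s. \<Sum>n\<in>X. c n * fmode P n s * fmode P m s) (\<lambda>s. S s * fmode P m s)
      (finite_subsets_at_top ?Z)" for m
    by (rule Weierstrass_m_test_general'[OF _ _ csum])
      (auto simp: norm_mult intro!: has_sum_cmult_left Ssum)
  have pc: "continuous_on {0..P} (\<lambda>s. \<Sum>n\<in>X. c n * fmode P n s * fmode P m s)" for X m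
    by (intro continuous_intros continuous_fmode)
  have Sc: "continuous_on {0..P} S"
    using uniform_limit_theorem[OF always_eventually unif[of 0]] pc[where m = 0] by simp
  have Scoeff: "((\<lambda>s. S s * fmode P m s) has_integral (if m = 0 then 0 else c (- m) * P)) {0..P}" for m
  proof -
    obtain I J where I: "\<And>X. ((\<lambda>s. \<Sum>n\<in>X. c n * fmode P n s * fmode P m s) has_integral I X) {0..P}"
      and J: "((\<lambda>s. S s * fmode P m s) has_integral J) {0..P}" and IJ: "(I \<longlongrightarrow> J) (finite_subsets_at_top ?Z)"
    proof (rule uniform_limit_integral[OF unif[of m] pc finite_subsets_at_top_neq_bot])
      fix I J
      assume "\<And>X. ((\<lambda>s. \<Sum>n\<in>X. c n * fmode P n s * fmode P m s) has_integral I X) {0..P}"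
        "((\<lambda>s. S s * fmode P m s) has_integral J) {0..P}" "(I \<longlongrightarrow> J) (finite_subsets_at_top ?Z)"
      then show thesis by (rule that)
    qed
    have Ival: "I X = (\<Sum>n\<in>X. c n * (if n + m = 0 then of_real P else 0))" if X: "finite X" for X
    proof -
      have "((\<lambda>s. \<Sum>n\<in>X. c n * fmode P (n + m) s) has_integral
          (\<Sum>n\<in>X. c n * (if n + m = 0 then of_real P else 0))) {0..P}"
        by (intro has_integral_sum X has_integral_mult_right fmode_has_integral P)
      then show ?thesis using I[of X] by (simp add: fmode_add mult.assoc has_integral_unique)
    qed
    let ?v = "if m = 0 then 0 else c (- m) * P"
    have "\<forall>\<^sub>F X in finite_subsets_at_top ?Z. I X = ?v"
    proof (rule eventually_finite_subsets_at_top[THEN iffD2], intro exI[of _ "?Z \<inter> {- m}"] conjI allI impI)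
      fix X assume X: "finite X \<and> ?Z \<inter> {- m} \<subseteq> X \<and> X \<subseteq> ?Z"
      have "(\<Sum>n\<in>X. c n * (if n + m = 0 then of_real P else 0)) = (\<Sum>n\<in>X. if n = - m then c (- m) * P else 0)"
        by (rule sum.cong) (auto simp: add_eq_0_iff2)
      also have "\<dots> = ?v" using X by (auto simp: sum.delta)
      finally show "I X = ?v" using Ival X by simp
    qed auto
    then have "(I \<longlongrightarrow> ?v) (finite_subsets_at_top ?Z)" by (rule tendsto_eventually)
    with IJ have "J = ?v" using tendsto_unique finite_subsets_at_top_neq_bot by blast
    then show ?thesis using J by simp
  qed
  define H where "H s = integral {0..s} h" for s
  have Hc: "continuous_on {0..P} H"
    unfolding H_def by (rule indefinite_integral_continuous_1) (rule set_lebesgue_integral_eq_integral(1)[OF h])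
  define c0 where "c0 = integral {0..P} H / P"
  have Hcoeff: "((\<lambda>s. H s * fmode P m s) has_integral (if m = 0 then c0 * P else c (- m) * P)) {0..P}" for m
  proof (cases "m = 0")
    case True
    then show ?thesis using integrable_integral[OF integrable_continuous_real[OF Hc]] P by (simp add: c0_def)
  next
    case False
    define \<omega> where "\<omega> = 2 * pi * \<i> * of_int m / P"
    have \<omega>: "\<omega> \<noteq> 0" using False P by (simp add: \<omega>_def)
    have "fcoeff P h (- m) = H P * fmode P m P - integral {0..P} (\<lambda>s. H s * (\<omega> * fmode P m s))"
      unfolding H_def \<omega>_def fcoeff_def minus_minus
      by (rule integration_by_parts_indefinite[OF _ h fmode_has_derivative])
        (use P in \<open>auto intro!: continuous_intros continuous_fmode\<close>)
    also have "(\<lambda>s. H s * (\<omega> * fmode P m s)) = (\<lambda>s. \<omega> * (H s * fmode P m s))" by (simp add: mult_ac)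
    finally have "\<omega> * integral {0..P} (\<lambda>s. H s * fmode P m s) = - fcoeff P h (- m)"
      using mean by (simp add: H_def)
    then have "integral {0..P} (\<lambda>s. H s * fmode P m s) = - fcoeff P h (- m) / \<omega>"
      using \<omega> by (simp add: field_simps)
    also have "\<dots> = c (- m) * P" using False P by (simp add: c_def \<omega>_def field_simps)
    finally have val: "integral {0..P} (\<lambda>s. H s * fmode P m s) = c (- m) * P" .
    have "(\<lambda>s. H s * fmode P m s) integrable_on {0..P}"
      by (intro integrable_continuous_real continuous_on_mult Hc continuous_fmode)
    from integrable_integral[OF this] show ?thesis unfolding val using False by simp
  qed
  have eq: "H s - c0 - S s = 0" if "s \<in> {0..P}" for s
  proof (rule fourier_uniqueness[OF P _ _ that])
    show "continuous_on {0..P} (\<lambda>s. H s - c0 - S s)" by (intro continuous_intros Hc Sc)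
    fix m
    have "((\<lambda>s. H s * fmode P m s - c0 * fmode P m s - S s * fmode P m s) has_integral
      (if m = 0 then c0 * P else c (- m) * P) - c0 * (if m = 0 then of_real P else 0)
       - (if m = 0 then 0 else c (- m) * P)) {0..P}"
      by (intro has_integral_diff has_integral_mult_right fmode_has_integral P Hcoeff Scoeff)
    then show "integral {0..P} (\<lambda>s. (H s - c0 - S s) * fmode P m s) = 0"
      by (cases "m = 0") (auto simp: left_diff_distrib integral_unique)
  qed
  show "\<exists>c0. \<forall>s\<in>{0..P}. ((\<lambda>n. c n * fmode P n s) has_sum (integral {0..s} h - c0)) ?Z"
  proof (intro exI ballI)
    fix s assume "s \<in> {0..P}"
    then have "S s = integral {0..s} h - c0" using eq[of s] by (simp add: H_def)
    then show "((\<lambda>n. c n * fmode P n s) has_sum (integral {0..s} h - c0)) ?Z" using Ssum[of s] by simp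
  qed
qed

section \<open>Propagation along characteristics\<close>

text \<open>The strip is closed, so that it contains the initial interval and both moving sides.\<close>

definition in_strip :: "real \<Rightarrow> real \<Rightarrow> real \<Rightarrow> real \<Rightarrow> real \<Rightarrow> bool" where
  "in_strip L v T x t \<longleftrightarrow> 0 \<le> t \<and> t \<le> T \<and> v * t \<le> x \<and> x \<le> L + v * t"

text \<open>The parallelogram identity: the point \<open>(x, t)\<close> is the latest corner of the rectangle, and
  \<open>a\<close>, \<open>b\<close> are the times spent going back along the two characteristics.\<close>

definition char_additive ::
  "real \<Rightarrow> real \<Rightarrow> real \<Rightarrow> (real \<times> real \<Rightarrow> 'a::real_vector) \<Rightarrow> bool" where
  "char_additive L v T w \<longleftrightarrow> (\<forall>x t a b. 0 \<le> a \<longrightarrow> 0 \<le> b \<longrightarrow> in_strip L v T x t \<longrightarrow>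
     in_strip L v T (x - a) (t - a) \<longrightarrow> in_strip L v T (x + b) (t - b) \<longrightarrow>
     in_strip L v T (x + b - a) (t - a - b) \<longrightarrow>
     w (x, t) + w (x + b - a, t - a - b) = w (x - a, t - a) + w (x + b, t - b))"

lemma char_additiveD:
  assumes "char_additive L v T w" "0 \<le> a" "0 \<le> b" "in_strip L v T x t"
    "in_strip L v T (x - a) (t - a)" "in_strip L v T (x + b) (t - b)"
    "in_strip L v T (x + b - a) (t - a - b)"
    "w (x - a, t - a) = 0" "w (x + b, t - b) = 0" "w (x + b - a, t - a - b) = 0"
  shows "w (x, t) = 0"
  using assms unfolding char_additive_def by (metis add.right_neutral)

text \<open>The zero set grows along characteristics.  Up to time \<open>L / 2\<close> a point outside the triangle
  sees exactly one side: a rectangle with one corner on that side has its two remaining corners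
  in the triangle.  Afterwards time advances in steps of \<open>L / 4\<close>: one goes back along both
  characteristics by the step or until a side is reached, and a strip of width \<open>L\<close> is too wide
  for both sides to be reached within one step.\<close>

lemma char_additive_zero:
  fixes w :: "real \<times> real \<Rightarrow> 'a::real_vector"
  assumes L: "L > 0" and v: "0 < v" "v < 1"
    and w: "char_additive L v T w"
    and left: "\<And>t. 0 \<le> t \<Longrightarrow> t \<le> T \<Longrightarrow> w (v * t, t) = 0"
    and right: "\<And>t. 0 \<le> t \<Longrightarrow> t \<le> T \<Longrightarrow> w (L + v * t, t) = 0"
    and triangle: "\<And>x t. 0 \<le> t \<Longrightarrow> t \<le> T \<Longrightarrow> 0 \<le> x - t \<Longrightarrow> x + t \<le> L \<Longrightarrow> w (x, t) = 0"
    and xt: "in_strip L v T x t"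
  shows "w (x, t) = 0"
proof -
  have base: "w (x, t) = 0" if xt: "in_strip L v T x t" and t: "t \<le> L / 2" for x t
  proof -
    have s: "0 \<le> t" "t \<le> T" "v * t \<le> x" "x \<le> L + v * t" using xt by (auto simp: in_strip_def)
    have vt: "0 \<le> v * t" "v * t \<le> t" using s v by (auto simp: mult_left_le_one_le)
    consider "0 \<le> x - t" "x + t \<le> L" | "x - t < 0" "x + t \<le> L" | "0 \<le> x - t" "x + t > L"
      using t by linarith
    then show ?thesis
    proof cases
      case 1
      then show ?thesis using triangle s by blast
    next
      case 2
      define a where "a = (x - v * t) / (1 - v)"
      define b where "b = t - a"
      have a: "(1 - v) * a = x - v * t" using v by (simp add: a_def)
      have a0: "0 \<le> a" unfolding a_def using s v by simp
      have "(1 - v) * a \<le> (1 - v) * t" unfolding a using 2 by (simp add: algebra_simps)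
      then have b0: "0 \<le> b" using v by (simp add: b_def)
      have va: "0 \<le> v * a" "v * a \<le> a" "0 \<le> v * b" "v * b \<le> b"
        using a0 b0 v by (auto simp: mult_left_le_one_le)
      have vb: "v * b = v * t - v * a" by (simp add: b_def algebra_simps)
      have ax: "x - a = v * (t - a)" using a by (simp add: algebra_simps)
      have ax': "x = a + v * b" using a vb by (simp add: algebra_simps)
      have tb: "t = a + b" by (simp add: b_def)
      show ?thesis
      proof (rule char_additiveD[OF w a0 b0 xt])
        show "in_strip L v T (x - a) (t - a)"
          unfolding ax in_strip_def using s a0 b0 L by (simp add: b_def)
        show "w (x - a, t - a) = 0" unfolding ax using left[of "t - a"] s a0 b0 by (simp add: b_def)
        show "w (x + b, t - b) = 0"
          using 2 a0 b0 va s by (intro triangle) (auto simp: ax' tb)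
        show "w (x + b - a, t - a - b) = 0"
          using 2 a0 b0 va s by (intro triangle) (auto simp: ax' tb)
        show "in_strip L v T (x + b) (t - b)"
          using 2 a0 b0 va s L by (auto simp: ax' tb in_strip_def)
        show "in_strip L v T (x + b - a) (t - a - b)"
          using 2 a0 b0 va s L by (auto simp: ax' tb in_strip_def)
      qed
    next
      case 3
      define b where "b = (L + v * t - x) / (1 + v)"
      define a where "a = t - b"
      have b: "(1 + v) * b = L + v * t - x" using v by (simp add: b_def)
      have b0: "0 \<le> b" unfolding b_def using s v by simp
      have "(1 + v) * b \<le> (1 + v) * t" unfolding b using 3 by (simp add: algebra_simps)
      then have a0: "0 \<le> a" using v by (simp add: a_def)
      have va: "0 \<le> v * a" "v * a \<le> a" "0 \<le> v * b" "v * b \<le> b"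
        using a0 b0 v by (auto simp: mult_left_le_one_le)
      have vb: "v * a = v * t - v * b" by (simp add: a_def algebra_simps)
      have bx: "x + b = L + v * (t - b)" using b by (simp add: algebra_simps)
      have bx': "x = L + v * a - b" using b vb by (simp add: algebra_simps)
      have tb: "t = a + b" by (simp add: a_def)
      show ?thesis
      proof (rule char_additiveD[OF w a0 b0 xt])
        show "in_strip L v T (x + b) (t - b)"
          unfolding bx in_strip_def using s a0 b0 L by (simp add: a_def)
        show "w (x + b, t - b) = 0" unfolding bx using right[of "t - b"] s a0 b0 by (simp add: a_def)
        show "w (x - a, t - a) = 0"
          using 3 a0 b0 va s by (intro triangle) (auto simp: bx' tb)
        show "w (x + b - a, t - a - b) = 0"
          using 3 a0 b0 va s by (intro triangle) (auto simp: bx' tb)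
        show "in_strip L v T (x - a) (t - a)"
          using 3 a0 b0 va s L by (auto simp: bx' tb in_strip_def)
        show "in_strip L v T (x + b - a) (t - a - b)"
          using 3 a0 b0 va s L by (auto simp: bx' tb in_strip_def)
      qed
    qed
  qed
  have "w (x, t) = 0" if "in_strip L v T x t" "t \<le> L / 2 + real n * (L / 4)" for n x t
    using that
  proof (induction n arbitrary: x t)
    case 0
    then show ?case using base by simp
  next
    case (Suc n)
    have s: "0 \<le> t" "t \<le> T" "v * t \<le> x" "x \<le> L + v * t" using Suc.prems(1) by (auto simp: in_strip_def)
    show ?case
    proof (cases "t \<le> L / 2")
      case True
      then show ?thesis using base Suc.prems(1) by blast
    next
      case False
      define \<alpha> \<beta> where "\<alpha> = (x - v * t) / (1 - v)" and "\<beta> = (L + v * t - x) / (1 + v)"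
      define a b where "a = min (L / 4) \<alpha>" and "b = min (L / 4) \<beta>"
      have \<alpha>\<beta>: "(1 - v) * \<alpha> = x - v * t" "(1 + v) * \<beta> = L + v * t - x" "0 \<le> \<alpha>" "0 \<le> \<beta>"
        using v s by (auto simp: \<alpha>_def \<beta>_def)
      have ab: "0 \<le> a" "0 \<le> b" "a \<le> L / 4" "b \<le> L / 4" "a \<le> \<alpha>" "b \<le> \<beta>"
        using \<alpha>\<beta> L by (auto simp: a_def b_def)
      have "(1 - v) * a \<le> (1 - v) * \<alpha>" "(1 + v) * b \<le> (1 + v) * \<beta>"
        using ab v by (auto intro: mult_left_mono)
      then have in1: "(1 - v) * a \<le> x - v * t" "(1 + v) * b \<le> L + v * t - x" using \<alpha>\<beta> by auto
      have pos: "0 \<le> (1 - v) * a" "0 \<le> (1 + v) * b" using ab v by auto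
      have IH: "w (y, r) = 0" if "in_strip L v T y r" "r \<le> t - L / 4" for y r
      proof (rule Suc.IH[OF that(1)])
        have "real (Suc n) * (L / 4) = real n * (L / 4) + L / 4" by (simp add: field_simps)
        then show "r \<le> L / 2 + real n * (L / 4)" using that(2) Suc.prems(2) by linarith
      qed
      \<comment> \<open>Hence the earliest corner lies at least one step back.\<close>
      have one: "a = L / 4 \<or> b = L / 4"
      proof (rule ccontr)
        assume "\<not> ?thesis"
        then have "\<alpha> < L / 4" "\<beta> < L / 4" by (auto simp: a_def b_def min_def split: if_splits)
        then have "(1 - v) * \<alpha> < (1 - v) * (L / 4)" "(1 + v) * \<beta> < (1 + v) * (L / 4)"
          using v by auto
        then show False using \<alpha>\<beta> L by (simp add: algebra_simps)
      qed
      have strips: "in_strip L v T (x - a) (t - a)" "in_strip L v T (x + b) (t - b)"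
        "in_strip L v T (x + b - a) (t - a - b)"
        using in1 pos s ab False L unfolding in_strip_def by (auto simp: algebra_simps)
      show ?thesis
      proof (rule char_additiveD[OF w ab(1,2) Suc.prems(1) strips])
        show "w (x - a, t - a) = 0"
        proof (cases "a = L / 4")
          case True
          then show ?thesis using IH strips(1) by simp
        next
          case False
          then have "a = \<alpha>" by (simp add: a_def min_def split: if_splits)
          then have "x - a = v * (t - a)" using \<alpha>\<beta>(1) by (simp add: algebra_simps)
          then show ?thesis using left[of "t - a"] strips(1) by (simp add: in_strip_def)
        qed
        show "w (x + b, t - b) = 0"
        proof (cases "b = L / 4")
          case True
          then show ?thesis using IH strips(2) by simp
        next
          case False
          then have "b = \<beta>" by (simp add: b_def min_def split: if_splits)
          then have "x + b = L + v * (t - b)" using \<alpha>\<beta>(2) by (simp add: algebra_simps)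
          then show ?thesis using right[of "t - b"] strips(2) by (simp add: in_strip_def)
        qed
        show "w (x + b - a, t - a - b) = 0"
          by (rule IH[OF strips(3)]) (use one ab in auto)
      qed
    qed
  qed
  moreover obtain n :: nat where "t / (L / 4) \<le> real n" using real_arch_simple by blast
  then have "t \<le> L / 2 + real n * (L / 4)" using L by (simp add: field_simps)
  ultimately show ?thesis using xt by blast
qed

section \<open>Square-integrable functions on an interval\<close>

text \<open>On a bounded interval this describes \<open>L\<^sup>2\<close>; carrying integrability of the function itself
  along spares a separate treatment of measurability.\<close>

definition square_integrable :: "real \<Rightarrow> real \<Rightarrow> (real \<Rightarrow> real) \<Rightarrow> bool" where
  "square_integrable a b f \<longleftrightarrow>
     set_integrable lebesgue {a..b} f \<and> set_integrable lebesgue {a..b} (\<lambda>x. (f x)\<^sup>2)"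

lemma square_integrableD:
  assumes "square_integrable a b f"
  shows "set_integrable lebesgue {a..b} f" "f integrable_on {a..b}"
    "(\<lambda>x. \<bar>f x\<bar>) integrable_on {a..b}" "(\<lambda>x. (f x)\<^sup>2) integrable_on {a..b}"
    "{p..q} \<subseteq> {a..b} \<Longrightarrow> set_integrable lebesgue {p..q} f"
proof -
  show 1: "set_integrable lebesgue {a..b} f" using assms by (simp add: square_integrable_def)
  then show "f integrable_on {a..b}" by (rule set_lebesgue_integral_eq_integral(1))
  show "(\<lambda>x. \<bar>f x\<bar>) integrable_on {a..b}"
    by (rule set_lebesgue_integral_eq_integral(1)[OF set_integrable_abs[OF 1]])
  show "(\<lambda>x. (f x)\<^sup>2) integrable_on {a..b}"
    by (rule set_lebesgue_integral_eq_integral(1)) (use assms in \<open>simp add: square_integrable_def\<close>)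
  show "{p..q} \<subseteq> {a..b} \<Longrightarrow> set_integrable lebesgue {p..q} f"
    by (rule set_integrable_subset[OF 1]) auto
qed

lemma set_integrable_Icc_iff_Ioo:
  fixes f :: "real \<Rightarrow> 'a::euclidean_space"
  shows "set_integrable lebesgue {a..b} f \<longleftrightarrow> set_integrable lebesgue {a<..<b} f"
proof -
  have "{a..b} - {a<..<b} \<subseteq> {a, b}" by auto
  then have "negligible ({a..b} - {a<..<b})" by (rule negligible_subset[rotated]) simp
  moreover have "{a<..<b} - {a..b} = {}" by auto
  ultimately show ?thesis
    by (intro absolutely_integrable_spike_set_eq negligible_subset[OF \<open>negligible ({a..b} - {a<..<b})\<close>]) auto
qed

text \<open>If the function is not integrable on one of the intervals, it is not integrable on the
  other, and both integrals are 0.\<close>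

lemma set_integral_Ioo_eq_Icc:
  fixes f :: "real \<Rightarrow> 'a::euclidean_space"
  shows "(LINT x:{a<..<b}|lebesgue. f x) = (LINT x:{a..b}|lebesgue. f x)"
proof -
  have "AE x in lebesgue. x \<noteq> a \<and> x \<noteq> b"
    using AE_lborel_singleton[of a] AE_lborel_singleton[of b] by (intro AE_completion) auto
  then have ae: "AE x in lebesgue. indicator {a<..<b} x *\<^sub>R f x = indicator {a..b} x *\<^sub>R f x"
    by eventually_elim (auto simp: indicator_def)
  show ?thesis
  proof (cases "set_integrable lebesgue {a..b} f")
    case True
    then show ?thesis unfolding set_lebesgue_integral_def
      using ae set_integrable_Icc_iff_Ioo[of a b f]
      by (intro integral_cong_AE) (auto simp: set_integrable_def)
  next
    case False
    then show ?thesis using set_integrable_Icc_iff_Ioo[of a b f]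
      by (simp add: set_lebesgue_integral_def set_integrable_def not_integrable_integral_eq)
  qed
qed

lemma set_integral_affine:
  fixes f :: "real \<Rightarrow> 'a::euclidean_space"
  assumes c: "c \<noteq> 0" and S: "\<And>y. y \<in> S' \<longleftrightarrow> t + c * y \<in> S"
  shows "set_integrable lebesgue S' (\<lambda>y. f (t + c * y)) \<longleftrightarrow> set_integrable lebesgue S f"
    and "(LINT y:S'|lebesgue. f (t + c * y)) = (LINT x:S|lebesgue. f x) /\<^sub>R \<bar>c\<bar>"
proof -
  have ind: "(\<lambda>y. indicator S' y *\<^sub>R f (t + c * y)) = (\<lambda>y. indicator S (t + c * y) *\<^sub>R f (t + c * y))"
    using S by (auto simp: indicator_def fun_eq_iff)
  note iff = has_bochner_integral_lebesgue_real_affine_iff[OF c, of "\<lambda>x. indicator S x *\<^sub>R f x" _ t]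
  show 1: "set_integrable lebesgue S' (\<lambda>y. f (t + c * y)) \<longleftrightarrow> set_integrable lebesgue S f"
    unfolding set_integrable_def ind
    by (rule lebesgue_integrable_real_affine_iff[OF c, of "\<lambda>x. indicator S x *\<^sub>R f x" t])
  show "(LINT y:S'|lebesgue. f (t + c * y)) = (LINT x:S|lebesgue. f x) /\<^sub>R \<bar>c\<bar>"
  proof (cases "set_integrable lebesgue S f")
    case True
    then have "has_bochner_integral lebesgue (\<lambda>x. indicator S x *\<^sub>R f x) (LINT x:S|lebesgue. f x)"
      by (simp add: set_integrable_def set_lebesgue_integral_def has_bochner_integral_integrable)
    from iffD1[OF iff this]
    have "has_bochner_integral lebesgue (\<lambda>y. indicator S' y *\<^sub>R f (t + c * y)) ((LINT x:S|lebesgue. f x) /\<^sub>R \<bar>c\<bar>)"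
      unfolding ind .
    then show ?thesis unfolding set_lebesgue_integral_def[of lebesgue S']
      by (rule has_bochner_integral_integral_eq)
  next
    case False
    with 1 show ?thesis
      by (simp add: set_lebesgue_integral_def set_integrable_def not_integrable_integral_eq)
  qed
qed

lemma square_integrable_of_L2_space:
  assumes "f \<in> L2_space {a<..<b}" shows "square_integrable a b f"
proof -
  have m: "set_borel_measurable lebesgue {a<..<b} f"
    and i: "set_integrable lebesgue {a<..<b} (\<lambda>x. (f x)\<^sup>2)"
    using assms by (auto simp: L2_space_def)
  have "set_integrable lebesgue {a<..<b} (\<lambda>x. 1 + (f x)\<^sup>2)"
    using set_integrable_continuous_compact[of "{a..b}" "\<lambda>x. 1"] i
    by (intro set_integral_add) (auto simp: set_integrable_Icc_iff_Ioo)
  then have "set_integrable lebesgue {a<..<b} f"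
  proof (rule set_integrable_bound[OF _ m])
    have "norm (f x) \<le> norm (1 + (f x)\<^sup>2)" for x
      using sum_squares_bound[of "\<bar>f x\<bar>" 1] by (simp add: abs_le_iff) (smt (verit) zero_le_power2)
    then show "AE x\<in>{a<..<b} in lebesgue. norm (f x) \<le> norm (1 + (f x)\<^sup>2)" by simp
  qed
  then show ?thesis using i by (simp add: square_integrable_def set_integrable_Icc_iff_Ioo)
qed

lemma square_integrable_linear:
  assumes f: "square_integrable a b f" and g: "square_integrable a b g"
  shows "square_integrable a b (\<lambda>x. r * f x + s * g x)"
  unfolding square_integrable_def
proof
  have fi: "set_integrable lebesgue {a..b} f" "set_integrable lebesgue {a..b} g"
    and f2: "set_integrable lebesgue {a..b} (\<lambda>x. (f x)\<^sup>2)" "set_integrable lebesgue {a..b} (\<lambda>x. (g x)\<^sup>2)"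
    using f g by (auto simp: square_integrable_def)
  show i: "set_integrable lebesgue {a..b} (\<lambda>x. r * f x + s * g x)"
    by (intro set_integral_add set_integrable_mult_right fi)
  show "set_integrable lebesgue {a..b} (\<lambda>x. (r * f x + s * g x)\<^sup>2)"
  proof (rule set_integrable_bound)
    show "set_integrable lebesgue {a..b} (\<lambda>x. 2 * r\<^sup>2 * (f x)\<^sup>2 + 2 * s\<^sup>2 * (g x)\<^sup>2)"
      by (intro set_integral_add set_integrable_mult_right f2)
    have "(\<lambda>x. (indicator {a..b} x *\<^sub>R (r * f x + s * g x))\<^sup>2) \<in> borel_measurable lebesgue"
      using i by (intro borel_measurable_power) (simp add: set_integrable_def)
    moreover have "(\<lambda>x. (indicator {a..b} x *\<^sub>R (r * f x + s * g x))\<^sup>2)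
        = (\<lambda>x. indicator {a..b} x *\<^sub>R (r * f x + s * g x)\<^sup>2)"
      by (auto simp: indicator_def fun_eq_iff)
    ultimately show "set_borel_measurable lebesgue {a..b} (\<lambda>x. (r * f x + s * g x)\<^sup>2)"
      by (simp only: set_borel_measurable_def)
    have "norm ((r * f x + s * g x)\<^sup>2) \<le> norm (2 * r\<^sup>2 * (f x)\<^sup>2 + 2 * s\<^sup>2 * (g x)\<^sup>2)" for x
    proof -
      have "norm ((r * f x + s * g x)\<^sup>2) = (r * f x + s * g x)\<^sup>2" by simp
      also have "\<dots> \<le> 2 * r\<^sup>2 * (f x)\<^sup>2 + 2 * s\<^sup>2 * (g x)\<^sup>2"
        using sum_squares_bound[of "r * f x" "s * g x"] by (simp add: power2_sum power_mult_distrib)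
      also have "\<dots> \<le> norm (2 * r\<^sup>2 * (f x)\<^sup>2 + 2 * s\<^sup>2 * (g x)\<^sup>2)"
        unfolding real_norm_def by (rule abs_ge_self)
      finally show ?thesis .
    qed
    then show "AE x\<in>{a..b} in lebesgue. norm ((r * f x + s * g x)\<^sup>2)
        \<le> norm (2 * r\<^sup>2 * (f x)\<^sup>2 + 2 * s\<^sup>2 * (g x)\<^sup>2)" by simp
  qed
qed

lemma square_integrable_diff:
  "square_integrable a b f \<Longrightarrow> square_integrable a b g \<Longrightarrow> square_integrable a b (\<lambda>x. f x - g x)"
  using square_integrable_linear[of a b f g 1 "-1"] by simp

lemma square_integrable_shift:
  assumes "square_integrable (a + c) (b + c) f" shows "square_integrable a b (\<lambda>x. f (x + c))"
  using assms set_integral_affine(1)[of 1 "{a..b}" c "{a + c..b + c}" f]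
    set_integral_affine(1)[of 1 "{a..b}" c "{a + c..b + c}" "\<lambda>x. (f x)\<^sup>2"]
  by (simp add: square_integrable_def add.commute)

text \<open>Cauchy-Schwarz against the constant function, from the nonnegative integral of
  \<open>(\<bar>f\<bar> - m)\<^sup>2\<close> with the mean \<open>m\<close>.\<close>

lemma integral_abs_le_L2_norm:
  assumes L: "L > 0" and f: "square_integrable 0 L f"
  shows "integral {0..L} (\<lambda>x. \<bar>f x\<bar>) \<le> sqrt L * L2_norm {0<..<L} f"
proof -
  have fa: "(\<lambda>x. \<bar>f x\<bar>) integrable_on {0..L}"
    by (rule square_integrableD(3)[OF f])
  have f2: "(\<lambda>x. (f x)\<^sup>2) integrable_on {0..L}"
    by (rule square_integrableD(4)[OF f])
  let ?I = "integral {0..L} (\<lambda>x. \<bar>f x\<bar>)" and ?J = "integral {0..L} (\<lambda>x. (f x)\<^sup>2)"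
  define m where "m = ?I / L"
  have "((\<lambda>x. (f x)\<^sup>2 - 2 * m * \<bar>f x\<bar> + m\<^sup>2) has_integral (?J - 2 * m * ?I + m\<^sup>2 * L)) {0..L}"
    using has_integral_const_real[of "m\<^sup>2" 0 L] L
    by (intro has_integral_add has_integral_diff has_integral_mult_right integrable_integral fa f2)
      (simp_all add: mult.commute)
  then have "0 \<le> ?J - 2 * m * ?I + m\<^sup>2 * L"
  proof (rule has_integral_nonneg)
    fix x
    have "0 \<le> (\<bar>f x\<bar> - m)\<^sup>2" by simp
    then show "0 \<le> (f x)\<^sup>2 - 2 * m * \<bar>f x\<bar> + m\<^sup>2" by (simp add: power2_diff algebra_simps)
  qed
  then have "?I\<^sup>2 \<le> L * ?J" using L by (simp add: m_def power2_eq_square field_simps)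
  then have "?I \<le> sqrt (L * ?J)" by (rule real_le_rsqrt)
  moreover have "L2_norm {0<..<L} f = sqrt ?J"
    using f unfolding L2_norm_def set_integral_Ioo_eq_Icc
    by (simp add: square_integrable_def set_lebesgue_integral_eq_integral)
  ultimately show ?thesis by (simp add: real_sqrt_mult)
qed

text \<open>Averaging \<open>\<bar>w y\<bar> \<le> \<bar>w z\<bar> + \<integral>\<bar>w'\<bar>\<close> over \<open>z\<close> bounds the supremum by the norms of \<open>w\<close> and \<open>w'\<close>.\<close>

lemma sup_le_L2_norms:
  assumes L: "L > 0" and w: "square_integrable 0 L w" and g: "square_integrable 0 L g"
    and wg: "\<And>p q. 0 \<le> p \<Longrightarrow> p \<le> q \<Longrightarrow> q \<le> L \<Longrightarrow> (g has_integral (w q - w p)) {p..q}"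
    and y: "y \<in> {0..L}"
  shows "L * \<bar>w y\<bar> \<le> sqrt L * L2_norm {0<..<L} w + L * (sqrt L * L2_norm {0<..<L} g)"
proof -
  have ga: "(\<lambda>x. \<bar>g x\<bar>) integrable_on {0..L}" and wa: "(\<lambda>x. \<bar>w x\<bar>) integrable_on {0..L}"
    by (rule square_integrableD(3)[OF g], rule square_integrableD(3)[OF w])
  let ?G = "integral {0..L} (\<lambda>x. \<bar>g x\<bar>)"
  have inc: "\<bar>w q - w p\<bar> \<le> ?G" if "0 \<le> p" "p \<le> q" "q \<le> L" for p q
  proof -
    have gap: "(\<lambda>x. \<bar>g x\<bar>) integrable_on {p..q}"
      by (rule integrable_subinterval_real[OF ga]) (use that in auto)
    have "norm (integral {p..q} g) \<le> integral {p..q} (\<lambda>x. \<bar>g x\<bar>)"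
      by (rule integral_norm_bound_integral[OF _ gap]) (use wg[OF that] in auto)
    also have "\<dots> \<le> ?G" by (rule integral_subset_le[OF _ gap ga]) (use that in auto)
    finally show ?thesis using wg[OF that] by (simp add: integral_unique)
  qed
  have "((\<lambda>z. \<bar>w y\<bar>) has_integral (L * \<bar>w y\<bar>)) {0..L}"
    using has_integral_const_real[of "\<bar>w y\<bar>" 0 L] L by simp
  moreover have "((\<lambda>z. \<bar>w z\<bar> + ?G) has_integral (integral {0..L} (\<lambda>z. \<bar>w z\<bar>) + L * ?G)) {0..L}"
    using has_integral_add[OF integrable_integral[OF wa] has_integral_const_real[of ?G 0 L]] L by simp
  ultimately have "L * \<bar>w y\<bar> \<le> integral {0..L} (\<lambda>z. \<bar>w z\<bar>) + L * ?G"
  proof (rule has_integral_le)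
    fix z assume "z \<in> {0..L}"
    then show "\<bar>w y\<bar> \<le> \<bar>w z\<bar> + ?G"
      using inc[of y z] inc[of z y] y by (cases "y \<le> z") auto
  qed
  also have "\<dots> \<le> sqrt L * L2_norm {0<..<L} w + L * (sqrt L * L2_norm {0<..<L} g)"
    using integral_abs_le_L2_norm[OF L w] integral_abs_le_L2_norm[OF L g] L
    by (intro add_mono mult_left_mono) auto
  finally show ?thesis .
qed

text \<open>The relation extends to the end points because both \<open>u\<close> and the indefinite integral of \<open>g\<close>
  are continuous there.\<close>

lemma increment_on_closed_interval:
  fixes u g :: "real \<Rightarrow> real"
  assumes ab: "a < b" and u: "continuous_on {a..b} u" and g: "g integrable_on {a..b}"
    and inc: "\<And>p q. a < p \<Longrightarrow> p \<le> q \<Longrightarrow> q < b \<Longrightarrow> (g has_integral (u q - u p)) {p..q}"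
    and pq: "a \<le> p" "p \<le> q" "q \<le> b"
  shows "(g has_integral (u q - u p)) {p..q}"
proof -
  define G where "G x = integral {a..x} g" for x
  define m where "m = (a + b) / 2"
  have m: "a < m" "m < b" using ab by (auto simp: m_def)
  have Gc: "continuous_on {a..b} G" unfolding G_def by (rule indefinite_integral_continuous_1[OF g])
  have sub: "g integrable_on {p..q}" if "a \<le> p" "q \<le> b" for p q
    by (rule integrable_subinterval_real[OF g]) (use that in auto)
  have split: "G q - G p = integral {p..q} g" if "a \<le> p" "p \<le> q" "q \<le> b" for p q
    using Henstock_Kurzweil_Integration.integral_combine[of a p q g] sub[of a q] that by (simp add: G_def)
  have "u x - G x = u m - G m" if "x \<in> {a<..<b}" for x
    using inc[of x m, THEN integral_unique] inc[of m x, THEN integral_unique] split[of x m] split[of m x] that m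
    by (cases "x \<le> m") auto
  then have "u x - G x = u m - G m" if "x \<in> {a..b}" for x
    using continuous_constant_on_closure[of "{a<..<b}" "\<lambda>x. u x - G x" "u m - G m" x] that ab
      continuous_on_diff[OF u Gc] by simp
  from this[of p] this[of q] have "u q - u p = integral {p..q} g" using split[of p q] pq by simp
  then show ?thesis using integrable_integral[OF sub[of p q]] pq by simp
qed

lemma AE_imp_negligible:
  assumes "AE x in lebesgue. P x" shows "negligible {x. \<not> P x}"
  using assms by (auto simp: eventually_ae_filter negligible_iff_null_sets[symmetric] intro: negligible_subset)

lemma set_integrable_AE_cong:
  fixes f g :: "real \<Rightarrow> 'a::euclidean_space"
  assumes f: "set_integrable lebesgue {a..b} f"
    and ae: "AE x in lebesgue. x \<in> {a<..<b} \<longrightarrow> f x = g x"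
  shows "set_integrable lebesgue {a..b} g" "integral {a..b} g = integral {a..b} f"
proof -
  let ?N = "{x. \<not> (x \<in> {a<..<b} \<longrightarrow> f x = g x)} \<union> {a, b}"
  have N: "negligible ?N" by (intro negligible_Un AE_imp_negligible ae) simp
  have eq: "g x = f x" if "x \<in> {a..b} - ?N" for x using that by auto
  show "set_integrable lebesgue {a..b} g" by (rule absolutely_integrable_spike[OF f N eq])
  show "integral {a..b} g = integral {a..b} f" by (rule integral_spike[OF N eq, symmetric])
qed

lemma square_integrable_AE_cong:
  assumes "square_integrable a b f" "AE x in lebesgue. x \<in> {a<..<b} \<longrightarrow> f x = g x"
  shows "square_integrable a b g"
proof -
  have "AE x in lebesgue. x \<in> {a<..<b} \<longrightarrow> (f x)\<^sup>2 = (g x)\<^sup>2"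
    using assms(2) by eventually_elim auto
  from set_integrable_AE_cong(1)[OF conjunct2[OF assms(1)[unfolded square_integrable_def]] this]
    set_integrable_AE_cong(1)[OF conjunct1[OF assms(1)[unfolded square_integrable_def]] assms(2)]
  show ?thesis unfolding square_integrable_def by (intro conjI)
qed

text \<open>Two weak derivatives of a continuous function have the same integrals over all compact
  subintervals.\<close>

lemma weak_derivative_unique:
  fixes u f g :: "real \<Rightarrow> real"
  assumes f: "weak_pderiv {a<..<b} 1 u f" and g: "weak_pderiv {a<..<b} 1 u g"
    and u: "continuous_on {a<..<b} u"
  shows "AE x in lebesgue. x \<in> {a<..<b} \<longrightarrow> f x = g x"
proof -
  define p q where "p n = a + inverse (real (Suc n))" and "q n = b - inverse (real (Suc n))" for n
  have pq: "a < p n" "q n < b" for n by (auto simp: p_def q_def)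
  have "AE x in lebesgue. x \<in> {p n..q n} \<longrightarrow> f x - g x = 0" for n
  proof (rule AE_zero_of_integrable_on_interval)
    have "{p n..q n} \<subseteq> {a<..<b}" using pq[of n] by auto
    then show "set_integrable lebesgue {p n..q n} (\<lambda>x. f x - g x)"
      using f g by (intro set_integral_diff) (auto simp: weak_pderiv_def locally_integrable_def)
    fix r s assume rs: "p n \<le> r" "r \<le> s" "s \<le> q n"
    then have "a < r" "s < b" using pq[of n] by auto
    from has_integral_diff[OF weak_derivative_increment[OF f u this(1) rs(2) this(2)]
        weak_derivative_increment[OF g u this(1) rs(2) this(2)]]
    show "((\<lambda>x. f x - g x) has_integral 0) {r..s}" by simp
  qed
  then have "AE x in lebesgue. \<forall>n. x \<in> {p n..q n} \<longrightarrow> f x - g x = 0"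
    by (intro AE_all_countable[THEN iffD2] allI)
  then show ?thesis
  proof (eventually_elim, intro impI)
    fix x assume *: "\<forall>n. x \<in> {p n..q n} \<longrightarrow> f x - g x = 0" and x: "x \<in> {a<..<b}"
    obtain n where "inverse (real (Suc n)) < min (x - a) (b - x)"
      using reals_Archimedean[of "min (x - a) (b - x)"] x by auto
    then have "x \<in> {p n..q n}" by (auto simp: p_def q_def)
    then show "f x = g x" using * by auto
  qed
qed

section \<open>Weak solutions in the moving strip\<close>

text \<open>A weak solution with fixed representatives of its space and time derivatives, so that
  lemmas can refer to them.\<close>

locale strip_wave =
  fixes L v T :: real and \<phi> \<phi>x \<phi>t :: "real \<times> real \<Rightarrow> real" and \<phi>1 :: "real \<Rightarrow> real"
  assumes L: "L > 0" and v: "0 < v" "v < 1" and T: "T > 0"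
    and \<phi>_L2: "C_L2 L v T \<phi>"
    and \<phi>x: "\<And>t. t \<in> {0..T} \<Longrightarrow>
        weak_pderiv (moving_interval L v t) 1 (\<lambda>x. \<phi> (x, t)) (\<lambda>x. \<phi>x (x, t))"
    and \<phi>x_L2: "C_L2 L v T \<phi>x"
    and slice_cont: "\<And>t. t \<in> {0..T} \<Longrightarrow> continuous_on {v * t..L + v * t} (\<lambda>x. \<phi> (x, t))"
    and wave: "\<And>\<psi>. test_function (spacetime L v T) \<psi> \<Longrightarrow>
        (LINT p:spacetime L v T|lebesgue. \<phi> p * (pderiv_dir (0, 1) (pderiv_dir (0, 1) \<psi>) p
                 - pderiv_dir (1, 0) (pderiv_dir (1, 0) \<psi>) p)) = 0"
    and sides: "\<And>t. t \<in> {0<..<T} \<Longrightarrow> \<phi> (v * t, t) = 0 \<and> \<phi> (L + v * t, t) = 0"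
    and \<phi>t: "weak_pderiv (spacetime L v T) (0, 1) \<phi> \<phi>t"
    and \<phi>t_L2: "C_L2 L v T \<phi>t"
    and \<phi>1: "\<phi>1 \<in> L2_space (moving_interval L v 0)"
    and \<phi>t_initial: "AE x in lebesgue. x \<in> moving_interval L v 0 \<longrightarrow> \<phi>t (x, 0) = \<phi>1 x"
begin

lemma slice_square_integrable:
  assumes "C_L2 L v T f" "t \<in> {0..T}"
  shows "square_integrable (v * t) (L + v * t) (\<lambda>x. f (x, t))"
    and "square_integrable 0 L (\<lambda>y. f (y + v * t, t))"
proof -
  show 1: "square_integrable (v * t) (L + v * t) (\<lambda>x. f (x, t))"
    using assms by (auto simp: C_L2_def moving_interval_def intro: square_integrable_of_L2_space)
  show "square_integrable 0 L (\<lambda>y. f (y + v * t, t))"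
    by (rule square_integrable_shift) (use 1 in simp)
qed

lemma slice_increment:
  assumes t: "t \<in> {0..T}" and pq: "v * t \<le> p" "p \<le> q" "q \<le> L + v * t"
  shows "((\<lambda>x. \<phi>x (x, t)) has_integral (\<phi> (q, t) - \<phi> (p, t))) {p..q}"
proof (rule increment_on_closed_interval[OF _ slice_cont[OF t] _ _ pq])
  show "v * t < L + v * t" using L by simp
  show "(\<lambda>x. \<phi>x (x, t)) integrable_on {v * t..L + v * t}"
    by (rule square_integrableD(2)[OF slice_square_integrable(1)[OF \<phi>x_L2 t]])
  fix p q assume "v * t < p" "p \<le> q" "q < L + v * t"
  moreover have "continuous_on {v * t<..<L + v * t} (\<lambda>x. \<phi> (x, t))"
    by (rule continuous_on_subset[OF slice_cont[OF t]]) auto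
  ultimately show "((\<lambda>x. \<phi>x (x, t)) has_integral (\<phi> (q, t) - \<phi> (p, t))) {p..q}"
    using weak_derivative_increment[of "v * t" "L + v * t"] \<phi>x[OF t] by (simp add: moving_interval_def)
qed

lemma shifted_slice_increment:
  assumes t: "t \<in> {0..T}" and pq: "0 \<le> p" "p \<le> q" "q \<le> L"
  shows "((\<lambda>y. \<phi>x (y + v * t, t)) has_integral (\<phi> (q + v * t, t) - \<phi> (p + v * t, t))) {p..q}"
proof -
  have "((\<lambda>x. \<phi>x (x, t)) has_integral (\<phi> (q + v * t, t) - \<phi> (p + v * t, t))) {p + v * t..q + v * t}"
    by (rule slice_increment[OF t]) (use pq in auto)
  from has_integral_affinity'[OF this[folded cbox_interval], of 1 "v * t"] show ?thesis by simp
qed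

text \<open>Continuity in time in \<open>L\<^sup>2\<close> of both \<open>\<phi>\<close> and its space derivative becomes uniform
  convergence of the slices, after translation to the fixed interval.\<close>

lemma shifted_uniform_continuity:
  assumes s: "s \<in> {0..T}" and e: "e > 0"
  obtains d where "d > 0" "\<And>t y. t \<in> {0..T} \<Longrightarrow> \<bar>t - s\<bar> < d \<Longrightarrow> y \<in> {0..L} \<Longrightarrow>
      \<bar>\<phi> (y + v * t, t) - \<phi> (y + v * s, s)\<bar> < e"
proof -
  define N where "N f t = L2_norm {0<..<L} (\<lambda>y. f (y + v * t, t) - f (y + v * s, s))"
    for f :: "real \<times> real \<Rightarrow> real" and t
  have "((\<lambda>t. sqrt L * N \<phi> t + L * (sqrt L * N \<phi>x t)) \<longlongrightarrow> sqrt L * 0 + L * (sqrt L * 0)) (at s within {0..T})"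
    using \<phi>_L2 \<phi>x_L2 s unfolding N_def C_L2_def by (intro tendsto_intros) auto
  then have "((\<lambda>t. sqrt L * N \<phi> t + L * (sqrt L * N \<phi>x t)) \<longlongrightarrow> 0) (at s within {0..T})" by simp
  from order_tendstoD(2)[OF this, of "L * e"]
  obtain d where d: "d > 0" "\<And>t. t \<in> {0..T} \<Longrightarrow> t \<noteq> s \<Longrightarrow> dist t s < d \<Longrightarrow>
      sqrt L * N \<phi> t + L * (sqrt L * N \<phi>x t) < L * e"
    using L e by (auto simp: eventually_at)
  show thesis
  proof (rule that[OF d(1)])
    fix t y assume t: "t \<in> {0..T}" "\<bar>t - s\<bar> < d" and y: "y \<in> {0..L}"
    show "\<bar>\<phi> (y + v * t, t) - \<phi> (y + v * s, s)\<bar> < e"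
    proof (cases "t = s")
      case True
      then show ?thesis using e by simp
    next
      case False
      have "L * \<bar>\<phi> (y + v * t, t) - \<phi> (y + v * s, s)\<bar> \<le> sqrt L * N \<phi> t + L * (sqrt L * N \<phi>x t)"
        unfolding N_def
      proof (rule sup_le_L2_norms[OF L _ _ _ y])
        show "square_integrable 0 L (\<lambda>y. \<phi> (y + v * t, t) - \<phi> (y + v * s, s))"
          "square_integrable 0 L (\<lambda>y. \<phi>x (y + v * t, t) - \<phi>x (y + v * s, s))"
          by (intro square_integrable_diff slice_square_integrable \<phi>_L2 \<phi>x_L2 t s)+
        fix p q assume "0 \<le> p" "p \<le> q" "q \<le> L"
        from has_integral_diff[OF shifted_slice_increment[OF t(1) this] shifted_slice_increment[OF s this]]
        show "((\<lambda>y. \<phi>x (y + v * t, t) - \<phi>x (y + v * s, s)) has_integral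
          (\<phi> (q + v * t, t) - \<phi> (q + v * s, s) - (\<phi> (p + v * t, t) - \<phi> (p + v * s, s)))) {p..q}"
          by (simp add: algebra_simps)
      qed
      also have "\<dots> < L * e" using d(2)[OF t(1) False] t(2) by (simp add: dist_real_def)
      finally show ?thesis using L by simp
    qed
  qed
qed

abbreviation strip :: "(real \<times> real) set" where
  "strip \<equiv> {(x, t). in_strip L v T x t}"

lemma continuous_on_strip: "continuous_on strip \<phi>"
proof -
  have shifted: "continuous_on ({0..L} \<times> {0..T}) (\<lambda>p. \<phi> (fst p + v * snd p, snd p))"
    unfolding continuous_on_iff
  proof (intro ballI allI impI)
    fix p and e :: real assume p: "p \<in> {0..L} \<times> {0..T}" and e: "e > 0"
    obtain y s where ys: "p = (y, s)" "y \<in> {0..L}" "s \<in> {0..T}" using p by auto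
    obtain d where d: "d > 0" "\<And>t y. t \<in> {0..T} \<Longrightarrow> \<bar>t - s\<bar> < d \<Longrightarrow> y \<in> {0..L} \<Longrightarrow>
        \<bar>\<phi> (y + v * t, t) - \<phi> (y + v * s, s)\<bar> < e / 2"
      using shifted_uniform_continuity[OF ys(3), of "e / 2"] e by auto
    have "continuous_on {0..L} (\<lambda>y. \<phi> (y + v * s, s))"
      by (rule continuous_on_compose2[OF slice_cont[OF ys(3)]]) (auto intro!: continuous_intros)
    then obtain r where r: "r > 0"
      "\<And>z. z \<in> {0..L} \<Longrightarrow> \<bar>z - y\<bar> < r \<Longrightarrow> \<bar>\<phi> (z + v * s, s) - \<phi> (y + v * s, s)\<bar> < e / 2"
      using ys(2) e unfolding continuous_on_iff dist_real_def by (metis half_gt_zero)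
    show "\<exists>d>0. \<forall>q\<in>{0..L} \<times> {0..T}. dist q p < d \<longrightarrow>
        dist (\<phi> (fst q + v * snd q, snd q)) (\<phi> (fst p + v * snd p, snd p)) < e"
    proof (intro exI[of _ "min d r"] conjI ballI impI)
      fix q assume q: "q \<in> {0..L} \<times> {0..T}" "dist q p < min d r"
      obtain z t where zt: "q = (z, t)" "z \<in> {0..L}" "t \<in> {0..T}" using q by auto
      have "\<bar>z - y\<bar> < r" "\<bar>t - s\<bar> < d"
        using q(2) dist_fst_le[of q p] dist_snd_le[of q p] by (auto simp: zt ys dist_real_def)
      from d(2)[OF zt(3) this(2) zt(2)] r(2)[OF zt(2) this(1)]
      have "\<bar>\<phi> (z + v * t, t) - \<phi> (y + v * s, s)\<bar> < e" by linarith
      then show "dist (\<phi> (fst q + v * snd q, snd q)) (\<phi> (fst p + v * snd p, snd p)) < e"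
        by (simp add: zt ys dist_real_def)
    qed (use d r in auto)
  qed
  have 1: "continuous_on strip (\<lambda>p. (fst p - v * snd p, snd p))" by (intro continuous_intros)
  have 2: "(\<lambda>p. (fst p - v * snd p, snd p)) ` strip \<subseteq> {0..L} \<times> {0..T}"
    by (auto simp: in_strip_def)
  from continuous_on_compose2[OF shifted 1 2] show ?thesis by simp
qed

lemma continuous_along:
  assumes "continuous_on S f" "continuous_on S g" "\<And>s. s \<in> S \<Longrightarrow> in_strip L v T (f s) (g s)"
  shows "continuous_on S (\<lambda>s. \<phi> (f s, g s))"
  by (rule continuous_on_compose2[OF continuous_on_strip continuous_on_Pair[OF assms(1,2)]])
    (use assms(3) in auto)

text \<open>The boundary condition is given for interior times only; continuity extends it to the
  initial and the final time.\<close>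

lemma sides_closed:
  assumes "0 \<le> t" "t \<le> T" shows "\<phi> (v * t, t) = 0" "\<phi> (L + v * t, t) = 0"
proof -
  have cl: "closure {0<..<T} = {0..T}" using T by simp
  have "continuous_on {0..T} (\<lambda>t. \<phi> (v * t, t))" "continuous_on {0..T} (\<lambda>t. \<phi> (L + v * t, t))"
    by (rule continuous_along; use L in \<open>auto simp: in_strip_def intro!: continuous_intros\<close>)+
  then show "\<phi> (v * t, t) = 0" "\<phi> (L + v * t, t) = 0"
    using continuous_constant_on_closure[of "{0<..<T}" _ 0 t] sides assms unfolding cl by auto
qed

lemma spacetime_subset_strip: "spacetime L v T \<subseteq> strip"
  by (auto simp: spacetime_def moving_interval_def in_strip_def)

lemma char_identity_interior:
  assumes ab: "0 \<le> a" "0 \<le> b" and t: "0 < t - a - b" "t < T"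
    and x: "v * (t - a) < x - a" "x + b < L + v * (t - b)"
  shows "\<phi> (x, t) + \<phi> (x + b - a, t - a - b) = \<phi> (x - a, t - a) + \<phi> (x + b, t - b)"
proof -
  \<comment> \<open>Enlarging the rectangle by \<open>d\<close> in both characteristic variables moves the extreme values of \<open>t\<close> and of
    \<open>x - v t\<close> by \<open>d\<close> each.\<close>
  define d where "d = min (min (t - a - b) (T - t)) (min (x - a - v * (t - a)) (L + v * (t - b) - (x + b))) / 2"
  have d: "0 < d" "d < t - a - b" "d < T - t" "d < x - a - v * (t - a)" "d < L + v * (t - b) - (x + b)"
    using t x by (auto simp: d_def min_def)
  have "char_rect (t + x - 2 * a - d) (t + x + d) (t - x - 2 * b - d) (t - x + d) \<subseteq> spacetime L v T"
  proof safe
    fix y s assume "(y, s) \<in> char_rect (t + x - 2 * a - d) (t + x + d) (t - x - 2 * b - d) (t - x + d)"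
    then have r: "t + x - 2 * a - d \<le> s + y" "s + y \<le> t + x + d" "t - x - 2 * b - d \<le> s - y" "s - y \<le> t - x + d"
      by (auto simp: char_rect_def)
    have "(1 - v) * (t + x - 2 * a - d) \<le> (1 - v) * (s + y)" "(1 + v) * (s - y) \<le> (1 + v) * (t - x + d)"
      "(1 - v) * (s + y) \<le> (1 - v) * (t + x + d)" "(1 + v) * (t - x - 2 * b - d) \<le> (1 + v) * (s - y)"
      using r v by (auto intro!: mult_left_mono)
    then have "v * s < y" "y < L + v * s" using d by (auto simp: algebra_simps)
    then show "(y, s) \<in> spacetime L v T" using r d by (auto simp: spacetime_def moving_interval_def)
  qed
  from wave_equation_char_rect[OF continuous_on_subset[OF continuous_on_strip spacetime_subset_strip] wave _ _ d(1) this]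
  have "\<phi> (char_pt (t + x) (t - x)) + \<phi> (char_pt (t + x - 2 * a) (t - x - 2 * b))
      = \<phi> (char_pt (t + x - 2 * a) (t - x)) + \<phi> (char_pt (t + x) (t - x - 2 * b))"
    using ab by simp
  moreover have "char_pt (t + x) (t - x) = (x, t)" "char_pt (t + x - 2 * a) (t - x) = (x - a, t - a)"
    "char_pt (t + x - 2 * a) (t - x - 2 * b) = (x + b - a, t - a - b)" "char_pt (t + x) (t - x - 2 * b) = (x + b, t - b)"
    by (simp_all add: char_pt_def field_simps)
  ultimately show ?thesis by simp
qed

text \<open>Contracting a rectangle towards the centre of the strip moves it into the interior.\<close>

lemma char_additive_solution: "char_additive L v T \<phi>"
  unfolding char_additive_def
proof (intro allI impI)
  fix x t a b
  assume ab: "0 \<le> a" "0 \<le> b"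
    and Q: "in_strip L v T x t" "in_strip L v T (x - a) (t - a)" "in_strip L v T (x + b) (t - b)"
      "in_strip L v T (x + b - a) (t - a - b)"
  define s0 y0 where "s0 = T / 2" and "y0 = L / 2 + v * (T / 2)"
  define X S where "X y r = y0 + r * (y - y0)" and "S s r = s0 + r * (s - s0)" for y s r :: real
  have X: "X (x + b - a) r = X x r + r * b - r * a" "X (x - a) r = X x r - r * a" "X (x + b) r = X x r + r * b"
    "S (t - a - b) r = S t r - r * a - r * b" "S (t - a) r = S t r - r * a" "S (t - b) r = S t r - r * b" for r
    by (simp_all add: X_def S_def algebra_simps)
  have strict: "0 < S s r \<and> S s r < T \<and> v * S s r < X y r \<and> X y r < L + v * S s r"
    if "in_strip L v T y s" "0 \<le> r" "r < 1" for y s r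
  proof -
    have y: "0 \<le> s" "s \<le> T" "0 \<le> y - v * s" "y - v * s \<le> L" using that(1) by (auto simp: in_strip_def)
    have mid: "0 < z" "z < w" if "2 * z = w - q + 2 * p" "0 \<le> p" "p \<le> q" "q < w" for z w p q :: real
      using that by linarith+
    have m: "0 \<le> r * s" "r * s \<le> r * T" "0 \<le> r * (y - v * s)" "r * (y - v * s) \<le> r * L"
      using y that by (auto intro!: mult_left_mono)
    have m': "r * T < T" "r * L < L" using that T L by auto
    have "2 * S s r = T - r * T + 2 * (r * s)" by (simp add: S_def s0_def field_simps)
    from mid[OF this m(1,2) m'(1)] have "0 < S s r" "S s r < T" .
    moreover have "2 * (X y r - v * S s r) = L - r * L + 2 * (r * (y - v * s))"
      by (simp add: S_def s0_def X_def y0_def field_simps)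
    from mid[OF this m(3,4) m'(2)] have "v * S s r < X y r" "X y r < L + v * S s r" by simp_all
    ultimately show ?thesis by blast
  qed
  define F where "F r = \<phi> (X x r, S t r) + \<phi> (X (x + b - a) r, S (t - a - b) r)
      - \<phi> (X (x - a) r, S (t - a) r) - \<phi> (X (x + b) r, S (t - b) r)" for r
  have cont: "continuous_on {0..1} (\<lambda>r. \<phi> (X y r, S s r))" if "in_strip L v T y s" for y s
  proof (rule continuous_along)
    show "continuous_on {0..1} (X y)" "continuous_on {0..1} (S s)"
      unfolding X_def[abs_def] S_def[abs_def] by (intro continuous_intros)+
    fix r :: real assume r: "r \<in> {0..1}"
    show "in_strip L v T (X y r) (S s r)"
    proof (cases "r = 1")
      case True
      then show ?thesis using that by (simp add: X_def S_def)
    next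
      case False
      then show ?thesis using strict[OF that, of r] r by (auto simp: in_strip_def)
    qed
  qed
  have "continuous_on {0..1} F" unfolding F_def using Q by (intro continuous_intros cont)
  moreover have "F r = 0" if "r \<in> {0<..<1}" for r
  proof -
    have r: "0 \<le> r" "r < 1" using that by auto
    note st = strict[OF Q(1) r] strict[OF Q(2) r] strict[OF Q(3) r] strict[OF Q(4) r]
    have "\<phi> (X x r, S t r) + \<phi> (X x r + r * b - r * a, S t r - r * a - r * b)
      = \<phi> (X x r - r * a, S t r - r * a) + \<phi> (X x r + r * b, S t r - r * b)"
      by (rule char_identity_interior) (use st ab r in \<open>auto simp: X\<close>)
    then show ?thesis unfolding F_def X by simp
  qed
  ultimately have "F 1 = 0"
    using continuous_constant_on_closure[of "{0<..<1::real}" F 0 1] by simp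
  moreover have "X y 1 = y" "S s 1 = s" for y s by (simp_all add: X_def S_def)
  ultimately show "\<phi> (x, t) + \<phi> (x + b - a, t - a - b) = \<phi> (x - a, t - a) + \<phi> (x + b, t - b)"
    unfolding F_def by simp
qed

lemma \<phi>1_square_integrable: "square_integrable 0 L \<phi>1"
  using \<phi>1 by (auto simp: moving_interval_def intro: square_integrable_of_L2_space)

text \<open>The slices of \<open>\<phi>t\<close> converge only after translation to the fixed interval, so the interval
  of integration moves as well; its effect is controlled by the continuous indefinite integral
  \<open>G\<close> of the initial slice.\<close>

lemma time_derivative_tendsto:
  assumes ab: "0 < \<alpha>" "\<alpha> \<le> \<beta>" "\<beta> < L"
  shows "((\<lambda>t. LINT x:{\<alpha>..\<beta>}|lebesgue. \<phi>t (x, t)) \<longlongrightarrow> integral {\<alpha>..\<beta>} \<phi>1) (at_right 0)"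
proof -
  define N where "N t = L2_norm {0<..<L} (\<lambda>y. \<phi>t (y + v * t, t) - \<phi>t (y + v * 0, 0))" for t
  define g where "g y = \<phi>t (y, 0)" for y
  have F: "at 0 within {0..T} = at_right 0" using T by (rule at_within_Icc_at_right)
  have N: "(N \<longlongrightarrow> 0) (at_right 0)"
  proof -
    have "0 \<in> {0..T}" using T by simp
    from conjunct2[OF \<phi>t_L2[unfolded C_L2_def], rule_format, OF this]
    show ?thesis unfolding N_def[abs_def] F .
  qed
  have gs: "square_integrable 0 L g"
    using slice_square_integrable(2)[OF \<phi>t_L2, of 0] T by (simp add: g_def[abs_def])
  then have gi: "g integrable_on {0..L}"
    by (rule square_integrableD(2))
  define G where "G y = integral {0..y} g" for y
  have Gc: "continuous_on {0..L} G" unfolding G_def by (rule indefinite_integral_continuous_1[OF gi])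
  have Gi: "isCont G y" if "0 < y" "y < L" for y
    using Gc that by (intro continuous_on_interior[OF Gc]) simp
  have split: "G q - G p = integral {p..q} g" if "0 \<le> p" "p \<le> q" "q \<le> L" for p q
    using Henstock_Kurzweil_Integration.integral_combine[of 0 p q g]
      integrable_subinterval_real[OF gi, of 0 q] that by (simp add: G_def)
  have small: "\<forall>\<^sub>F t in at_right 0. t < T \<and> v * t < \<alpha>"
  proof -
    have "0 < min T (\<alpha> / v)" using T ab v by simp
    then show ?thesis unfolding eventually_at_right_field
      by (intro exI[of _ "min T (\<alpha> / v)"]) (use v in \<open>auto simp: field_simps\<close>)
  qed
  have "((\<lambda>t. (LINT x:{\<alpha>..\<beta>}|lebesgue. \<phi>t (x, t)) - (G (\<beta> - v * t) - G (\<alpha> - v * t))) \<longlongrightarrow> 0) (at_right 0)"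
  proof (rule Lim_null_comparison)
    have "((\<lambda>t. sqrt L * N t) \<longlongrightarrow> sqrt L * 0) (at_right 0)" by (intro tendsto_intros N)
    then show "((\<lambda>t. sqrt L * N t) \<longlongrightarrow> 0) (at_right 0)" by simp
    have "\<forall>\<^sub>F t in at_right (0::real). 0 < t" by (rule eventually_at_right_less)
    with small show "\<forall>\<^sub>F t in at_right 0. norm ((LINT x:{\<alpha>..\<beta>}|lebesgue. \<phi>t (x, t))
        - (G (\<beta> - v * t) - G (\<alpha> - v * t))) \<le> sqrt L * N t"
    proof eventually_elim
      case (elim t)
      then have t: "t \<in> {0..T}" and vt: "0 < v * t" using v by auto
      let ?f = "\<lambda>y. \<phi>t (y + v * t, t)" and ?I = "{\<alpha> - v * t..\<beta> - v * t}"
      have sub: "?I \<subseteq> {0..L}" using ab elim vt by auto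
      have fs: "square_integrable 0 L ?f" by (rule slice_square_integrable(2)[OF \<phi>t_L2 t])
      have fi: "set_integrable lebesgue ?I ?f"
        by (rule square_integrableD(5)[OF fs sub])
      have d: "square_integrable 0 L (\<lambda>y. ?f y - g y)" by (rule square_integrable_diff[OF fs gs])
      have gI: "g integrable_on ?I" by (rule integrable_subinterval_real[OF gi sub])
      have da: "(\<lambda>y. \<bar>?f y - g y\<bar>) integrable_on {0..L}"
        by (rule square_integrableD(3)[OF d])
      have "(LINT x:{\<alpha>..\<beta>}|lebesgue. \<phi>t (x, t)) = (LINT y:?I|lebesgue. \<phi>t (v * t + 1 * y, t))"
        by (subst set_integral_affine(2)[where f = "\<lambda>x. \<phi>t (x, t)" and S = "{\<alpha>..\<beta>}"]) auto
      also have "\<dots> = integral ?I ?f"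
        using fi by (simp add: add.commute set_lebesgue_integral_eq_integral)
      finally have "(LINT x:{\<alpha>..\<beta>}|lebesgue. \<phi>t (x, t)) - (G (\<beta> - v * t) - G (\<alpha> - v * t))
        = integral ?I ?f - integral ?I g"
        using split[of "\<alpha> - v * t" "\<beta> - v * t"] ab elim vt by simp
      also have "\<dots> = integral ?I (\<lambda>y. ?f y - g y)"
        using fi gI by (simp add: Henstock_Kurzweil_Integration.integral_diff set_lebesgue_integral_eq_integral)
      also have "norm \<dots> \<le> integral ?I (\<lambda>y. \<bar>?f y - g y\<bar>)"
        using fi gI integrable_subinterval_real[OF da sub]
        by (intro integral_norm_bound_integral integrable_diff) (auto intro: set_lebesgue_integral_eq_integral(1))
      also have "\<dots> \<le> integral {0..L} (\<lambda>y. \<bar>?f y - g y\<bar>)"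
        by (intro integral_subset_le sub da integrable_subinterval_real[OF da sub]) auto
      also have "\<dots> \<le> sqrt L * N t"
        using integral_abs_le_L2_norm[OF L d] by (simp add: N_def g_def)
      finally show ?case .
    qed
  qed
  moreover have "((\<lambda>t. G (\<beta> - v * t) - G (\<alpha> - v * t)) \<longlongrightarrow> G (\<beta> - v * 0) - G (\<alpha> - v * 0)) (at_right 0)"
    by (intro tendsto_diff isCont_tendsto_compose[OF Gi] tendsto_intros) (use ab in auto)
  ultimately have "((\<lambda>t. LINT x:{\<alpha>..\<beta>}|lebesgue. \<phi>t (x, t)) \<longlongrightarrow> 0 + (G (\<beta> - v * 0) - G (\<alpha> - v * 0))) (at_right 0)"
    using tendsto_add by fastforce
  moreover have "G \<beta> - G \<alpha> = integral {\<alpha>..\<beta>} \<phi>1"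
  proof -
    have "AE x in lebesgue. x \<in> {\<alpha><..<\<beta>} \<longrightarrow> \<phi>1 x = g x"
      using \<phi>t_initial by eventually_elim (use ab in \<open>auto simp: moving_interval_def g_def\<close>)
    moreover have "set_integrable lebesgue {\<alpha>..\<beta>} \<phi>1"
      by (rule square_integrableD(5)[OF \<phi>1_square_integrable]) (use ab in auto)
    ultimately have "integral {\<alpha>..\<beta>} g = integral {\<alpha>..\<beta>} \<phi>1" by (rule set_integrable_AE_cong(2)[rotated])
    then show ?thesis using split[of \<alpha> \<beta>] ab by simp
  qed
  ultimately show ?thesis by simp
qed

text \<open>This is how the initial velocity, an almost-everywhere statement about one slice of \<open>\<phi>t\<close>,
  becomes accessible: means of \<open>\<phi>\<close> over intervals are differentiable at time 0.\<close>

lemma mean_time_derivative_initial: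
  assumes ab: "0 < \<alpha>" "\<alpha> \<le> \<beta>" "\<beta> < L"
  defines "m \<equiv> \<lambda>t. integral {\<alpha>..\<beta>} (\<lambda>x. \<phi> (x, t))"
  shows "((\<lambda>t. (m t - m 0) / t) \<longlongrightarrow> integral {\<alpha>..\<beta>} \<phi>1) (at_right 0)"
proof (rule tendstoI)
  fix e :: real assume e: "e > 0"
  let ?n = "integral {\<alpha>..\<beta>} \<phi>1"
  have "\<forall>\<^sub>F t in at_right 0. dist (LINT x:{\<alpha>..\<beta>}|lebesgue. \<phi>t (x, t)) ?n < e / 2"
    by (rule tendstoD[OF time_derivative_tendsto[OF ab]]) (use e in simp)
  then obtain d1 where d1: "d1 > 0"
    "\<And>t. 0 < t \<Longrightarrow> t < d1 \<Longrightarrow> \<bar>(LINT x:{\<alpha>..\<beta>}|lebesgue. \<phi>t (x, t)) - ?n\<bar> \<le> e / 2"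
    unfolding eventually_at_right_field dist_real_def by (metis less_imp_le)
  define d where "d = min d1 (min T (\<alpha> / v))"
  have d: "d > 0" "d \<le> d1" "d \<le> T" using d1 T ab v by (auto simp: d_def)
  have vd: "v * t < \<alpha>" if "t < d" for t using that v by (auto simp: d_def field_simps)
  have step: "\<bar>m t2 - m t1 - ?n * (t2 - t1)\<bar> \<le> e / 2 * (t2 - t1)" if t: "0 < t1" "t1 \<le> t2" "t2 < d" for t1 t2
  proof -
    \<comment> \<open>Room for the cutoffs: the enlarged box must stay away from time 0 and from both sides.\<close>
    define r where "r = min (min t1 (T - t2)) (min (\<alpha> - v * t2) (L - \<beta>)) / 3"
    have r: "r > 0" "3 * r \<le> t1" "3 * r \<le> T - t2" "3 * r \<le> \<alpha> - v * t2" "3 * r \<le> L - \<beta>"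
      using t d vd[of t2] ab by (auto simp: r_def)
    have box: "{\<alpha> - r..\<beta> + r} \<times> {t1 - r..t2 + r} \<subseteq> spacetime L v T"
    proof safe
      fix x t assume xt: "x \<in> {\<alpha> - r..\<beta> + r}" "t \<in> {t1 - r..t2 + r}"
      then have xt: "\<alpha> - r \<le> x" "x \<le> \<beta> + r" "t1 - r \<le> t" "t \<le> t2 + r" by auto
      have "v * t \<le> v * (t2 + r)" using xt v by (intro mult_left_mono) auto
      moreover have "v * (t2 + r) = v * t2 + v * r" by (rule distrib_left)
      moreover have "v * r \<le> 1 * r" using v r by (intro mult_right_mono) auto
      moreover have "0 \<le> v * t" using xt r v t by (intro mult_nonneg_nonneg) auto
      ultimately have "v * t < x" "x < L + v * t" "0 < t" "t < T" using xt r t by linarith+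
      then show "(x, t) \<in> spacetime L v T" by (simp add: spacetime_def moving_interval_def)
    qed
    have inc: "m t2 - m t1 = (LINT p:{\<alpha>..\<beta>} \<times> {t1..t2}|lebesgue. \<phi>t p)"
      unfolding m_def
      by (rule weak_time_derivative_increment[OF \<phi>t continuous_on_subset[OF continuous_on_strip spacetime_subset_strip]
            ab(2) t(2) r(1) box])
    have "\<bar>(LINT p:{\<alpha>..\<beta>} \<times> {t1..t2}|lebesgue. \<phi>t p) - ?n * (t2 - t1)\<bar> \<le> e / 2 * (t2 - t1)"
    proof (rule box_integral_slice_bound[OF t(2)])
      have "{\<alpha>..\<beta>} \<times> {t1..t2} \<subseteq> {\<alpha> - r..\<beta> + r} \<times> {t1 - r..t2 + r}" using r by auto
      with box have "{\<alpha>..\<beta>} \<times> {t1..t2} \<subseteq> spacetime L v T" by blast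
      then show "set_integrable lebesgue ({\<alpha>..\<beta>} \<times> {t1..t2}) \<phi>t"
        using \<phi>t by (auto simp: weak_pderiv_def locally_integrable_def compact_Times)
      fix s assume s: "s \<in> {t1..t2}"
      then have sT: "s \<in> {0..T}" and vs: "v * s < \<alpha>" "0 \<le> v * s" using t d vd v by auto
      show "set_integrable lebesgue {\<alpha>..\<beta>} (\<lambda>x. \<phi>t (x, s))"
        by (rule square_integrableD(5)[OF slice_square_integrable(1)[OF \<phi>t_L2 sT]]) (use vs ab in auto)
      show "\<bar>(LINT x:{\<alpha>..\<beta>}|lebesgue. \<phi>t (x, s)) - ?n\<bar> \<le> e / 2"
        using d1(2)[of s] s t d by auto
    qed
    then show ?thesis unfolding inc .
  qed
  have m0: "(m \<longlongrightarrow> m 0) (at_right 0)"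
  proof -
    define c where "c = d / 2"
    have c: "0 < c" "c < d" using d by (auto simp: c_def)
    have "continuous_on ({0..c} \<times> cbox \<alpha> \<beta>) (\<lambda>(t, x). \<phi> (x, t))"
      unfolding case_prod_unfold
    proof (rule continuous_along)
      fix p assume "p \<in> {0..c} \<times> cbox \<alpha> \<beta>"
      then have p: "0 \<le> fst p" "fst p \<le> c" "\<alpha> \<le> snd p" "snd p \<le> \<beta>" by auto
      moreover have "v * fst p < \<alpha>" "0 \<le> v * fst p" using vd[of "fst p"] p c v by auto
      ultimately show "in_strip L v T (snd p) (fst p)" using c d ab by (auto simp: in_strip_def)
    qed (intro continuous_intros)+
    from integral_continuous_on_param[OF this] have "continuous_on {0..c} m" by (simp add: m_def)
    then have "(m \<longlongrightarrow> m 0) (at 0 within {0..c})" using c by (auto simp: continuous_on_def)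
    then show ?thesis using c at_within_Icc_at_right[of 0 c] by simp
  qed
  have "\<forall>\<^sub>F t in at_right 0. 0 < t \<and> t < d"
    using d unfolding eventually_at_right_field by auto
  then show "\<forall>\<^sub>F t in at_right 0. dist ((m t - m 0) / t) ?n < e"
  proof eventually_elim
    case (elim t)
    have "\<bar>m t - m 0 - ?n * (t - 0)\<bar> \<le> e / 2 * (t - 0)"
    proof (rule tendsto_le[OF trivial_limit_at_right_real])
      show "((\<lambda>s. \<bar>m t - m s - ?n * (t - s)\<bar>) \<longlongrightarrow> \<bar>m t - m 0 - ?n * (t - 0)\<bar>) (at_right 0)"
        "((\<lambda>s. e / 2 * (t - s)) \<longlongrightarrow> e / 2 * (t - 0)) (at_right 0)"
        by (intro tendsto_intros m0)+
      have "\<forall>\<^sub>F s in at_right 0. 0 < s \<and> s < t" using elim unfolding eventually_at_right_field by auto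
      then show "\<forall>\<^sub>F s in at_right 0. \<bar>m t - m s - ?n * (t - s)\<bar> \<le> e / 2 * (t - s)"
        by eventually_elim (use step elim in auto)
    qed
    then have "\<bar>m t - m 0 - ?n * t\<bar> / t \<le> e / 2" using elim by (simp add: field_simps)
    moreover have "(m t - m 0) / t - ?n = (m t - m 0 - ?n * t) / t"
      using elim by (simp add: field_simps)
    then have "\<bar>(m t - m 0) / t - ?n\<bar> = \<bar>m t - m 0 - ?n * t\<bar> / t"
      using elim by (simp only: abs_divide) simp
    ultimately have "\<bar>(m t - m 0) / t - ?n\<bar> < e" using e by linarith
    then show ?case by (simp only: dist_real_def)
  qed
qed

text \<open>With \<open>r = x - t\<close>, the parallelogram identity writes \<open>\<phi>\<close> in the triangle over
  \<open>[x - t, x + t]\<close> as \<open>A (y + \<tau>) - A (y - \<tau>) + u (y - \<tau>)\<close>, where \<open>A\<close> holds the values on the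
  characteristic through \<open>r\<close> and \<open>u\<close> the initial values.  The mean over \<open>[\<alpha>, \<beta>]\<close> then has an
  explicit time derivative at 0, and comparing it with the mean of \<open>\<phi>1\<close> determines the
  increments of \<open>2 A - u\<close>.\<close>

lemma dalembert:
  assumes t: "0 \<le> t" "t \<le> T" and x: "0 \<le> x - t" "x + t \<le> L"
  shows "\<phi> (x, t) = (\<phi> (x + t, 0) + \<phi> (x - t, 0) + integral {x - t..x + t} \<phi>1) / 2"
proof (cases "t = 0")
  case True
  then show ?thesis by simp
next
  case False
  with t have t0: "0 < t" by simp
  define r R where "r = x - t" and "R = x + t"
  have rR: "0 \<le> r" "r < R" "R \<le> L" "R - r = 2 * t" using x t0 by (auto simp: r_def R_def)
  define A where "A s = \<phi> ((s + r) / 2, (s - r) / 2)" for s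
  define u where "u s = \<phi> (s, 0)" for s
  have edge: "in_strip L v T ((s + r) / 2) ((s - r) / 2)" if s: "r \<le> s" "s \<le> R" for s
  proof -
    define \<sigma> where "\<sigma> = (s - r) / 2"
    have "s = r + 2 * \<sigma>" by (simp add: \<sigma>_def field_simps)
    then have \<sigma>: "0 \<le> \<sigma>" "r + 2 * \<sigma> \<le> R" "\<sigma> \<le> t" using s rR by linarith+
    have "0 \<le> v * \<sigma>" "v * \<sigma> \<le> \<sigma>" using v \<sigma> by (auto simp: mult_left_le_one_le)
    then have "in_strip L v T (r + \<sigma>) \<sigma>" using \<sigma> rR t by (simp add: in_strip_def)
    moreover have "r + \<sigma> = (s + r) / 2" by (simp add: \<sigma>_def field_simps)
    ultimately show ?thesis by (simp only: \<sigma>_def)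
  qed
  have Ac: "continuous_on {r..R} A"
    unfolding A_def by (intro continuous_along continuous_intros) (use edge in auto)
  have uc: "continuous_on {r..R} u"
    unfolding u_def by (intro continuous_along continuous_intros) (use rR T in \<open>auto simp: in_strip_def\<close>)
  \<comment> \<open>Apply the identity to the rectangle with one side on the characteristic through the foot \<open>r\<close>, which
    carries the values \<open>A\<close>, and with its earliest corner at time 0.\<close>
  have rep: "\<phi> (y, \<tau>) = A (y + \<tau>) - A (y - \<tau>) + u (y - \<tau>)"
    if y: "0 \<le> \<tau>" "r \<le> y - \<tau>" "y + \<tau> \<le> R" for y \<tau>
  proof -
    let ?X = "(y + \<tau> + r) / 2" and ?T = "(y + \<tau> - r) / 2" and ?b = "(y - \<tau> - r) / 2"
    have pts: "?X - \<tau> = (y - \<tau> + r) / 2" "?T - \<tau> = (y - \<tau> - r) / 2" "?X + ?b = y" "?T - ?b = \<tau>"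
      "?X + ?b - \<tau> = y - \<tau>" "?T - \<tau> - ?b = 0" by (auto simp: field_simps)
    have strips: "in_strip L v T ?X ?T" "in_strip L v T (?X - \<tau>) (?T - \<tau>)"
      unfolding pts using edge[of "y + \<tau>"] edge[of "y - \<tau>"] y by auto
    have "v * \<tau> \<le> \<tau>" "0 \<le> v * \<tau>" using v y by (auto simp: mult_left_le_one_le)
    then have strips': "in_strip L v T (?X + ?b) (?T - ?b)" "in_strip L v T (?X + ?b - \<tau>) (?T - \<tau> - ?b)"
      unfolding pts using y rR t T by (auto simp: in_strip_def)
    have "\<phi> (?X, ?T) + \<phi> (?X + ?b - \<tau>, ?T - \<tau> - ?b) = \<phi> (?X - \<tau>, ?T - \<tau>) + \<phi> (?X + ?b, ?T - ?b)"
      using char_additive_solution[unfolded char_additive_def, rule_format, OF y(1) _ strips strips'] y by simp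
    then show ?thesis unfolding pts by (simp add: A_def u_def)
  qed
  define IA where "IA s = integral {r..s} A" for s
  define IU where "IU s = integral {r..s} u" for s
  have IA: "(IA has_real_derivative A s) (at s)" "(IU has_real_derivative u s) (at s)" if "r < s" "s < R" for s
  proof -
    have "s \<in> {r..R}" "s \<in> interior {r..R}" using that by auto
    with integral_has_vector_derivative[OF Ac this(1)] integral_has_vector_derivative[OF uc this(1)]
    show "(IA has_real_derivative A s) (at s)" "(IU has_real_derivative u s) (at s)"
      unfolding IA_def[abs_def] IU_def[abs_def] has_real_derivative_iff_has_vector_derivative
      by (simp_all only: at_within_interior)
  qed
  have int_diff: "integral {p..q} A = IA q - IA p" "integral {p..q} u = IU q - IU p"
    if "r \<le> p" "p \<le> q" "q \<le> R" for p q
  proof -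
    have "A integrable_on {r..q}" "u integrable_on {r..q}"
      using that by (auto intro!: integrable_continuous_real intro: continuous_on_subset[OF Ac] continuous_on_subset[OF uc])
    then show "integral {p..q} A = IA q - IA p" "integral {p..q} u = IU q - IU p"
      using Henstock_Kurzweil_Integration.integral_combine[of r p q A]
        Henstock_Kurzweil_Integration.integral_combine[of r p q u] that by (auto simp: IA_def IU_def)
  qed
  have inner: "integral {\<alpha>..\<beta>} \<phi>1 = (2 * A \<beta> - u \<beta>) - (2 * A \<alpha> - u \<alpha>)"
    if ab: "r < \<alpha>" "\<alpha> \<le> \<beta>" "\<beta> < R" for \<alpha> \<beta>
  proof -
    define m where "m \<tau> = integral {\<alpha>..\<beta>} (\<lambda>y. \<phi> (y, \<tau>))" for \<tau>
    define M where "M \<tau> = (IA (\<beta> + \<tau>) - IA (\<alpha> + \<tau>)) - (IA (\<beta> - \<tau>) - IA (\<alpha> - \<tau>)) + (IU (\<beta> - \<tau>) - IU (\<alpha> - \<tau>))" for \<tau>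
    define d where "d = min (\<alpha> - r) (R - \<beta>)"
    have d: "0 < d" "d \<le> \<alpha> - r" "d \<le> R - \<beta>" using ab by (auto simp: d_def)
    have mM: "m \<tau> = M \<tau>" if \<tau>: "0 \<le> \<tau>" "\<tau> < d" for \<tau>
    proof -
      have shift: "((\<lambda>y. f (y + c)) has_integral integral {\<alpha> + c..\<beta> + c} f) {\<alpha>..\<beta>}"
        if "continuous_on {r..R} f" "\<bar>c\<bar> \<le> \<tau>" for f :: "real \<Rightarrow> real" and c
      proof -
        have "continuous_on {\<alpha> + c..\<beta> + c} f"
          by (rule continuous_on_subset[OF that(1)]) (use that(2) \<tau> d in auto)
        then have "(f has_integral integral {\<alpha> + c..\<beta> + c} f) {\<alpha> + c..\<beta> + c}"
          by (intro integrable_integral integrable_continuous_real)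
        from has_integral_affinity'[OF this[folded cbox_interval], of 1 c] show ?thesis by simp
      qed
      have "((\<lambda>y. A (y + \<tau>) - A (y + - \<tau>) + u (y + - \<tau>)) has_integral
          (integral {\<alpha> + \<tau>..\<beta> + \<tau>} A - integral {\<alpha> + - \<tau>..\<beta> + - \<tau>} A + integral {\<alpha> + - \<tau>..\<beta> + - \<tau>} u)) {\<alpha>..\<beta>}"
        by (intro has_integral_add has_integral_diff shift Ac uc) (use \<tau> in auto)
      moreover have "A (y + \<tau>) - A (y + - \<tau>) + u (y + - \<tau>) = \<phi> (y, \<tau>)" if "y \<in> {\<alpha>..\<beta>}" for y
        using rep[of \<tau> y] that \<tau> d by simp
      ultimately have "((\<lambda>y. \<phi> (y, \<tau>)) has_integral
          (integral {\<alpha> + \<tau>..\<beta> + \<tau>} A - integral {\<alpha> + - \<tau>..\<beta> + - \<tau>} A + integral {\<alpha> + - \<tau>..\<beta> + - \<tau>} u)) {\<alpha>..\<beta>}"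
        by (rule has_integral_eq[rotated])
      then show ?thesis using int_diff \<tau> d ab by (simp add: m_def M_def integral_unique)
    qed
    have plus: "((\<lambda>z. J (s + z)) has_real_derivative j) (at 0)"
      and minus: "((\<lambda>z. J (s - z)) has_real_derivative - j) (at 0)"
      if "(J has_real_derivative j) (at s)" for J j and s :: real
    proof -
      have "((+) s has_real_derivative 1) (at 0)" "((-) s has_real_derivative - 1) (at 0)"
        by (auto intro!: derivative_eq_intros)
      then show "((\<lambda>z. J (s + z)) has_real_derivative j) (at 0)"
        "((\<lambda>z. J (s - z)) has_real_derivative - j) (at 0)"
        using DERIV_chain2[of J j "(+) s" 0 1 UNIV] DERIV_chain2[of J j "(-) s" 0 "-1" UNIV] that by simp_all
    qed
    have "(M has_real_derivative (A \<beta> - A \<alpha>) - (- A \<beta> - - A \<alpha>) + (- u \<beta> - - u \<alpha>)) (at 0)"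
      unfolding M_def[abs_def]
      by (intro DERIV_add DERIV_diff plus minus IA) (use ab in auto)
    then have "(M has_real_derivative 2 * (A \<beta> - A \<alpha>) - (u \<beta> - u \<alpha>)) (at 0)"
      by (simp add: algebra_simps)
    then have "((\<lambda>\<tau>. (M \<tau> - M 0) / \<tau>) \<longlongrightarrow> 2 * (A \<beta> - A \<alpha>) - (u \<beta> - u \<alpha>)) (at_right 0)"
      using filterlim_mono[OF _ order_refl at_le[of "{0<..}" UNIV 0]] by (auto simp: DERIV_def)
    moreover have "\<forall>\<^sub>F \<tau> in at_right 0. (M \<tau> - M 0) / \<tau> = (m \<tau> - m 0) / \<tau>"
      unfolding eventually_at_right_field by (intro exI[of _ d]) (use mM d in auto)
    ultimately have "((\<lambda>\<tau>. (m \<tau> - m 0) / \<tau>) \<longlongrightarrow> 2 * (A \<beta> - A \<alpha>) - (u \<beta> - u \<alpha>)) (at_right 0)"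
      by (rule Lim_transform_eventually)
    moreover have "((\<lambda>\<tau>. (m \<tau> - m 0) / \<tau>) \<longlongrightarrow> integral {\<alpha>..\<beta>} \<phi>1) (at_right 0)"
      unfolding m_def by (rule mean_time_derivative_initial) (use ab rR in auto)
    ultimately have "integral {\<alpha>..\<beta>} \<phi>1 = 2 * (A \<beta> - A \<alpha>) - (u \<beta> - u \<alpha>)"
      using tendsto_unique[OF trivial_limit_at_right_real] by blast
    then show ?thesis by simp
  qed
  have \<phi>1i: "\<phi>1 integrable_on {p..q}" if "r \<le> p" "q \<le> R" for p q
    by (rule integrable_subinterval_real[OF square_integrableD(2)[OF \<phi>1_square_integrable]]) (use that rR in auto)
  have "(\<phi>1 has_integral ((\<lambda>s. 2 * A s - u s) R - (\<lambda>s. 2 * A s - u s) r)) {r..R}"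
  proof (rule increment_on_closed_interval[OF rR(2) _ \<phi>1i])
    show "continuous_on {r..R} (\<lambda>s. 2 * A s - u s)" by (intro continuous_intros Ac uc)
    fix p q assume "r < p" "p \<le> q" "q < R"
    then show "(\<phi>1 has_integral ((2 * A q - u q) - (2 * A p - u p))) {p..q}"
      using integrable_integral[OF \<phi>1i[of p q]] inner[of p q] by simp
  qed (use rR in auto)
  then have "integral {r..R} \<phi>1 = (2 * A R - u R) - (2 * A r - u r)" by (simp add: integral_unique)
  moreover have "A r = u r" by (simp add: A_def u_def)
  moreover have "A R = \<phi> (x, t)" by (simp add: A_def r_def R_def)
  ultimately show ?thesis by (simp add: r_def[symmetric] R_def[symmetric] u_def)
qed

end

section \<open>The reflected data\<close>

lemma set_integral_cong_Ioo:
  fixes f g :: "real \<Rightarrow> 'a::euclidean_space"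
  assumes "\<And>x. a < x \<Longrightarrow> x < b \<Longrightarrow> f x = g x"
  shows "set_integrable lebesgue {a..b} f \<longleftrightarrow> set_integrable lebesgue {a..b} g"
    and "(LINT x:{a..b}|lebesgue. f x) = (LINT x:{a..b}|lebesgue. g x)"
proof -
  have "(\<lambda>x. indicator {a<..<b} x *\<^sub>R f x) = (\<lambda>x. indicator {a<..<b} x *\<^sub>R g x)"
    using assms by (auto simp: indicator_def fun_eq_iff)
  then show "set_integrable lebesgue {a..b} f \<longleftrightarrow> set_integrable lebesgue {a..b} g"
    and "(LINT x:{a..b}|lebesgue. f x) = (LINT x:{a..b}|lebesgue. g x)"
    unfolding set_integrable_Icc_iff_Ioo set_integral_Ioo_eq_Icc[symmetric]
    by (simp_all only: set_integrable_def set_lebesgue_integral_def)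
qed

lemma set_integral_split_Icc:
  fixes f :: "real \<Rightarrow> 'a::euclidean_space"
  assumes "a \<le> b" "b \<le> c" "set_integrable lebesgue {a..b} f" "set_integrable lebesgue {b..c} f"
  shows "set_integrable lebesgue {a..c} f"
    and "(LINT x:{a..c}|lebesgue. f x) = (LINT x:{a..b}|lebesgue. f x) + (LINT x:{b..c}|lebesgue. f x)"
proof -
  have "{a..c} = {a..b} \<union> {b..c}" using assms by auto
  then show 1: "set_integrable lebesgue {a..c} f"
    using set_integrable_Un[OF assms(3,4)] by simp
  have "integral {a..c} f = integral {a..b} f + integral {b..c} f"
    using Henstock_Kurzweil_Integration.integral_combine[OF assms(1,2)]
      set_lebesgue_integral_eq_integral(1)[OF 1] by metis
  then show "(LINT x:{a..c}|lebesgue. f x) = (LINT x:{a..b}|lebesgue. f x) + (LINT x:{b..c}|lebesgue. f x)"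
    using 1 assms by (simp add: set_lebesgue_integral_eq_integral)
qed

text \<open>Here \<open>d\<close> is the derivative of the initial position and \<open>f\<close> the initial velocity.\<close>

locale reflected_data =
  fixes L v :: real and d f :: "real \<Rightarrow> real"
  assumes L: "L > 0" and v: "0 < v" "v < 1"
    and d: "square_integrable 0 L d" and f: "square_integrable 0 L f"
begin

abbreviation P where "P \<equiv> L_right L v"
abbreviation \<gamma> where "\<gamma> \<equiv> gam v"

lemma \<gamma>_pos: "\<gamma> > 0" using v by (simp add: gam_def)

lemma P_eq: "P = L + \<gamma> * L"
proof -
  have "1 - v \<noteq> 0" using v by simp
  then have "L + \<gamma> * L = ((1 - v) * L + (1 + v) * L) / (1 - v)"
    by (simp only: add_divide_distrib[of "(1 - v) * L"]) (simp add: gam_def)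
  also have "(1 - v) * L + (1 + v) * L = 2 * L" by (simp add: algebra_simps)
  finally show ?thesis by (simp add: L_right_def)
qed

lemma P_gt: "P > L" and P_pos: "P > 0"
  using P_eq mult_pos_pos[OF \<gamma>_pos L] L by linarith+

lemma L_left_eq: "L_left L v = L / \<gamma>" and P_div: "2 * L / (1 + v) = P / \<gamma>"
  using v by (simp_all add: gam_def L_right_def L_left_def)

lemma frequency_right: "(1 - v) * s / L = 2 * s / P"
  and frequency_left: "(1 + v) * s / L = 2 * (\<gamma> * s) / P"
  using v L by (simp_all add: gam_def L_right_def)

text \<open>One period of the derivative of the function \<open>F\<close> in
  \<open>\<phi> (x, t) = F (t + x) - F (\<gamma> (t - x))\<close>.\<close>

definition profile where
  "profile s = (ext_dphi0 L v d s + ext_phi1 L v f s) / 2"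

lemma ext_left:
  assumes "0 < y" "y < L"
  shows "ext_dphi0 L v d (- y / \<gamma>) = \<gamma> * d y" "ext_phi1 L v f (- y / \<gamma>) = - \<gamma> * f y"
proof -
  have "- y / \<gamma> \<in> {- L_left L v<..<0}"
    using assms \<gamma>_pos by (auto simp: L_left_eq field_simps)
  then show "ext_dphi0 L v d (- y / \<gamma>) = \<gamma> * d y" "ext_phi1 L v f (- y / \<gamma>) = - \<gamma> * f y"
    using \<gamma>_pos by (simp_all add: ext_dphi0_def ext_phi1_def)
qed

lemma ext_middle:
  assumes "0 < x" "x < L" shows "ext_dphi0 L v d x = d x" "ext_phi1 L v f x = f x"
  using assms by (auto simp: ext_dphi0_def ext_phi1_def)

lemma profile_middle: "0 < x \<Longrightarrow> x < L \<Longrightarrow> profile x = (d x + f x) / 2"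
  by (simp add: profile_def ext_middle)

lemma profile_right:
  assumes "L < s" "s < P"
  shows "profile s = (d (P / \<gamma> + (- 1 / \<gamma>) * s) - f (P / \<gamma> + (- 1 / \<gamma>) * s)) / (2 * \<gamma>)"
proof -
  have "- s / \<gamma> + 2 * L / (1 + v) = P / \<gamma> + (- 1 / \<gamma>) * s" by (simp add: P_div)
  then show ?thesis
    using assms L \<gamma>_pos by (simp add: profile_def ext_dphi0_def ext_phi1_def field_simps)
qed

lemma reflect_mem: "s \<in> {P - \<gamma> * q..P - \<gamma> * p} \<longleftrightarrow> P / \<gamma> + (- 1 / \<gamma>) * s \<in> {p..q}"
  using \<gamma>_pos by (auto simp: field_simps)

lemma square_integrable_profile: "square_integrable 0 P profile"
proof -
  have m: "square_integrable 0 L (\<lambda>x. (1/2) * d x + (1/2) * f x)"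
    by (rule square_integrable_linear[OF d f])
  have e: "square_integrable 0 L (\<lambda>x. (1 / (2 * \<gamma>)) * d x + (- 1 / (2 * \<gamma>)) * f x)"
    by (rule square_integrable_linear[OF d f])
  let ?e = "\<lambda>x. (1 / (2 * \<gamma>)) * d x + (- 1 / (2 * \<gamma>)) * f x"
  have mem: "s \<in> {L..P} \<longleftrightarrow> P / \<gamma> + (- 1 / \<gamma>) * s \<in> {0..L}" for s
    using reflect_mem[of s L 0] by (simp add: P_eq)
  have r: "profile s = ?e (P / \<gamma> + (- 1 / \<gamma>) * s)" if "L < s" "s < P" for s
    using profile_right[OF that] \<gamma>_pos by (simp add: field_simps)
  have c: "- 1 / \<gamma> \<noteq> 0" using \<gamma>_pos by simp
  have p: "profile x = (1/2) * d x + (1/2) * f x" if "0 < x" "x < L" for x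
    using profile_middle[OF that] by simp
  have "set_integrable lebesgue {0..L} profile" "set_integrable lebesgue {0..L} (\<lambda>x. (profile x)\<^sup>2)"
    using m p set_integral_cong_Ioo(1)[of 0 L profile] set_integral_cong_Ioo(1)[of 0 L "\<lambda>x. (profile x)\<^sup>2"]
    by (simp_all add: square_integrable_def)
  moreover have "set_integrable lebesgue {L..P} profile" "set_integrable lebesgue {L..P} (\<lambda>x. (profile x)\<^sup>2)"
  proof -
    have "set_integrable lebesgue {L..P} (\<lambda>s. ?e (P / \<gamma> + (- 1 / \<gamma>) * s))"
      by (rule iffD2[OF set_integral_affine(1)[OF c mem, of ?e] square_integrableD(1)[OF e]])
    from iffD2[OF set_integral_cong_Ioo(1) this, OF r]
    show "set_integrable lebesgue {L..P} profile" .
    have "set_integrable lebesgue {L..P} (\<lambda>s. (?e (P / \<gamma> + (- 1 / \<gamma>) * s))\<^sup>2)"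
      by (rule iffD2[OF set_integral_affine(1)[OF c mem, of "\<lambda>x. (?e x)\<^sup>2"]
            conjunct2[OF e[unfolded square_integrable_def]]])
    from iffD2[OF set_integral_cong_Ioo(1) this, of "\<lambda>x. (profile x)\<^sup>2"]
    show "set_integrable lebesgue {L..P} (\<lambda>x. (profile x)\<^sup>2)" by (simp only: r)
  qed
  ultimately show ?thesis
    unfolding square_integrable_def by (intro conjI set_integral_split_Icc(1)[of 0 L P]) (use L P_gt in simp_all)
qed

lemma integral_profile_middle:
  assumes "0 \<le> s" "s \<le> L" shows "integral {0..s} profile = (integral {0..s} d + integral {0..s} f) / 2"
proof -
  have di: "set_integrable lebesgue {0..s} d" and fi: "set_integrable lebesgue {0..s} f"
    using square_integrableD(5)[OF d] square_integrableD(5)[OF f] assms by auto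
  have pi: "set_integrable lebesgue {0..s} profile"
    using square_integrableD(5)[OF square_integrable_profile] assms P_gt by auto
  have "(LINT x:{0..s}|lebesgue. profile x) = (LINT x:{0..s}|lebesgue. (d x + f x) / 2)"
    by (rule set_integral_cong_Ioo(2)) (use assms profile_middle in auto)
  also have "\<dots> = ((LINT x:{0..s}|lebesgue. d x) + (LINT x:{0..s}|lebesgue. f x)) / 2"
    using di fi by (simp add: set_integral_add)
  finally show ?thesis using pi di fi by (simp add: set_lebesgue_integral_eq_integral)
qed

text \<open>Together with \<open>integral_profile_middle\<close> this evaluates the antiderivative of the profile
  at \<open>x\<close> and, up to a period, at \<open>- \<gamma> x\<close>: the two arguments that occur at time 0.\<close>

lemma integral_profile_right:
  assumes x: "0 \<le> x" "x \<le> L"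
  shows "integral {0..P - \<gamma> * x} profile
    = (integral {0..L} d + integral {0..L} f) / 2 + (integral {x..L} d - integral {x..L} f) / 2"
proof -
  have di: "set_integrable lebesgue {x..L} d" and fi: "set_integrable lebesgue {x..L} f"
    using square_integrableD(5)[OF d] square_integrableD(5)[OF f] x by auto
  have b: "L \<le> P - \<gamma> * x" "P - \<gamma> * x \<le> P" using x \<gamma>_pos by (auto simp: P_eq)
  have p1: "set_integrable lebesgue {0..L} profile" and p2: "set_integrable lebesgue {L..P - \<gamma> * x} profile"
    using square_integrableD(5)[OF square_integrable_profile] b L by auto
  have mem: "s \<in> {L..P - \<gamma> * x} \<longleftrightarrow> P / \<gamma> + (- 1 / \<gamma>) * s \<in> {x..L}" for s
    using reflect_mem[of s L x] by (simp add: P_eq)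
  have c: "- 1 / \<gamma> \<noteq> 0" using \<gamma>_pos by simp
  have "(LINT s:{L..P - \<gamma> * x}|lebesgue. profile s)
      = (LINT s:{L..P - \<gamma> * x}|lebesgue. (\<lambda>y. (d y - f y) / (2 * \<gamma>)) (P / \<gamma> + (- 1 / \<gamma>) * s))"
    by (rule set_integral_cong_Ioo(2)) (use b profile_right in auto)
  also have "\<dots> = \<gamma> * (LINT y:{x..L}|lebesgue. (d y - f y) / (2 * \<gamma>))"
    using set_integral_affine(2)[OF c mem, of "\<lambda>y. (d y - f y) / (2 * \<gamma>)"] \<gamma>_pos by simp
  also have "\<dots> = ((LINT y:{x..L}|lebesgue. d y) - (LINT y:{x..L}|lebesgue. f y)) / 2"
    using di fi \<gamma>_pos by (simp add: set_integral_diff)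
  finally have "integral {L..P - \<gamma> * x} profile = (integral {x..L} d - integral {x..L} f) / 2"
    using p2 di fi by (simp add: set_lebesgue_integral_eq_integral)
  moreover have "integral {0..P - \<gamma> * x} profile = integral {0..L} profile + integral {L..P - \<gamma> * x} profile"
    using set_integral_split_Icc[OF _ b(1) p1 p2] L p1 p2 by (simp add: set_lebesgue_integral_eq_integral)
  ultimately show ?thesis using integral_profile_middle[of L] L by simp
qed

definition cprofile :: "real \<Rightarrow> complex" where "cprofile s = of_real (profile s)"

lemma cprofile_integrable: "cprofile absolutely_integrable_on {0..P}"
proof -
  have "(complex_of_real \<circ> profile) absolutely_integrable_on {0..P}"
    by (rule absolutely_integrable_linear[OF square_integrableD(1)[OF square_integrable_profile] bounded_linear_of_real])
  then show ?thesis by (simp add: cprofile_def[abs_def] o_def)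
qed

lemma integral_cprofile:
  assumes "0 \<le> s" "s \<le> P" shows "integral {0..s} cprofile = of_real (integral {0..s} profile)"
proof -
  have "profile integrable_on {0..s}"
    by (rule integrable_subinterval_real[OF square_integrableD(2)[OF square_integrable_profile]]) (use assms in auto)
  from has_integral_linear[OF integrable_integral[OF this] bounded_linear_of_real[where 'a = complex]]
  show ?thesis unfolding cprofile_def[abs_def] o_def by (rule integral_unique)
qed

lemma coeff_right_eq:
  "coeff_right L v d f n = 1 / (2 * of_int n * of_real pi * \<i>) * fcoeff P cprofile n"
proof -
  have "(LINT x:{0<..<P}|lebesgue. complex_of_real (ext_dphi0 L v d x + ext_phi1 L v f x) *
        exp (- (of_int n * of_real pi * \<i> * of_real ((1 - v) * x / L))))
    = (LINT x:{0..P}|lebesgue. 2 * (cprofile x * fmode P (- n) x))"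
    unfolding set_integral_Ioo_eq_Icc frequency_right
    by (simp add: cprofile_def profile_def fmode_def)
  also have "\<dots> = 2 * (LINT x:{0..P}|lebesgue. cprofile x * fmode P (- n) x)" by simp
  also have "(LINT x:{0..P}|lebesgue. cprofile x * fmode P (- n) x) = fcoeff P cprofile n"
    unfolding fcoeff_def
    by (intro set_lebesgue_integral_eq_integral absolutely_integrable_mult_continuous cprofile_integrable continuous_fmode)
  finally show ?thesis unfolding coeff_right_def by (cases "n = 0") (simp_all add: field_simps)
qed

text \<open>The integral over \<open>(- L\<^sub>1, 0)\<close> becomes the one over \<open>(0, L)\<close> under \<open>x = - y / \<gamma>\<close>, and the
  integral over \<open>(0, L)\<close> becomes the one over \<open>(L, P)\<close> under \<open>x = (P - s) / \<gamma>\<close>, the exponential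
  being \<open>P\<close>-periodic.\<close>

lemma coeff_left_eq:
  "coeff_left L v d f n = 1 / (2 * of_int n * of_real pi * \<i>) * fcoeff P cprofile n"
proof -
  define k where "k x = complex_of_real (ext_dphi0 L v d x - ext_phi1 L v f x) *
        exp (of_int n * of_real pi * \<i> * of_real ((1 + v) * x / L))" for x
  define g where "g s = cprofile s * fmode P (- n) s" for s
  have g: "set_integrable lebesgue {0..P} g"
    unfolding g_def[abs_def] by (intro absolutely_integrable_mult_continuous cprofile_integrable continuous_fmode)
  have gi: "set_integrable lebesgue {0..L} g" "set_integrable lebesgue {L..P} g"
    by (rule set_integrable_subset[OF g]; use L P_gt in auto)+
  have c: "- 1 / \<gamma> \<noteq> 0" using \<gamma>_pos by simp
  have mem1: "y \<in> {0..L} \<longleftrightarrow> 0 + (- 1 / \<gamma>) * y \<in> {- L_left L v..0}" for y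
    using \<gamma>_pos by (auto simp: L_left_eq field_simps)
  have mem2: "s \<in> {L..P} \<longleftrightarrow> P / \<gamma> + (- 1 / \<gamma>) * s \<in> {0..L}" for s
    using reflect_mem[of s L 0] by (simp add: P_eq)
  have k1: "k (0 + (- 1 / \<gamma>) * y) = (2 * \<gamma>) *\<^sub>R g y" if y: "0 < y" "y < L" for y
  proof -
    have y': "0 + (- 1 / \<gamma>) * y = - y / \<gamma>" by simp
    have "2 * (\<gamma> * (- y / \<gamma>)) / P = 2 * (- y) / P" using \<gamma>_pos by simp
    then have "k (0 + (- 1 / \<gamma>) * y) = complex_of_real (\<gamma> * d y - - \<gamma> * f y) * exp (of_int n * of_real pi * \<i> * of_real (2 * (- y) / P))"
      unfolding y' k_def frequency_left ext_left[OF y] by (simp only:)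
    also have "\<gamma> * d y - - \<gamma> * f y = 2 * \<gamma> * profile y"
      using profile_middle[OF y] by (simp add: algebra_simps)
    also have "exp (of_int n * of_real pi * \<i> * of_real (2 * (- y) / P)) = fmode P (- n) y"
      by (simp add: fmode_def)
    finally show ?thesis by (simp add: g_def cprofile_def scaleR_conv_of_real)
  qed
  have k2: "k (P / \<gamma> + (- 1 / \<gamma>) * s) = (2 * \<gamma>) *\<^sub>R g s" if s: "L < s" "s < P" for s
  proof -
    define x where "x = P / \<gamma> + (- 1 / \<gamma>) * s"
    have "x = (P - s) / \<gamma>" by (simp add: x_def diff_divide_distrib)
    moreover have "0 < (P - s) / \<gamma>" "(P - s) / \<gamma> < L" "\<gamma> * ((P - s) / \<gamma>) = P - s"
      using s \<gamma>_pos P_eq by (simp_all add: pos_divide_less_eq mult.commute)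
    ultimately have x: "0 < x" "x < L" "\<gamma> * x = P - s" by simp_all
    have "k x = complex_of_real (d x - f x) * fmode P n (P - s)"
      unfolding k_def frequency_left ext_middle[OF x(1,2)] x(3) fmode_def ..
    also have "fmode P n (P - s) = fmode P (- n) s"
      using fmode_periodic[of P n "- s" 1] P_pos by (simp add: fmode_def)
    also have "d x - f x = 2 * \<gamma> * profile s"
      using profile_right[OF s] \<gamma>_pos by (simp add: x_def)
    finally show ?thesis by (simp add: x_def g_def cprofile_def scaleR_conv_of_real)
  qed
  have i1: "set_integrable lebesgue {- L_left L v..0} k"
  proof -
    have "set_integrable lebesgue {0..L} (\<lambda>y. (2 * \<gamma>) *\<^sub>R g y)"
      by (rule set_integrable_scaleR_right) (rule gi(1))
    from iffD2[OF set_integral_cong_Ioo(1)[of 0 L "\<lambda>y. k (0 + (- 1 / \<gamma>) * y)" "\<lambda>y. (2 * \<gamma>) *\<^sub>R g y", OF k1] this]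
    show ?thesis by (rule iffD1[OF set_integral_affine(1)[OF c mem1, of k]])
  qed
  have i2: "set_integrable lebesgue {0..L} k"
  proof -
    have "set_integrable lebesgue {L..P} (\<lambda>y. (2 * \<gamma>) *\<^sub>R g y)"
      by (rule set_integrable_scaleR_right) (rule gi(2))
    from iffD2[OF set_integral_cong_Ioo(1)[of L P "\<lambda>y. k (P / \<gamma> + (- 1 / \<gamma>) * y)" "\<lambda>y. (2 * \<gamma>) *\<^sub>R g y", OF k2] this]
    show ?thesis by (rule iffD1[OF set_integral_affine(1)[OF c mem2, of k]])
  qed
  have "(LINT x:{- L_left L v..0}|lebesgue. k x) /\<^sub>R \<bar>- 1 / \<gamma>\<bar> = (LINT y:{0..L}|lebesgue. (2 * \<gamma>) *\<^sub>R g y)"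
    unfolding set_integral_affine(2)[OF c mem1, of k, symmetric] by (rule set_integral_cong_Ioo(2)[OF k1])
  then have v1: "(LINT x:{- L_left L v..0}|lebesgue. k x) = 2 *\<^sub>R (LINT y:{0..L}|lebesgue. g y)"
    using \<gamma>_pos by (simp add: scaleR_conv_of_real field_simps)
  have "(LINT x:{0..L}|lebesgue. k x) /\<^sub>R \<bar>- 1 / \<gamma>\<bar> = (LINT y:{L..P}|lebesgue. (2 * \<gamma>) *\<^sub>R g y)"
    unfolding set_integral_affine(2)[OF c mem2, of k, symmetric] by (rule set_integral_cong_Ioo(2)[OF k2])
  then have v2: "(LINT x:{0..L}|lebesgue. k x) = 2 *\<^sub>R (LINT y:{L..P}|lebesgue. g y)"
    using \<gamma>_pos by (simp add: scaleR_conv_of_real field_simps)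
  have "(LINT x:{- L_left L v<..<L}|lebesgue. k x) = (LINT x:{- L_left L v..0}|lebesgue. k x) + (LINT x:{0..L}|lebesgue. k x)"
    unfolding set_integral_Ioo_eq_Icc
    by (rule set_integral_split_Icc(2)[OF _ _ i1 i2]) (use L \<gamma>_pos in \<open>auto simp: L_left_eq\<close>)
  also have "\<dots> = 2 *\<^sub>R (LINT y:{0..P}|lebesgue. g y)"
    unfolding v1 v2 using set_integral_split_Icc(2)[OF _ _ gi] L P_gt by (simp add: scaleR_add_right)
  also have "(LINT y:{0..P}|lebesgue. g y) = fcoeff P cprofile n"
    using g unfolding fcoeff_def g_def by (rule set_lebesgue_integral_eq_integral(2))
  finally show ?thesis
    unfolding coeff_left_def k_def by (cases "n = 0") (simp_all add: field_simps scaleR_conv_of_real)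
qed

text \<open>The Fourier series of the antiderivative of the profile, up to an additive constant.\<close>

lemma periodic_profile_series:
  assumes mean: "integral {0..L} d = 0"
  obtains F c0 where
    "\<And>s. ((\<lambda>n. coeff_right L v d f n * fmode P n s) has_sum F s) (UNIV - {0})"
    "\<And>s. F (s + P) = F s"
    "\<And>s. 0 \<le> s \<Longrightarrow> s \<le> P \<Longrightarrow> F s = of_real (integral {0..s} profile) - c0"
proof -
  let ?Z = "UNIV - {0::int}"
  define c where "c n = 1 / (2 * of_int n * of_real pi * \<i>) * fcoeff P cprofile n" for n
  have cr: "coeff_right L v d f n = c n" for n by (simp add: c_def coeff_right_eq)
  have "integral {0..P} profile = 0"
    using integral_profile_right[of 0] L mean by simp
  then have mean': "integral {0..P} cprofile = 0" using integral_cprofile[of P] P_pos by simp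
  have "(\<lambda>s. (cmod (cprofile s))\<^sup>2) integrable_on {0..P}"
    using square_integrableD(4)[OF square_integrable_profile] by (simp add: cprofile_def)
  note four = fourier_series_antiderivative[OF P_pos cprofile_integrable this mean', folded c_def]
  obtain c0 where c0: "\<And>s. s \<in> {0..P} \<Longrightarrow> ((\<lambda>n. c n * fmode P n s) has_sum (integral {0..s} cprofile - c0)) ?Z"
    using four(2) by blast
  define F where "F s = (\<Sum>\<^sub>\<infinity>n\<in>?Z. c n * fmode P n s)" for s
  have F: "((\<lambda>n. c n * fmode P n s) has_sum F s) ?Z" for s
    unfolding F_def
    by (rule has_sum_infsum, rule abs_summable_summable) (use four(1) in \<open>simp add: norm_mult\<close>)
  show thesis
  proof (rule that)
    show "((\<lambda>n. coeff_right L v d f n * fmode P n s) has_sum F s) ?Z" for s unfolding cr by (rule F)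
    show "F (s + P) = F s" for s
      unfolding F_def using fmode_periodic[of P _ s 1] P_pos by simp
    show "F s = of_real (integral {0..s} profile) - c0" if "0 \<le> s" "s \<le> P" for s
      using has_sum_unique[OF F c0[of s]] integral_cprofile[OF that] that by simp
  qed
qed

end

section \<open>The series representation\<close>

text \<open>If one of the functions is not integrable, neither is the other, and both integrals are 0.\<close>

lemma lebesgue_integral_spike:
  fixes f g :: "'a::euclidean_space \<Rightarrow> real"
  assumes N: "negligible N" and fg: "\<And>x. x \<notin> N \<Longrightarrow> f x = g x"
  shows "integral\<^sup>L lebesgue f = integral\<^sup>L lebesgue g"
proof (cases "integrable lebesgue f")
  case True
  then have "f absolutely_integrable_on UNIV" by (simp add: set_integrable_def)
  from absolutely_integrable_spike[OF this N, of g] fg have "integrable lebesgue g"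
    by (simp add: set_integrable_def)
  moreover have "AE x in lebesgue. f x = g x"
    by (rule AE_I'[of N]) (use N fg in \<open>auto simp: negligible_iff_null_sets\<close>)
  ultimately show ?thesis using True by (intro integral_cong_AE) auto
next
  case False
  have "\<not> integrable lebesgue g"
  proof
    assume "integrable lebesgue g"
    then have "g absolutely_integrable_on UNIV" by (simp add: set_integrable_def)
    from absolutely_integrable_spike[OF this N, of f] fg False show False
      by (simp add: set_integrable_def)
  qed
  then show ?thesis using False by (simp add: not_integrable_integral_eq)
qed

text \<open>The weak derivative of the data is given for one representative, while the solution
  supplies the continuous one.\<close>

lemma weak_pderiv_AE_cong:
  assumes w: "weak_pderiv \<Omega> b u g" and ae: "AE x in lebesgue. x \<in> \<Omega> \<longrightarrow> u' x = u x"
  shows "weak_pderiv \<Omega> b u' g"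
proof -
  let ?N = "{x. \<not> (x \<in> \<Omega> \<longrightarrow> u' x = u x)}"
  have N: "negligible ?N" by (rule AE_imp_negligible[OF ae])
  have "set_integrable lebesgue K u'" if K: "compact K" "K \<subseteq> \<Omega>" for K
  proof (rule absolutely_integrable_spike[OF _ N])
    show "set_integrable lebesgue K u" using w K by (simp add: weak_pderiv_def locally_integrable_def)
  qed (use K in auto)
  moreover have "(LINT x:\<Omega>|lebesgue. u' x * h x) = (LINT x:\<Omega>|lebesgue. u x * h x)" for h
    unfolding set_lebesgue_integral_def by (rule lebesgue_integral_spike[OF N]) (auto simp: indicator_def)
  ultimately show ?thesis using w by (simp add: weak_pderiv_def locally_integrable_def)
qed

theorem theorem1:
  fixes L v T :: real and \<phi>0 \<phi>0x \<phi>1 :: "real \<Rightarrow> real" and \<phi> :: "real \<times> real \<Rightarrow> real"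
  assumes "L > 0" and "0 < v" and "v < 1" and "T > 0"
    and "\<phi>0 \<in> H10_space (moving_interval L v 0)"
    and "weak_pderiv (moving_interval L v 0) 1 \<phi>0 \<phi>0x"
    and "\<phi>1 \<in> L2_space (moving_interval L v 0)"
    and "weak_solution L v T \<phi>0 \<phi>1 \<phi>"
  shows "\<exists>c :: int \<Rightarrow> complex.
    (\<forall>n. n \<noteq> 0 \<longrightarrow> c n = coeff_right L v \<phi>0x \<phi>1 n \<and> c n = coeff_left L v \<phi>0x \<phi>1 n) \<and>
    (\<forall>t\<in>{0<..<T}. \<forall>x\<in>moving_interval L v t.
       ((\<lambda>n. c n *
          (exp (of_int n * of_real pi * \<i> * of_real ((1 - v) * (t + x) / L))
           - exp (of_int n * of_real pi * \<i> * of_real ((1 + v) * (t - x) / L))))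
        has_sum complex_of_real (\<phi> (x, t))) (UNIV - {0}))"
proof -
  note sol = assms(8)[unfolded weak_solution_def C_H10_def]
  obtain \<phi>x where \<phi>x: "\<forall>t\<in>{0..T}. weak_pderiv (moving_interval L v t) 1 (\<lambda>x. \<phi> (x, t)) (\<lambda>x. \<phi>x (x, t))"
    "C_L2 L v T \<phi>x" using sol by blast
  obtain \<phi>t where \<phi>t: "weak_pderiv (spacetime L v T) (0, 1) \<phi> \<phi>t" "C_L2 L v T \<phi>t"
    "AE x in lebesgue. x \<in> moving_interval L v 0 \<longrightarrow> \<phi>t (x, 0) = \<phi>1 x" using sol by blast
  have I0: "moving_interval L v 0 = {0<..<L}" by (simp add: moving_interval_def)
  interpret strip_wave L v T \<phi> \<phi>x \<phi>t \<phi>1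
    using assms \<phi>x \<phi>t sol by unfold_locales blast+
  \<comment> \<open>The given derivative of the data agrees almost everywhere with the square-integrable
    derivative of the initial slice.\<close>
  have "weak_pderiv {0<..<L} 1 (\<lambda>x. \<phi> (x, 0)) \<phi>0x"
    by (rule weak_pderiv_AE_cong[OF assms(6)[unfolded I0]]) (use sol I0 in auto)
  moreover have "weak_pderiv {0<..<L} 1 (\<lambda>x. \<phi> (x, 0)) (\<lambda>x. \<phi>x (x, 0))"
    using \<phi>x[of 0] T I0 by simp
  moreover have "continuous_on {0<..<L} (\<lambda>x. \<phi> (x, 0))"
  proof -
    have "continuous_on {0..L} (\<lambda>x. \<phi> (x, 0))" using slice_cont[of 0] T by simp
    then show ?thesis by (rule continuous_on_subset) auto
  qed
  ultimately have ae: "AE x in lebesgue. x \<in> {0<..<L} \<longrightarrow> \<phi>x (x, 0) = \<phi>0x x"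
    using weak_derivative_unique by blast
  have \<phi>x0: "square_integrable 0 L (\<lambda>x. \<phi>x (x, 0))"
    using slice_square_integrable(1)[OF \<phi>x_L2, of 0] T by simp
  have d: "square_integrable 0 L \<phi>0x" by (rule square_integrable_AE_cong[OF \<phi>x0 ae])
  interpret reflected_data L v \<phi>0x \<phi>1
    by unfold_locales (rule L v d \<phi>1_square_integrable)+
  have inc: "integral {p..q} \<phi>0x = \<phi> (q, 0) - \<phi> (p, 0)" if "0 \<le> p" "p \<le> q" "q \<le> L" for p q
  proof -
    have "integral {p..q} \<phi>0x = integral {p..q} (\<lambda>x. \<phi>x (x, 0))"
    proof (rule set_integrable_AE_cong(2))
      show "set_integrable lebesgue {p..q} (\<lambda>x. \<phi>x (x, 0))"
        by (rule square_integrableD(5)[OF \<phi>x0]) (use that in auto)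
      show "AE x in lebesgue. x \<in> {p<..<q} \<longrightarrow> \<phi>x (x, 0) = \<phi>0x x"
        using ae by eventually_elim (use that in auto)
    qed
    then show ?thesis using slice_increment[of 0 p q] that T by (simp add: integral_unique)
  qed
  have ends: "\<phi> (0, 0) = 0" "\<phi> (L, 0) = 0" using sides_closed[of 0] T by auto
  \<comment> \<open>Vanishing of the data at both ends is what makes the antiderivative of the profile periodic.\<close>
  have mean: "integral {0..L} \<phi>0x = 0" using inc[of 0 L] ends L by simp
  obtain F c0 where F: "\<And>s. ((\<lambda>n. coeff_right L v \<phi>0x \<phi>1 n * fmode P n s) has_sum F s) (UNIV - {0})"
    and Fper: "\<And>s. F (s + P) = F s"
    and Fval: "\<And>s. 0 \<le> s \<Longrightarrow> s \<le> P \<Longrightarrow> F s = of_real (integral {0..s} profile) - c0"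
    by (rule periodic_profile_series[OF mean]) blast
  \<comment> \<open>The constant \<open>c0\<close> cancels between the two terms with \<open>F\<close>.\<close>
  define w where "w p = complex_of_real (\<phi> p) - (F (snd p + fst p) - F (\<gamma> * (snd p - fst p)))" for p
  have zero: "w (x, t) = 0" if "in_strip L v T x t" for x t
  proof (rule char_additive_zero[OF L v _ _ _ _ that])
    have "w (x, t) + w (x + b - a, t - a - b) = w (x - a, t - a) + w (x + b, t - b)"
      if "\<phi> (x, t) + \<phi> (x + b - a, t - a - b) = \<phi> (x - a, t - a) + \<phi> (x + b, t - b)" for x t a b
    proof -
      have "complex_of_real (\<phi> (x, t)) + of_real (\<phi> (x + b - a, t - a - b))
          = of_real (\<phi> (x - a, t - a)) + of_real (\<phi> (x + b, t - b))"
        using that by (metis of_real_add)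
      moreover have "t - a - b + (x + b - a) = t - a + (x - a)" "t - b + (x + b) = t + x"
        "t - a - b - (x + b - a) = t - b - (x + b)" "t - a - (x - a) = t - x" by simp_all
      ultimately show ?thesis by (simp add: w_def algebra_simps)
    qed
    then show "char_additive L v T w"
      using char_additive_solution unfolding char_additive_def by blast
    fix t assume t: "0 \<le> t" "t \<le> T"
    have \<gamma>v: "\<gamma> * (1 - v) = 1 + v" using v by (simp add: gam_def)
    have "\<gamma> * (t - v * t) = t + v * t" using \<gamma>v by (metis mult.commute mult.left_commute left_diff_distrib distrib_right mult_1)
    then show "w (v * t, t) = 0" using sides_closed(1)[OF t] by (simp add: w_def)
    have "\<gamma> * (t - (L + v * t)) + P = t + (L + v * t)"
      using \<open>\<gamma> * (t - v * t) = t + v * t\<close> by (simp add: P_eq algebra_simps)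
    then show "w (L + v * t, t) = 0"
      using sides_closed(2)[OF t] Fper[of "\<gamma> * (t - (L + v * t))"] by (simp add: w_def)
  next
    fix x t assume t: "0 \<le> t" "t \<le> T" and x: "0 \<le> x - t" "x + t \<le> L"
    let ?\<xi> = "x + t" and ?\<eta> = "x - t"
    have le: "?\<eta> \<le> ?\<xi>" "?\<eta> \<le> L" "0 \<le> ?\<xi>" using t x by auto
    have i1: "\<phi>1 integrable_on {p..q}" if "0 \<le> p" "q \<le> L" for p q
      by (rule integrable_subinterval_real[OF square_integrableD(2)[OF \<phi>1_square_integrable]]) (use that in auto)
    have s1: "integral {0..?\<xi>} \<phi>1 = integral {0..?\<eta>} \<phi>1 + integral {?\<eta>..?\<xi>} \<phi>1"
      using Henstock_Kurzweil_Integration.integral_combine[OF x(1) le(1) i1] x by simp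
    have s2: "integral {0..L} \<phi>1 = integral {0..?\<eta>} \<phi>1 + integral {?\<eta>..L} \<phi>1"
      using Henstock_Kurzweil_Integration.integral_combine[OF x(1) le(2) i1] x by simp
    have "F ?\<xi> = of_real ((\<phi> (?\<xi>, 0) + integral {0..?\<xi>} \<phi>1) / 2) - c0"
      using Fval[of ?\<xi>] integral_profile_middle[of ?\<xi>] inc[of 0 ?\<xi>] ends x le P_gt by simp
    moreover have "F (\<gamma> * (t - x)) = of_real ((integral {0..?\<eta>} \<phi>1 - \<phi> (?\<eta>, 0)) / 2) - c0"
    proof -
      have "\<gamma> * ?\<eta> \<le> \<gamma> * L" using le \<gamma>_pos by (intro mult_left_mono) auto
      moreover have "0 \<le> \<gamma> * ?\<eta>" using x \<gamma>_pos by (intro mult_nonneg_nonneg) auto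
      ultimately have b: "0 \<le> P - \<gamma> * ?\<eta>" "P - \<gamma> * ?\<eta> \<le> P" using P_eq L by linarith+
      have "\<gamma> * (t - x) + P = P - \<gamma> * ?\<eta>" by (simp add: algebra_simps)
      then have "F (\<gamma> * (t - x)) = of_real (integral {0..P - \<gamma> * ?\<eta>} profile) - c0"
        using Fper[of "\<gamma> * (t - x)"] Fval[OF b] by simp
      also have "integral {0..P - \<gamma> * ?\<eta>} profile = (integral {0..?\<eta>} \<phi>1 - \<phi> (?\<eta>, 0)) / 2"
        unfolding integral_profile_right[OF x(1) le(2)] mean s2 inc[OF x(1) le(2) order_refl] ends
        by (simp add: field_simps)
      finally show ?thesis .
    qed
    moreover have "\<phi> (x, t) = (\<phi> (?\<xi>, 0) + integral {0..?\<xi>} \<phi>1) / 2 - (integral {0..?\<eta>} \<phi>1 - \<phi> (?\<eta>, 0)) / 2"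
      using dalembert[OF t x] s1 by (simp add: field_simps)
    ultimately show "w (x, t) = 0" by (simp add: w_def add.commute)
  qed
  show ?thesis
  proof (intro exI[of _ "coeff_right L v \<phi>0x \<phi>1"] conjI allI impI ballI)
    fix n show "coeff_right L v \<phi>0x \<phi>1 n = coeff_left L v \<phi>0x \<phi>1 n"
      unfolding coeff_right_eq coeff_left_eq ..
  next
    fix t x assume "t \<in> {0<..<T}" "x \<in> moving_interval L v t"
    then have "in_strip L v T x t" by (auto simp: in_strip_def moving_interval_def)
    then have "complex_of_real (\<phi> (x, t)) = F (t + x) - F (\<gamma> * (t - x))"
      using zero[of x t] by (simp add: w_def)
    moreover have "((\<lambda>n. coeff_right L v \<phi>0x \<phi>1 n * fmode P n (t + x) - coeff_right L v \<phi>0x \<phi>1 n * fmode P n (\<gamma> * (t - x)))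
        has_sum (F (t + x) - F (\<gamma> * (t - x)))) (UNIV - {0})"
    proof -
      have "((\<lambda>n. - (coeff_right L v \<phi>0x \<phi>1 n * fmode P n s)) has_sum - F s) (UNIV - {0})" for s
        using F[of s] by (simp add: has_sum_uminus)
      from has_sum_add[OF F this] show ?thesis by simp
    qed
    ultimately show "((\<lambda>n. coeff_right L v \<phi>0x \<phi>1 n *
          (exp (of_int n * of_real pi * \<i> * of_real ((1 - v) * (t + x) / L))
           - exp (of_int n * of_real pi * \<i> * of_real ((1 + v) * (t - x) / L))))
        has_sum complex_of_real (\<phi> (x, t))) (UNIV - {0})"
      unfolding frequency_right frequency_left fmode_def by (simp only: right_diff_distrib)
  qed simp
qed

end
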